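(* Let $\mathcal L$ be a finite relational language and $M$ an infinite mutually algebraic $\mathcal L$-structure. The following are equivalent: (1) $M$ is cellular; (2) $M$ is $\omega$-categorical; (3) there is a uniform finite bound on $|\mathrm{acl}(a)|$ for all $a\in M$; (4) for every finitely MA-presented structure $M'$ associated to $M$, there is a uniform finite bound on $|[a]_\sim|$ for $a\in M'$; (5) for some finitely MA-presented structure $M'$ associated to $M$, there is a uniform finite bound on $|[a]_\sim|$ for $a\in M'$.
   Context: Languages have only relation and constant symbols. A relation $R\subseteq M^n$ is mutually algebraic if there is $K$ with each $m\in M$ occurring in at most $K$ tuples of $R$; a formula is mutually algebraic if the relation it defines is. $M$ is mutually algebraic if every formula with parameters from $M$ is equivalent in $M$ to a boolean combination of mutually algebraic formulas with parameters. A structure is MA-presented if every atomic formula is mutually algebraic, and finitely MA-presented if in addition its language is finite relational. In an MA-presented structure, $b$ is a mate of $a$ if some atomic formula holds on a tuple (in some order) containing $a$ and $b$; $\sim$ is the transitive closure of the mate relation, $[a]_\sim$ the class of $a$. For $\mathcal L\subseteq\mathcal L^*$, an $\mathcal L^*$-structure $M^*$ is a q.f. expansion by definitions of the $\mathcal L$-structure $M$ if it has the same universe, expands $M$, and every atomic $\mathcal L^*$-formula is equivalent in $M^*$ to a quantifier-free $\mathcal L$-formula with parameters from $M$. An $\mathcal L_1$-structure $M_1$ and an $\mathcal L_2$-structure $M_2$ with the same universe are associated if there is an $\mathcal L_1\cup\mathcal L_2$-structure with that universe which is a q.f. expansion by definitions of both. Cellular: $M$ admits a partition $\{K\}\cup\{\bar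 c_{i,j}:i\in[n],j\in\omega\}$ with $K$ finite, $\bar c_{i,j}$ of length $k_i$, tuples with the same $i$ pairwise isomorphic over $K$, and for every $i$ and permutation $\sigma$ of $\omega$ an automorphism of $M$ sending $\bar c_{i,j}$ coordinatewise to $\bar c_{i,\sigma(j)}$ and fixing everything outside $\bigcup_j\bar c_{i,j}$ pointwise.
   Formalization: M is taken to be countably infinite rather than just infinite: a cellular structure is countable by definition, so an uncountable pure set (mutually algebraic, satisfying (2)–(5) but not (1)) refutes the statement as worded. *)

theory Defs
  imports Main "HOL-Library.Countable_Set"
begin

text \<open>
  A symbol carries its kind and its arity, so that a language is just a set of symbols and inclusion
  and union of languages are the set operations. Names come from a countably infinite supply.
\<close>

datatype symbol =
    RelSym (name: nat) (arity: nat)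
  | ConstSym (name: nat)

type_synonym language = "symbol set"

definition relational :: "language \<Rightarrow> bool" where
  "relational L \<longleftrightarrow> (\<forall>c. ConstSym c \<notin> L)"

text \<open>
  Elements of the universe may occur in formulas as parameters, through \<open>Param\<close>.
  In \<open>Rel r ts\<close> the relation symbol is \<open>RelSym r (length ts)\<close>.
\<close>

datatype (tparams: 'a) trm = Var nat | Const nat | Param 'a

datatype (params: 'a) fm =
    Eq "'a trm" "'a trm"
  | Rel nat "'a trm list"
  | Neg "'a fm"
  | And "'a fm" "'a fm"
  | Exists nat "'a fm"

fun tfv :: "'a trm \<Rightarrow> nat set" where
  "tfv (Var x) = {x}"
| "tfv (Const c) = {}"
| "tfv (Param a) = {}"

fun fv :: "'a fm \<Rightarrow> nat set" where
  "fv (Eq s t) = tfv s \<union> tfv t"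
| "fv (Rel r ts) = (\<Union>t\<in>set ts. tfv t)"
| "fv (Neg \<phi>) = fv \<phi>"
| "fv (And \<phi> \<psi>) = fv \<phi> \<union> fv \<psi>"
| "fv (Exists x \<phi>) = fv \<phi> - {x}"

fun tsymbols :: "'a trm \<Rightarrow> symbol set" where
  "tsymbols (Var x) = {}"
| "tsymbols (Const c) = {ConstSym c}"
| "tsymbols (Param a) = {}"

fun symbols :: "'a fm \<Rightarrow> symbol set" where
  "symbols (Eq s t) = tsymbols s \<union> tsymbols t"
| "symbols (Rel r ts) = insert (RelSym r (length ts)) (\<Union>t\<in>set ts. tsymbols t)"
| "symbols (Neg \<phi>) = symbols \<phi>"
| "symbols (And \<phi> \<psi>) = symbols \<phi> \<union> symbols \<psi>"
| "symbols (Exists x \<phi>) = symbols \<phi>"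

fun atomic :: "'a fm \<Rightarrow> bool" where
  "atomic (Eq s t) \<longleftrightarrow> True"
| "atomic (Rel r ts) \<longleftrightarrow> True"
| "atomic _ \<longleftrightarrow> False"

fun qfree :: "'a fm \<Rightarrow> bool" where
  "qfree (Eq s t) \<longleftrightarrow> True"
| "qfree (Rel r ts) \<longleftrightarrow> True"
| "qfree (Neg \<phi>) \<longleftrightarrow> qfree \<phi>"
| "qfree (And \<phi> \<psi>) \<longleftrightarrow> qfree \<phi> \<and> qfree \<psi>"
| "qfree (Exists x \<phi>) \<longleftrightarrow> False"

definition formulas :: "language \<Rightarrow> 'a set \<Rightarrow> 'a fm set" where
  "formulas L A = {\<phi>. symbols \<phi> \<subseteq> L \<and> params \<phi> \<subseteq> A}"

text \<open>
  \<open>rel_of M r n\<close> interprets \<open>RelSym r n\<close>. The values of \<open>rel_of\<close> and \<open>const_of\<close> at symbols outside the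
  language under consideration are irrelevant.
\<close>

record 'a struct =
  univ :: "'a set"
  rel_of :: "nat \<Rightarrow> nat \<Rightarrow> 'a list set"
  const_of :: "nat \<Rightarrow> 'a"

definition is_structure :: "language \<Rightarrow> 'a struct \<Rightarrow> bool" where
  "is_structure L M \<longleftrightarrow> univ M \<noteq> {} \<and>
     (\<forall>r n. RelSym r n \<in> L \<longrightarrow> rel_of M r n \<subseteq> {xs. length xs = n \<and> set xs \<subseteq> univ M}) \<and>
     (\<forall>c. ConstSym c \<in> L \<longrightarrow> const_of M c \<in> univ M)"

fun tval :: "'a struct \<Rightarrow> (nat \<Rightarrow> 'a) \<Rightarrow> 'a trm \<Rightarrow> 'a" where
  "tval M e (Var x) = e x"
| "tval M e (Const c) = const_of M c"
| "tval M e (Param a) = a"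

fun sat :: "'a struct \<Rightarrow> (nat \<Rightarrow> 'a) \<Rightarrow> 'a fm \<Rightarrow> bool" where
  "sat M e (Eq s t) \<longleftrightarrow> tval M e s = tval M e t"
| "sat M e (Rel r ts) \<longleftrightarrow> map (tval M e) ts \<in> rel_of M r (length ts)"
| "sat M e (Neg \<phi>) \<longleftrightarrow> \<not> sat M e \<phi>"
| "sat M e (And \<phi> \<psi>) \<longleftrightarrow> sat M e \<phi> \<and> sat M e \<psi>"
| "sat M e (Exists x \<phi>) \<longleftrightarrow> (\<exists>a\<in>univ M. sat M (e(x := a)) \<phi>)"

definition assignments :: "'a struct \<Rightarrow> (nat \<Rightarrow> 'a) set" where
  "assignments M = {e. range e \<subseteq> univ M}"

definition holds :: "'a struct \<Rightarrow> 'a fm \<Rightarrow> bool" where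
  "holds M \<phi> \<longleftrightarrow> (\<forall>e\<in>assignments M. sat M e \<phi>)"

definition equivalent :: "'a struct \<Rightarrow> 'a fm \<Rightarrow> 'a fm \<Rightarrow> bool" where
  "equivalent M \<phi> \<psi> \<longleftrightarrow> (\<forall>e\<in>assignments M. sat M e \<phi> \<longleftrightarrow> sat M e \<psi>)"

text \<open>
  The relation defined by a formula, its free variables being listed in increasing order. Parameters
  are not entries of the tuples.
\<close>

definition defined_rel :: "'a struct \<Rightarrow> 'a fm \<Rightarrow> 'a list set" where
  "defined_rel M \<phi> = {map e (sorted_list_of_set (fv \<phi>)) | e. e \<in> assignments M \<and> sat M e \<phi>}"

definition is_iso :: "language \<Rightarrow> ('a \<Rightarrow> 'b) \<Rightarrow> 'a struct \<Rightarrow> 'b struct \<Rightarrow> bool" where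
  "is_iso L h M N \<longleftrightarrow> bij_betw h (univ M) (univ N) \<and>
     (\<forall>r n xs. RelSym r n \<in> L \<and> length xs = n \<and> set xs \<subseteq> univ M \<longrightarrow>
        (xs \<in> rel_of M r n \<longleftrightarrow> map h xs \<in> rel_of N r n)) \<and>
     (\<forall>c. ConstSym c \<in> L \<longrightarrow> h (const_of M c) = const_of N c)"

definition Th :: "language \<Rightarrow> 'a struct \<Rightarrow> 'a fm set" where
  "Th L M = {\<phi> \<in> formulas L {}. fv \<phi> = {} \<and> holds M \<phi>}"

definition countable_models :: "language \<Rightarrow> 'a fm set \<Rightarrow> 'a struct set" where
  "countable_models L T =
     {N. is_structure L N \<and> countable (univ N) \<and> infinite (univ N) \<and> (\<forall>\<phi>\<in>T. holds N \<phi>)}"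

text \<open>
  Models are taken with universe inside the type \<open>'a\<close>. If \<open>M\<close> is infinite then so is \<open>'a\<close>, hence every
  countable model of the theory of \<open>M\<close> has an isomorphic copy of this kind.
\<close>

definition omega_categorical :: "language \<Rightarrow> 'a struct \<Rightarrow> bool" where
  "omega_categorical L M \<longleftrightarrow> countable_models L (Th L M) \<noteq> {} \<and>
     (\<forall>N\<in>countable_models L (Th L M). \<forall>N'\<in>countable_models L (Th L M). \<exists>h. is_iso L h N N')"

text \<open>
  Since \<open>fv \<phi> \<subseteq> {x}\<close>, a constant assignment \<open>\<lambda>_. b\<close> evaluates \<open>\<phi>\<close> at \<open>b\<close>.
\<close>

definition acl :: "language \<Rightarrow> 'a struct \<Rightarrow> 'a set \<Rightarrow> 'a set" where
  "acl L M A = {b \<in> univ M. \<exists>\<phi>\<in>formulas L A. \<exists>x. fv \<phi> \<subseteq> {x} \<and>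
     sat M (\<lambda>_. b) \<phi> \<and> finite {c \<in> univ M. sat M (\<lambda>_. c) \<phi>}}"

definition uniformly_finite :: "'a set \<Rightarrow> ('a \<Rightarrow> 'b set) \<Rightarrow> bool" where
  "uniformly_finite A F \<longleftrightarrow> (\<exists>K::nat. \<forall>a\<in>A. finite (F a) \<and> card (F a) \<le> K)"

definition mutually_algebraic_rel :: "'a set \<Rightarrow> 'a list set \<Rightarrow> bool" where
  "mutually_algebraic_rel A R \<longleftrightarrow> uniformly_finite A (\<lambda>m. {t \<in> R. m \<in> set t})"

definition mutually_algebraic_fm :: "'a struct \<Rightarrow> 'a fm \<Rightarrow> bool" where
  "mutually_algebraic_fm M \<phi> \<longleftrightarrow> mutually_algebraic_rel (univ M) (defined_rel M \<phi>)"

inductive_set boolean_combinations :: "'a fm set \<Rightarrow> 'a fm set" for S where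
  "\<phi> \<in> S \<Longrightarrow> \<phi> \<in> boolean_combinations S"
| "\<phi> \<in> boolean_combinations S \<Longrightarrow> Neg \<phi> \<in> boolean_combinations S"
| "\<phi> \<in> boolean_combinations S \<Longrightarrow> \<psi> \<in> boolean_combinations S \<Longrightarrow>
     And \<phi> \<psi> \<in> boolean_combinations S"

definition mutually_algebraic :: "language \<Rightarrow> 'a struct \<Rightarrow> bool" where
  "mutually_algebraic L M \<longleftrightarrow> (\<forall>\<phi>\<in>formulas L (univ M).
     \<exists>\<psi>\<in>boolean_combinations {\<theta> \<in> formulas L (univ M). mutually_algebraic_fm M \<theta>}.
       equivalent M \<phi> \<psi>)"

definition MA_presented :: "language \<Rightarrow> 'a struct \<Rightarrow> bool" where
  "MA_presented L M \<longleftrightarrow> is_structure L M \<and>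
     (\<forall>\<phi>\<in>formulas L {}. atomic \<phi> \<longrightarrow> mutually_algebraic_fm M \<phi>)"

definition finitely_MA_presented :: "language \<Rightarrow> 'a struct \<Rightarrow> bool" where
  "finitely_MA_presented L M \<longleftrightarrow> MA_presented L M \<and> finite L \<and> relational L"

definition mates :: "language \<Rightarrow> 'a struct \<Rightarrow> ('a \<times> 'a) set" where
  "mates L M = {(a, b). \<exists>\<phi>\<in>formulas L {}. atomic \<phi> \<and>
     (\<exists>t\<in>defined_rel M \<phi>. a \<in> set t \<and> b \<in> set t)}"

text \<open>
  Equations are atomic, so every element is a mate of itself and \<open>mates\<close> is reflexive on the universe.
\<close>

definition ma_class :: "language \<Rightarrow> 'a struct \<Rightarrow> 'a \<Rightarrow> 'a set" where
  "ma_class L M a = (mates L M)\<^sup>+ `` {a}"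

definition qf_expansion :: "language \<Rightarrow> 'a struct \<Rightarrow> language \<Rightarrow> 'a struct \<Rightarrow> bool" where
  "qf_expansion L M L' M' \<longleftrightarrow> L \<subseteq> L' \<and> is_structure L M \<and> is_structure L' M' \<and>
     univ M' = univ M \<and>
     (\<forall>r n. RelSym r n \<in> L \<longrightarrow> rel_of M' r n = rel_of M r n) \<and>
     (\<forall>c. ConstSym c \<in> L \<longrightarrow> const_of M' c = const_of M c) \<and>
     (\<forall>\<phi>\<in>formulas L' {}. atomic \<phi> \<longrightarrow>
        (\<exists>\<psi>\<in>formulas L (univ M). qfree \<psi> \<and> equivalent M' \<phi> \<psi>))"

definition associated :: "language \<Rightarrow> 'a struct \<Rightarrow> language \<Rightarrow> 'a struct \<Rightarrow> bool" where
  "associated L1 M1 L2 M2 \<longleftrightarrow>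
     (\<exists>N. qf_expansion L1 M1 (L1 \<union> L2) N \<and> qf_expansion L2 M2 (L1 \<union> L2) N)"

definition induced :: "'a struct \<Rightarrow> 'a set \<Rightarrow> 'a struct" where
  "induced M A = M\<lparr>univ := A, rel_of := (\<lambda>r n. {xs \<in> rel_of M r n. set xs \<subseteq> A})\<rparr>"

definition isomorphic_over ::
  "language \<Rightarrow> 'a struct \<Rightarrow> 'a set \<Rightarrow> 'a list \<Rightarrow> 'a list \<Rightarrow> bool" where
  "isomorphic_over L M K xs ys \<longleftrightarrow>
     (\<exists>h. is_iso L h (induced M (K \<union> set xs)) (induced M (K \<union> set ys)) \<and>
          (\<forall>a\<in>K. h a = a) \<and> map h xs = ys)"

text \<open>
  The set \<open>K\<close> may be empty; the tuples are nonempty and without repetitions.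
\<close>

definition cellular_partition ::
  "'a struct \<Rightarrow> 'a set \<Rightarrow> nat \<Rightarrow> (nat \<Rightarrow> nat) \<Rightarrow> (nat \<Rightarrow> nat \<Rightarrow> 'a list) \<Rightarrow> bool" where
  "cellular_partition M K n k c \<longleftrightarrow> finite K \<and>
     (\<forall>i<n. 0 < k i \<and> (\<forall>j. length (c i j) = k i \<and> distinct (c i j))) \<and>
     K \<union> (\<Union>i<n. \<Union>j. set (c i j)) = univ M \<and>
     (\<forall>i<n. \<forall>j. K \<inter> set (c i j) = {}) \<and>
     (\<forall>i<n. \<forall>i'<n. \<forall>j j'. (i, j) \<noteq> (i', j') \<longrightarrow> set (c i j) \<inter> set (c i' j') = {})"

definition cellular :: "language \<Rightarrow> 'a struct \<Rightarrow> bool" where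
  "cellular L M \<longleftrightarrow> (\<exists>K n k c. cellular_partition M K n k c \<and>
     (\<forall>i<n. \<forall>j j'. isomorphic_over L M K (c i j) (c i j')) \<and>
     (\<forall>i<n. \<forall>\<sigma>::nat \<Rightarrow> nat. bij \<sigma> \<longrightarrow>
        (\<exists>f. is_iso L f M M \<and> (\<forall>j. map f (c i j) = c i (\<sigma> j)) \<and>
             (\<forall>a\<in>univ M - (\<Union>j. set (c i j)). f a = a))))"

end

theory Submission
  imports Defs "HOL-Library.FuncSet"
begin

text \<open>
  (1) implies (2): automorphisms move every $n$-tuple of a cellular structure into a fixed finite
  set, so there are finitely many $n$-types, and back-and-forth between countable models applies.

  (2) implies (3): if there were infinitely many $n$-types, generic models over finitely supported
  conditions would realize, respectively omit, a non-isolated type. With finitely many 2-types the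
  algebraic closure of a point is finite, and its size depends only on the 1-type of the point.

  (3) implies (4): the mate relation of $M'$ is a graph of bounded degree definable in $M$ with
  parameters. If its components are unbounded, the parameters can be eliminated one by one, and a
  parameter-free definable graph of bounded degree with large components makes
  $|\mathrm{acl}(a)|$ unbounded.

  (4) implies (5) is the existence of an associated finitely MA-presented structure, that is, mutually
  algebraic pieces that are quantifier-free definable.

  (5) implies (1): bounded classes have finitely many isomorphism types; the types that occur
  infinitely often, away from the parameters of the association, give the cells.
\<close>

section \<open>Satisfaction and definability\<close>

text \<open>Association asks for quantifier-free definitions, while mutual algebraicity supplies
  pieces defined by arbitrary formulas. The bridge: a relation at a tuple that falls into two
  non-adjacent parts depends only on the types of the parts, and this dependence can be tested
  without quantifiers by replacing one part with finitely many fixed tuples as parameters. In (3)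
  only \<open>a\<close> itself may be a parameter, whereas the mate relation may need others.
  Letting such a parameter vary can make the degree infinite; if infinitely many elements resemble
  it, an edge is kept only if it occurs for more of them than can be adjacent to its ends.
  Components are not first-order, so finite trees of prescribed size take their place. Genericity is
  measured by an ideal of small sets of types: the finite sets when a non-isolated type is to be
  realized, only the empty set when it is to be omitted.\<close>

lemma finite_tfv [simp]: "finite (tfv t)"
  by (cases t) auto

lemma finite_fv [simp]: "finite (fv \<phi>)"
  by (induction \<phi>) auto

lemma tval_cong: "(\<forall>x\<in>tfv t. e x = e' x) \<Longrightarrow> tval M e t = tval M e' t"
  by (cases t) auto

lemma sat_cong: "(\<forall>x\<in>fv \<phi>. e x = e' x) \<Longrightarrow> sat M e \<phi> \<longleftrightarrow> sat M e' \<phi>"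
proof (induction \<phi> arbitrary: e e')
  case (Eq s t)
  then have "tval M e s = tval M e' s" "tval M e t = tval M e' t"
    by (auto intro!: tval_cong)
  then show ?case by simp
next
  case (Rel r ts)
  then have "map (tval M e) ts = map (tval M e') ts"
    by (auto intro!: tval_cong)
  then show ?case by (simp del: map_eq_conv)
next
  case (Exists x \<phi>)
  have "sat M (e(x := a)) \<phi> \<longleftrightarrow> sat M (e'(x := a)) \<phi>" for a
    by (rule Exists.IH) (use Exists.prems in auto)
  then show ?case by simp
next
  case (And \<phi> \<psi>)
  then show ?case by (metis UnI1 UnI2 fv.simps(4) sat.simps(4))
qed auto

lemma assignmentsI: "(\<And>x. e x \<in> univ M) \<Longrightarrow> e \<in> assignments M"
  by (auto simp: assignments_def)

lemma assignmentsD [simp]: "e \<in> assignments M \<Longrightarrow> e x \<in> univ M"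
  by (auto simp: assignments_def)

lemma assignments_upd [simp]: "e \<in> assignments M \<Longrightarrow> a \<in> univ M \<Longrightarrow> e(x := a) \<in> assignments M"
  by (auto simp: assignments_def)

lemma assignments_comp [simp]: "e \<in> assignments M \<Longrightarrow> (\<lambda>x. e (\<rho> x)) \<in> assignments M"
  by (auto simp: assignments_def)

lemma assignments_const [simp]: "a \<in> univ M \<Longrightarrow> (\<lambda>_. a) \<in> assignments M"
  by (auto simp: assignments_def)

lemma assignments_if [simp]:
  "e \<in> assignments M \<Longrightarrow> e' \<in> assignments M \<Longrightarrow> (\<lambda>x. if Q x then e x else e' x) \<in> assignments M"
  by (auto simp: assignments_def)

lemma formulas_simps [simp]:
  "Neg \<phi> \<in> formulas L A \<longleftrightarrow> \<phi> \<in> formulas L A"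
  "And \<phi> \<psi> \<in> formulas L A \<longleftrightarrow> \<phi> \<in> formulas L A \<and> \<psi> \<in> formulas L A"
  "Exists x \<phi> \<in> formulas L A \<longleftrightarrow> \<phi> \<in> formulas L A"
  "Eq (Var x) (Var y) \<in> formulas L A"
  "Eq (Var x) (Param a) \<in> formulas L A \<longleftrightarrow> a \<in> A"
  by (auto simp: formulas_def)

lemma formulas_mono: "\<phi> \<in> formulas L A \<Longrightarrow> A \<subseteq> B \<Longrightarrow> \<phi> \<in> formulas L B"
  by (auto simp: formulas_def)

text \<open>Predicates on assignments take the place of formulas, so that closure properties can be
  proved up to equivalence. The class \<open>\<Phi>\<close> is left open to cover both all formulas
  over a parameter set and the quantifier-free ones.\<close>

definition definable_by :: "'a fm set \<Rightarrow> 'a struct \<Rightarrow> ((nat \<Rightarrow> 'a) \<Rightarrow> bool) \<Rightarrow> bool" where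
  "definable_by \<Phi> M P \<longleftrightarrow> (\<exists>\<phi>\<in>\<Phi>. \<forall>e\<in>assignments M. P e \<longleftrightarrow> sat M e \<phi>)"

definition bool_closed :: "'a fm set \<Rightarrow> bool" where
  "bool_closed \<Phi> \<longleftrightarrow> \<Phi> \<noteq> {} \<and> (\<forall>\<phi>\<in>\<Phi>. Neg \<phi> \<in> \<Phi>) \<and> (\<forall>\<phi>\<in>\<Phi>. \<forall>\<psi>\<in>\<Phi>. And \<phi> \<psi> \<in> \<Phi>)"

lemma definable_by_cong:
  "(\<And>e. e \<in> assignments M \<Longrightarrow> P e \<longleftrightarrow> P' e) \<Longrightarrow> definable_by \<Phi> M P \<longleftrightarrow> definable_by \<Phi> M P'"
  by (auto simp: definable_by_def)

lemma definable_by_sat: "\<phi> \<in> \<Phi> \<Longrightarrow> definable_by \<Phi> M (\<lambda>e. sat M e \<phi>)"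
  by (auto simp: definable_by_def)

lemma definable_by_not:
  "bool_closed \<Phi> \<Longrightarrow> definable_by \<Phi> M P \<Longrightarrow> definable_by \<Phi> M (\<lambda>e. \<not> P e)"
  unfolding definable_by_def bool_closed_def
  by (elim bexE conjE, rule_tac x = "Neg \<phi>" in bexI) auto

lemma definable_by_conj:
  "bool_closed \<Phi> \<Longrightarrow> definable_by \<Phi> M P \<Longrightarrow> definable_by \<Phi> M Q \<Longrightarrow> definable_by \<Phi> M (\<lambda>e. P e \<and> Q e)"
  unfolding definable_by_def bool_closed_def
  by (elim bexE conjE, rule_tac x = "And \<phi> \<phi>'" in bexI) auto

lemma definable_by_disj:
  assumes "bool_closed \<Phi>" "definable_by \<Phi> M P" "definable_by \<Phi> M Q"
  shows "definable_by \<Phi> M (\<lambda>e. P e \<or> Q e)"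
  using definable_by_not[OF assms(1) definable_by_conj[OF assms(1) definable_by_not definable_by_not]] assms
  by (simp)

lemma definable_by_const:
  assumes "bool_closed \<Phi>"
  shows "definable_by \<Phi> M (\<lambda>e. b)"
proof -
  obtain \<phi> where "\<phi> \<in> \<Phi>" using assms by (auto simp: bool_closed_def)
  then have d: "definable_by \<Phi> M (\<lambda>e. sat M e \<phi>)" by (rule definable_by_sat)
  have "definable_by \<Phi> M (\<lambda>e. sat M e \<phi> \<and> \<not> sat M e \<phi>)"
    using definable_by_conj[OF assms d definable_by_not[OF assms d]] .
  then have f: "definable_by \<Phi> M (\<lambda>e. False)" by simp
  have t: "definable_by \<Phi> M (\<lambda>e. True)" using definable_by_not[OF assms f] by simp
  show ?thesis by (cases b) (simp_all only: f t)
qed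

lemma definable_by_ball:
  assumes "bool_closed \<Phi>" "finite I" "\<And>i. i \<in> I \<Longrightarrow> definable_by \<Phi> M (P i)"
  shows "definable_by \<Phi> M (\<lambda>e. \<forall>i\<in>I. P i e)"
  using assms(2,3)
proof (induction I)
  case empty
  show ?case by (simp add: definable_by_const assms(1))
next
  case (insert i I)
  show ?case
    using definable_by_conj[OF assms(1) insert.prems[of i] insert.IH] insert.prems by simp
qed

lemma definable_by_bex:
  assumes "bool_closed \<Phi>" "finite I" "\<And>i. i \<in> I \<Longrightarrow> definable_by \<Phi> M (P i)"
  shows "definable_by \<Phi> M (\<lambda>e. \<exists>i\<in>I. P i e)"
  using assms(2,3)
proof (induction I)
  case empty
  show ?case by (simp add: definable_by_const assms(1))
next
  case (insert i I)
  show ?case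
    using definable_by_disj[OF assms(1) insert.prems[of i] insert.IH] insert.prems by simp
qed

text \<open>The semantic counterpart of being a boolean combination of the predicates in
  \<open>Q\<close>; arguments with it never touch connectives.\<close>

definition determined_by ::
  "'a struct \<Rightarrow> ((nat \<Rightarrow> 'a) \<Rightarrow> bool) set \<Rightarrow> ((nat \<Rightarrow> 'a) \<Rightarrow> 'b) \<Rightarrow> bool" where
  "determined_by M Q P \<longleftrightarrow>
     (\<forall>e\<in>assignments M. \<forall>e'\<in>assignments M. (\<forall>q\<in>Q. q e \<longleftrightarrow> q e') \<longrightarrow> P e = P e')"

lemma determined_byD:
  "determined_by M Q P \<Longrightarrow> e \<in> assignments M \<Longrightarrow> e' \<in> assignments M \<Longrightarrow>
   (\<And>q. q \<in> Q \<Longrightarrow> q e \<longleftrightarrow> q e') \<Longrightarrow> P e = P e'"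
  unfolding determined_by_def by blast

text \<open>Disjunctive normal form over the truth patterns on \<^term>\<open>Q\<close>.\<close>

lemma definable_by_determined:
  assumes "bool_closed \<Phi>" "finite Q" "\<And>q. q \<in> Q \<Longrightarrow> definable_by \<Phi> M q" "determined_by M Q P"
  shows "definable_by \<Phi> M P"
proof -
  define I where "I = {X. X \<subseteq> Q \<and> (\<exists>e\<in>assignments M. P e \<and> {q\<in>Q. q e} = X)}"
  have "finite I" using assms(2) by (auto simp: I_def)
  have lit: "definable_by \<Phi> M (\<lambda>e. if q \<in> X then q e else \<not> q e)" if "q \<in> Q" for q X
    using assms(3)[OF that] definable_by_not[OF assms(1) assms(3)[OF that]] by (cases "q \<in> X") simp_all
  have "definable_by \<Phi> M (\<lambda>e. \<exists>X\<in>I. \<forall>q\<in>Q. (if q \<in> X then q e else \<not> q e))"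
    by (intro definable_by_bex definable_by_ball assms(1,2) \<open>finite I\<close> lit)
  moreover have "P e \<longleftrightarrow> (\<exists>X\<in>I. \<forall>q\<in>Q. (if q \<in> X then q e else \<not> q e))" if e: "e \<in> assignments M" for e
  proof
    assume "P e"
    then have "{q\<in>Q. q e} \<in> I" using e by (auto simp: I_def)
    then show "\<exists>X\<in>I. \<forall>q\<in>Q. (if q \<in> X then q e else \<not> q e)" by (rule bexI[rotated]) auto
  next
    assume "\<exists>X\<in>I. \<forall>q\<in>Q. (if q \<in> X then q e else \<not> q e)"
    then obtain X e' where X: "\<forall>q\<in>Q. (if q \<in> X then q e else \<not> q e)"
      "e' \<in> assignments M" "P e'" "{q\<in>Q. q e'} = X" by (auto simp: I_def)
    have "q e \<longleftrightarrow> q e'" if "q \<in> Q" for q using bspec[OF X(1) that] X(4) that by (auto split: if_splits)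
    then have "P e = P e'" by (rule determined_byD[OF assms(4) e X(2)])
    then show "P e" using X(3) by simp
  qed
  ultimately show ?thesis by (simp cong: definable_by_cong)
qed

lemma bool_closed_formulas [simp]: "bool_closed (formulas L A)"
proof -
  have "Eq (Var 0) (Var 0) \<in> formulas L A" by simp
  then have "formulas L A \<noteq> {}" by (metis empty_iff)
  then show ?thesis unfolding bool_closed_def by simp
qed

abbreviation definable :: "language \<Rightarrow> 'a struct \<Rightarrow> 'a set \<Rightarrow> ((nat \<Rightarrow> 'a) \<Rightarrow> bool) \<Rightarrow> bool" where
  "definable L M A \<equiv> definable_by (formulas L A) M"

lemmas definable_not = definable_by_not[OF bool_closed_formulas]
lemmas definable_conj = definable_by_conj[OF bool_closed_formulas]
lemmas definable_disj = definable_by_disj[OF bool_closed_formulas]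
lemmas definable_const = definable_by_const[OF bool_closed_formulas]
lemmas definable_ball = definable_by_ball[OF bool_closed_formulas]
lemmas definable_bex = definable_by_bex[OF bool_closed_formulas]

section \<open>Quantifiers, renaming and projection of definable predicates\<close>

lemma definable_mono: "definable L M A P \<Longrightarrow> A \<subseteq> B \<Longrightarrow> definable L M B P"
  by (auto simp: definable_by_def intro: formulas_mono)

lemma definable_eq: "definable L M A (\<lambda>e. e x = e y)"
  unfolding definable_by_def by (rule bexI[of _ "Eq (Var x) (Var y)"]) auto

lemma definable_eq_param: "a \<in> A \<Longrightarrow> definable L M A (\<lambda>e. e x = a)"
  unfolding definable_by_def by (rule bexI[of _ "Eq (Var x) (Param a)"]) auto

lemma definable_ex:
  "definable L M A P \<Longrightarrow> definable L M A (\<lambda>e. \<exists>a\<in>univ M. P (e(x := a)))"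
  unfolding definable_by_def
  by (elim bexE, rule_tac x = "Exists x \<phi>" in bexI) auto

text \<open>For z different from y the update is expressed by a quantifier, \<exists>z (z = y and
  ...), so bound variables of the formula cannot interfere.\<close>

lemma definable_upd_var:
  assumes "definable L M A P"
  shows "definable L M A (\<lambda>e. P (e(z := e y)))"
proof (cases "z = y")
  case True
  then show ?thesis using assms by simp
next
  case False
  have "definable L M A (\<lambda>e. \<exists>a\<in>univ M. (e(z := a)) z = (e(z := a)) y \<and> P (e(z := a)))"
    by (rule definable_ex) (intro definable_conj definable_eq assms)
  then show ?thesis using False by (simp cong: definable_by_cong)
qed

lemma definable_upd_param:
  assumes "definable L M A P" "a \<in> univ M"
  shows "definable L M (insert a A) (\<lambda>e. P (e(z := a)))"
proof -
  have "definable L M (insert a A) (\<lambda>e. \<exists>b\<in>univ M. (e(z := b)) z = a \<and> P (e(z := b)))"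
    using definable_mono[OF assms(1)]
    by (intro definable_ex definable_conj definable_eq_param) auto
  then show ?thesis using assms(2) by (simp cong: definable_by_cong)
qed

text \<open>Since no target lies in \<open>Z\<close>, simultaneous replacement agrees with replacing
  the variables one at a time.\<close>

lemma definable_upd_vars:
  assumes "definable L M A P" "finite Z" "Z \<inter> \<sigma> ` Z = {}"
  shows "definable L M A (\<lambda>e. P (\<lambda>x. if x \<in> Z then e (\<sigma> x) else e x))"
  using assms(2,3)
proof (induction Z)
  case empty
  then show ?case using assms(1) by simp
next
  case (insert z Z)
  have "definable L M A (\<lambda>e. (\<lambda>e. P (\<lambda>x. if x \<in> Z then e (\<sigma> x) else e x)) (e(z := e (\<sigma> z))))"
    by (rule definable_upd_var) (use insert in auto)
  moreover have "(\<lambda>x. if x \<in> Z then (e(z := e (\<sigma> z))) (\<sigma> x) else (e(z := e (\<sigma> z))) x)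
      = (\<lambda>x. if x \<in> insert z Z then e (\<sigma> x) else e x)" for e :: "nat \<Rightarrow> 'a"
    using insert by (auto simp: fun_eq_iff)
  ultimately show ?case by simp
qed

text \<open>
  Bound variables could capture the new names; passing through a block of fresh variables
  avoids substitution into quantified formulas.
\<close>

lemma definable_rename:
  assumes "definable L M A P"
  shows "definable L M A (\<lambda>e. P (\<lambda>x. e (\<rho> x)))"
proof -
  obtain \<phi> where \<phi>: "\<phi> \<in> formulas L A" "\<And>e. e \<in> assignments M \<Longrightarrow> P e \<longleftrightarrow> sat M e \<phi>"
    using assms by (auto simp: definable_by_def)
  define V where "V = fv \<phi>"
  \<comment> \<open>Both \<open>V\<close> and its image under \<open>\<rho>\<close> lie below
    \<open>B\<close>, so the block of variables starting at \<open>B\<close> is disjoint from them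
    and each of the two updates satisfies the disjointness condition.\<close>
  obtain B where B: "\<forall>x\<in>V \<union> \<rho> ` V. x < B"
    using finite_nat_set_iff_bounded[of "V \<union> \<rho> ` V"] by (auto simp: V_def)
  define W where "W = (\<lambda>x. B + x) ` V"
  have "definable L M A (\<lambda>e. sat M (\<lambda>x. if x \<in> V then e (B + x) else e x) \<phi>)"
    by (rule definable_upd_vars[OF definable_by_sat[OF \<phi>(1)]]) (use B in \<open>auto simp: V_def\<close>)
  then have "definable L M A (\<lambda>e. (\<lambda>e. sat M (\<lambda>x. if x \<in> V then e (B + x) else e x) \<phi>)
      (\<lambda>x. if x \<in> W then e (\<rho> (x - B)) else e x))"
  proof (rule definable_upd_vars)
    show "finite W" by (simp add: W_def V_def)
    have "B + x \<noteq> \<rho> y" if "y \<in> V" for x y using B that by (metis UnI2 imageI not_add_less1)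
    then show "W \<inter> (\<lambda>x. \<rho> (x - B)) ` W = {}" by (auto simp: W_def)
  qed
  moreover have "sat M (\<lambda>x. if x \<in> V then if B + x \<in> W then e (\<rho> (B + x - B)) else e (B + x)
      else if x \<in> W then e (\<rho> (x - B)) else e x) \<phi> \<longleftrightarrow> P (\<lambda>x. e (\<rho> x))" if "e \<in> assignments M" for e
    using that by (subst \<phi>(2)) (auto simp: V_def W_def intro!: sat_cong)
  ultimately show ?thesis by (simp cong: definable_by_cong)
qed

text \<open>All variables outside \<open>V\<close> are quantified at once, but those that are not
  free in the defining formula have no influence, so finitely many existential quantifiers express
  it.\<close>

lemma definable_project:
  assumes "definable L M A P"
  shows "definable L M A (\<lambda>e. \<exists>e'\<in>assignments M. (\<forall>x\<in>V. e' x = e x) \<and> P e')"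
proof -
  obtain \<phi> where \<phi>: "\<phi> \<in> formulas L A" "\<And>e. e \<in> assignments M \<Longrightarrow> P e \<longleftrightarrow> sat M e \<phi>"
    using assms by (auto simp: definable_by_def)
  have "definable L M A (\<lambda>e. \<exists>e'\<in>assignments M. (\<forall>x\<in>-Z. e' x = e x) \<and> P e')" if "finite Z" for Z
    using that
  proof (induction Z)
    case empty
    have "(\<exists>e'\<in>assignments M. (\<forall>x\<in>-{}. e' x = e x) \<and> P e') \<longleftrightarrow> P e" if "e \<in> assignments M" for e
      using that by (metis Compl_empty_eq UNIV_I ext)
    then show ?case using assms by (simp cong: definable_by_cong)
  next
    case (insert z Z)
    have *: "(\<exists>a\<in>univ M. \<exists>e'\<in>assignments M. (\<forall>x\<in>-Z. e' x = (e(z := a)) x) \<and> P e') \<longleftrightarrow>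
        (\<exists>e'\<in>assignments M. (\<forall>x\<in>-insert z Z. e' x = e x) \<and> P e')" for e
    proof
      assume "\<exists>e'\<in>assignments M. (\<forall>x\<in>-insert z Z. e' x = e x) \<and> P e'"
      then obtain e' where e': "e' \<in> assignments M" "\<forall>x\<in>-insert z Z. e' x = e x" "P e'" by auto
      then show "\<exists>a\<in>univ M. \<exists>e'\<in>assignments M. (\<forall>x\<in>-Z. e' x = (e(z := a)) x) \<and> P e'"
        by (intro bexI[of _ "e' z"] bexI[of _ e']) auto
    next
      assume "\<exists>a\<in>univ M. \<exists>e'\<in>assignments M. (\<forall>x\<in>-Z. e' x = (e(z := a)) x) \<and> P e'"
      then show "\<exists>e'\<in>assignments M. (\<forall>x\<in>-insert z Z. e' x = e x) \<and> P e'"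
        by (elim bexE conjE, rule_tac x = e' in bexI) (auto split: if_splits)
    qed
    show ?case using definable_ex[OF insert.IH, of z] unfolding * .
  qed
  from this[of "fv \<phi> - V"]
  have "definable L M A (\<lambda>e. \<exists>e'\<in>assignments M. (\<forall>x\<in>-(fv \<phi> - V). e' x = e x) \<and> P e')" by simp
  moreover have "(\<exists>e'\<in>assignments M. (\<forall>x\<in>-(fv \<phi> - V). e' x = e x) \<and> P e') \<longleftrightarrow>
      (\<exists>e'\<in>assignments M. (\<forall>x\<in>V. e' x = e x) \<and> P e')" if e: "e \<in> assignments M" for e
  proof
    assume "\<exists>e'\<in>assignments M. (\<forall>x\<in>V. e' x = e x) \<and> P e'"
    then obtain e' where e': "e' \<in> assignments M" "\<forall>x\<in>V. e' x = e x" "P e'" by auto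
    let ?e = "\<lambda>x. if x \<in> fv \<phi> - V then e' x else e x"
    have "?e \<in> assignments M" using e e' by (auto intro!: assignmentsI)
    moreover have "sat M ?e \<phi> \<longleftrightarrow> sat M e' \<phi>" using e' by (intro sat_cong) auto
    ultimately show "\<exists>e'\<in>assignments M. (\<forall>x\<in>-(fv \<phi> - V). e' x = e x) \<and> P e'"
      using e' \<phi>(2) by (intro bexI[of _ ?e]) auto
  qed auto
  ultimately show ?thesis by (simp cong: definable_by_cong)
qed

text \<open>A free variable on which \<open>P\<close> does not depend can be bound by an existential
  quantifier without changing the truth value, the universe being nonempty.\<close>

lemma definable_fv:
  assumes "definable L M A P" "\<And>e e'. e \<in> assignments M \<Longrightarrow> e' \<in> assignments M \<Longrightarrow>
    (\<forall>x\<in>V. e x = e' x) \<Longrightarrow> P e \<longleftrightarrow> P e'" "univ M \<noteq> {}"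
  shows "\<exists>\<phi>\<in>formulas L A. fv \<phi> \<subseteq> V \<and> (\<forall>e\<in>assignments M. P e \<longleftrightarrow> sat M e \<phi>)"
proof -
  obtain \<phi> where \<phi>: "\<phi> \<in> formulas L A" "\<And>e. e \<in> assignments M \<Longrightarrow> P e \<longleftrightarrow> sat M e \<phi>"
    using assms(1) by (auto simp: definable_by_def)
  have "\<exists>\<psi>\<in>formulas L A. fv \<psi> \<subseteq> fv \<phi> - Z \<and> (\<forall>e\<in>assignments M. sat M e \<psi> \<longleftrightarrow> P e)"
    if "finite Z" "Z \<inter> V = {}" for Z
    using that
  proof (induction Z)
    case empty
    show ?case using \<phi> by (intro bexI[of _ \<phi>]) simp_all
  next
    case (insert z Z)
    then obtain \<psi> where \<psi>: "\<psi> \<in> formulas L A" "fv \<psi> \<subseteq> fv \<phi> - Z"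
      "\<And>e. e \<in> assignments M \<Longrightarrow> sat M e \<psi> \<longleftrightarrow> P e" by blast
    show ?case
    proof (rule bexI[of _ "Exists z \<psi>"], intro conjI ballI)
      fix e assume e: "e \<in> assignments M"
      have "P (e(z := a)) \<longleftrightarrow> P e" if "a \<in> univ M" for a
        using that e insert.prems by (intro assms(2)) auto
      then show "sat M e (Exists z \<psi>) \<longleftrightarrow> P e" using e \<psi>(3)[of "e(z := _)"] assms(3) by auto
    qed (use \<psi>(1,2) in auto)
  qed
  from this[of "fv \<phi> - V"] obtain \<psi> where "\<psi> \<in> formulas L A" "fv \<psi> \<subseteq> fv \<phi> - (fv \<phi> - V)"
    "\<forall>e\<in>assignments M. sat M e \<psi> \<longleftrightarrow> P e" by auto
  then show ?thesis by (intro bexI[of _ \<psi>]) auto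
qed

section \<open>Replacing a parameter by a variable\<close>

fun trm_unparam :: "'a \<Rightarrow> nat \<Rightarrow> 'a trm \<Rightarrow> 'a trm" where
  "trm_unparam p w (Param a) = (if a = p then Var w else Param a)"
| "trm_unparam p w t = t"

primrec unparam :: "'a \<Rightarrow> nat \<Rightarrow> 'a fm \<Rightarrow> 'a fm" where
  "unparam p w (Eq s t) = Eq (trm_unparam p w s) (trm_unparam p w t)"
| "unparam p w (Rel r ts) = Rel r (map (trm_unparam p w) ts)"
| "unparam p w (Neg \<phi>) = Neg (unparam p w \<phi>)"
| "unparam p w (And \<phi> \<psi>) = And (unparam p w \<phi>) (unparam p w \<psi>)"
| "unparam p w (Exists x \<phi>) = Exists x (unparam p w \<phi>)"

primrec bvars :: "'a fm \<Rightarrow> nat set" where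
  "bvars (Eq s t) = {}"
| "bvars (Rel r ts) = {}"
| "bvars (Neg \<phi>) = bvars \<phi>"
| "bvars (And \<phi> \<psi>) = bvars \<phi> \<union> bvars \<psi>"
| "bvars (Exists x \<phi>) = insert x (bvars \<phi>)"

lemma finite_bvars [simp]: "finite (bvars \<phi>)"
  by (induction \<phi>) auto

lemma tsymbols_unparam [simp]: "tsymbols (trm_unparam p w t) = tsymbols t"
  by (cases t) auto

lemma symbols_unparam [simp]: "symbols (unparam p w \<phi>) = symbols \<phi>"
  by (induction \<phi>) auto

lemma tparams_unparam [simp]: "tparams (trm_unparam p w t) = tparams t - {p}"
  by (cases t) auto

lemma params_unparam [simp]: "params (unparam p w \<phi>) = params \<phi> - {p}"
  by (induction \<phi>) auto

lemma tval_unparam: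
  "w \<notin> tfv t \<Longrightarrow> tval M (e(w := p)) (trm_unparam p w t) = tval M e t"
  by (cases t) auto

lemma sat_unparam:
  "w \<notin> fv \<phi> \<union> bvars \<phi> \<Longrightarrow> sat M (e(w := p)) (unparam p w \<phi>) \<longleftrightarrow> sat M e \<phi>"
proof (induction \<phi> arbitrary: e)
  case (Rel r ts)
  then have "map (tval M (e(w := p)) \<circ> trm_unparam p w) ts = map (tval M e) ts"
    by (auto simp: tval_unparam)
  then show ?case by (simp del: map_eq_conv fun_upd_apply)
next
  case (Exists x \<phi>)
  have "sat M (e(w := p, x := a)) (unparam p w \<phi>) \<longleftrightarrow> sat M (e(x := a)) \<phi>" for a
    using Exists.IH[of "e(x := a)"] Exists.prems
    by (auto simp add: fun_upd_twist[of w x] simp del: fun_upd_apply)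
  then show ?case by (simp del: fun_upd_apply)
qed (auto simp: tval_unparam)

text \<open>The parameter is first replaced by a variable \<open>w\<close> that is neither free nor
  bound in the formula, and \<open>definable_upd_var\<close> then moves it to \<open>z\<close>,
  which may occur bound.\<close>

lemma definable_unparam:
  assumes "definable L M (insert p A) P" "p \<in> univ M"
    and z: "\<And>e a. e \<in> assignments M \<Longrightarrow> a \<in> univ M \<Longrightarrow> P (e(z := a)) \<longleftrightarrow> P e"
  shows "\<exists>Q. definable L M A Q \<and> (\<forall>e\<in>assignments M. Q (e(z := p)) \<longleftrightarrow> P e)"
proof -
  obtain \<phi> where \<phi>: "\<phi> \<in> formulas L (insert p A)" "\<And>e. e \<in> assignments M \<Longrightarrow> P e \<longleftrightarrow> sat M e \<phi>"
    using assms(1) by (auto simp: definable_by_def)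
  obtain w where w: "w \<notin> insert z (fv \<phi> \<union> bvars \<phi>)"
    using ex_new_if_finite[of "insert z (fv \<phi> \<union> bvars \<phi>)"] by auto
  have "definable L M A (\<lambda>e. sat M e (unparam p w \<phi>))"
    by (rule definable_by_sat) (use \<phi> in \<open>auto simp: formulas_def\<close>)
  from definable_upd_var[OF this, of w z]
  have "definable L M A (\<lambda>e. sat M (e(w := e z)) (unparam p w \<phi>))" .
  moreover have "sat M (e(z := p, w := p)) (unparam p w \<phi>) \<longleftrightarrow> P e" if e: "e \<in> assignments M" for e
    using sat_unparam[of w \<phi> M "e(z := p)" p] w z[OF e assms(2)] \<phi>(2)[of "e(z := p)"] e assms(2)
    by auto
  ultimately show ?thesis
    by (intro exI[of _ "\<lambda>e. sat M (e(w := e z)) (unparam p w \<phi>)"]) auto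
qed

section \<open>Isomorphisms\<close>

lemma tval_iso:
  assumes "is_iso L h M N" "tsymbols t \<subseteq> L"
  shows "tval N (\<lambda>x. h (e x)) (map_trm h t) = h (tval M e t)"
  using assms by (cases t) (auto simp: is_iso_def)

lemma tval_in_univ:
  assumes "is_structure L M" "e \<in> assignments M" "tsymbols t \<subseteq> L" "tparams t \<subseteq> univ M"
  shows "tval M e t \<in> univ M"
  using assms by (cases t) (auto simp: is_structure_def)

lemma sat_iso:
  assumes iso: "is_iso L h M N" and M: "is_structure L M"
  shows "e \<in> assignments M \<Longrightarrow> \<phi> \<in> formulas L (univ M) \<Longrightarrow>
    sat N (\<lambda>x. h (e x)) (map_fm h \<phi>) \<longleftrightarrow> sat M e \<phi>"
proof (induction \<phi> arbitrary: e)
  case (Eq s t)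
  have inj: "inj_on h (univ M)" using iso by (auto simp: is_iso_def bij_betw_def)
  have "tval M e s \<in> univ M" "tval M e t \<in> univ M"
    using Eq by (auto simp: formulas_def intro!: tval_in_univ[OF M])
  then show ?case
    using Eq inj by (auto simp: tval_iso[OF iso] formulas_def inj_on_eq_iff)
next
  case (Rel r ts)
  have sub: "tsymbols t \<subseteq> L" "tparams t \<subseteq> univ M" if "t \<in> set ts" for t
    using Rel(2) that by (auto simp: formulas_def)
  have "map (tval N (\<lambda>x. h (e x)) \<circ> map_trm h) ts = map h (map (tval M e) ts)"
    using sub by (auto simp: tval_iso[OF iso])
  moreover have "set (map (tval M e) ts) \<subseteq> univ M"
    using sub Rel(1) by (auto intro!: tval_in_univ[OF M])
  moreover have "RelSym r (length ts) \<in> L" using Rel(2) by (auto simp: formulas_def)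
  ultimately have "map (tval M e) ts \<in> rel_of M r (length ts) \<longleftrightarrow>
      map (tval N (\<lambda>x. h (e x)) \<circ> map_trm h) ts \<in> rel_of N r (length ts)"
    using iso unfolding is_iso_def by (metis length_map)
  then show ?case by simp
next
  case (Exists x \<phi>)
  have surj: "univ N = h ` univ M" using iso by (simp add: is_iso_def bij_betw_def)
  have "(\<exists>b\<in>univ N. sat N ((\<lambda>x. h (e x))(x := b)) (map_fm h \<phi>)) \<longleftrightarrow>
        (\<exists>a\<in>univ M. sat N ((\<lambda>x. h (e x))(x := h a)) (map_fm h \<phi>))"
    by (simp add: surj del: fun_upd_apply)
  also have "\<dots> \<longleftrightarrow> (\<exists>a\<in>univ M. sat M (e(x := a)) \<phi>)"
  proof (rule bex_cong[OF refl])
    fix a assume a: "a \<in> univ M"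
    have "(\<lambda>x. h (e x))(x := h a) = (\<lambda>y. h ((e(x := a)) y))" by auto
    then show "sat N ((\<lambda>x. h (e x))(x := h a)) (map_fm h \<phi>) \<longleftrightarrow> sat M (e(x := a)) \<phi>"
      using Exists.IH[of "e(x := a)"] a Exists.prems by (simp del: fun_upd_apply)
  qed
  finally show ?case by simp
qed auto

lemma map_trm_id: "(\<forall>a\<in>tparams t. h a = a) \<Longrightarrow> map_trm h t = t"
  by (cases t) auto

lemma map_fm_id: "(\<forall>a\<in>params \<phi>. h a = a) \<Longrightarrow> map_fm h \<phi> = \<phi>"
  by (induction \<phi>) (auto simp: map_trm_id map_idI)

lemma sat_iso_fixed:
  assumes "is_iso L h M N" "is_structure L M" "e \<in> assignments M" "\<phi> \<in> formulas L A"
    "A \<subseteq> univ M" "\<forall>a\<in>A. h a = a"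
  shows "sat N (\<lambda>x. h (e x)) \<phi> \<longleftrightarrow> sat M e \<phi>"
proof -
  have "map_fm h \<phi> = \<phi>" using assms by (intro map_fm_id) (auto simp: formulas_def)
  then show ?thesis using sat_iso[OF assms(1,2,3), of \<phi>] formulas_mono[OF assms(4,5)] by simp
qed

lemma is_iso_comp:
  assumes "is_iso L g M N" "is_iso L h N P"
  shows "is_iso L (h \<circ> g) M P"
  unfolding is_iso_def
proof (intro conjI allI impI)
  have g: "bij_betw g (univ M) (univ N)" using assms by (auto simp: is_iso_def)
  then show "bij_betw (h \<circ> g) (univ M) (univ P)"
    using assms by (auto simp: is_iso_def intro: bij_betw_trans)
  fix r n xs assume *: "RelSym r n \<in> L \<and> length xs = n \<and> set xs \<subseteq> univ M"
  then have "set (map g xs) \<subseteq> univ N" using g by (auto simp: bij_betw_def)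
  then have "map g xs \<in> rel_of N r n \<longleftrightarrow> map h (map g xs) \<in> rel_of P r n"
    using * assms(2) unfolding is_iso_def by (metis length_map)
  moreover have "xs \<in> rel_of M r n \<longleftrightarrow> map g xs \<in> rel_of N r n"
    using * assms(1) unfolding is_iso_def by blast
  ultimately show "xs \<in> rel_of M r n \<longleftrightarrow> map (h \<circ> g) xs \<in> rel_of P r n" by simp
qed (use assms in \<open>auto simp: is_iso_def\<close>)

lemma is_iso_id: "is_iso L (\<lambda>a. a) M M"
  by (auto simp: is_iso_def bij_betw_def)

section \<open>Bounded degree and mutual algebraicity\<close>

definition bounded_degree :: "('a \<times> 'a) set \<Rightarrow> bool" where
  "bounded_degree B \<longleftrightarrow> (\<exists>D. \<forall>a. finite (B `` {a}) \<and> card (B `` {a}) \<le> D)"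

lemma bounded_degree_subset: "bounded_degree B \<Longrightarrow> A \<subseteq> B \<Longrightarrow> bounded_degree A"
  unfolding bounded_degree_def
  by (meson Image_mono card_mono finite_subset le_trans order_refl)

lemma bounded_degree_empty: "bounded_degree {}"
  by (auto simp: bounded_degree_def)

lemma bounded_degree_Id: "bounded_degree Id"
  by (auto simp: bounded_degree_def)

lemma bounded_degree_Un:
  assumes "bounded_degree A" "bounded_degree B"
  shows "bounded_degree (A \<union> B)"
proof -
  obtain D E where "\<forall>a. finite (A `` {a}) \<and> card (A `` {a}) \<le> D"
    "\<forall>a. finite (B `` {a}) \<and> card (B `` {a}) \<le> E"
    using assms by (auto simp: bounded_degree_def)
  then have "finite ((A \<union> B) `` {a}) \<and> card ((A \<union> B) `` {a}) \<le> D + E" for a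
    unfolding Un_Image by (meson add_mono card_Un_le finite_UnI le_trans)
  then show ?thesis by (auto simp: bounded_degree_def)
qed

lemma bounded_degree_UN:
  "finite I \<Longrightarrow> (\<And>i. i \<in> I \<Longrightarrow> bounded_degree (B i)) \<Longrightarrow> bounded_degree (\<Union>i\<in>I. B i)"
  by (induction I rule: finite_induct) (auto intro: bounded_degree_empty bounded_degree_Un)

lemma card_UN_le_mult:
  assumes "finite I" "\<And>i. i \<in> I \<Longrightarrow> finite (A i)" "\<And>i. i \<in> I \<Longrightarrow> card (A i) \<le> K"
  shows "finite (\<Union>i\<in>I. A i) \<and> card (\<Union>i\<in>I. A i) \<le> card I * K"
  using assms card_UN_le[OF assms(1), of A] sum_bounded_above[of I "\<lambda>i. card (A i)" K] by auto

lemma bounded_degree_image: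
  assumes "\<forall>a. finite (B `` {a}) \<and> card (B `` {a}) \<le> D" "finite X"
  shows "finite (B `` X) \<and> card (B `` X) \<le> card X * D"
proof -
  have "B `` X = (\<Union>a\<in>X. B `` {a})" by auto
  then show ?thesis using card_UN_le_mult[of X "\<lambda>a. B `` {a}" D] assms by auto
qed

lemma bounded_degree_relcomp:
  assumes "bounded_degree A" "bounded_degree B"
  shows "bounded_degree (A O B)"
proof -
  obtain D E where DE: "\<forall>a. finite (A `` {a}) \<and> card (A `` {a}) \<le> D"
    "\<forall>a. finite (B `` {a}) \<and> card (B `` {a}) \<le> E"
    using assms by (auto simp: bounded_degree_def)
  have "finite ((A O B) `` {a}) \<and> card ((A O B) `` {a}) \<le> D * E" for a
    using bounded_degree_image[OF DE(2), of "A `` {a}"] DE(1)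
    by (auto simp: relcomp_Image intro: order_trans mult_right_mono)
  then show ?thesis by (auto simp: bounded_degree_def)
qed

lemma bounded_degree_relpow: "bounded_degree B \<Longrightarrow> bounded_degree (B ^^ n)"
  by (induction n) (auto intro: bounded_degree_relcomp bounded_degree_Id)

text \<open>The Gaifman graph of \<open>R\<close>, with a loop at every element that occurs in a
  tuple.\<close>

definition list_graph :: "'a list set \<Rightarrow> ('a \<times> 'a) set" where
  "list_graph R = {(a, b). \<exists>t\<in>R. a \<in> set t \<and> b \<in> set t}"

text \<open>An element in at most K tuples of length n has at most K * n neighbours. Conversely,
  every tuple through m is a word of length n over the neighbours of m, which leaves at most
  \<open>D ^ n\<close> tuples.\<close>

lemma mutually_algebraic_rel_iff:
  assumes R: "R \<subseteq> {t. length t = n \<and> set t \<subseteq> A}"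
  shows "mutually_algebraic_rel A R \<longleftrightarrow> bounded_degree (list_graph R)"
proof
  assume "mutually_algebraic_rel A R"
  then obtain K where K: "\<forall>m\<in>A. finite {t\<in>R. m \<in> set t} \<and> card {t\<in>R. m \<in> set t} \<le> K"
    by (auto simp: mutually_algebraic_rel_def uniformly_finite_def)
  have "finite (list_graph R `` {a}) \<and> card (list_graph R `` {a}) \<le> K * n" for a
  proof (cases "a \<in> A")
    case True
    have "list_graph R `` {a} = (\<Union>t\<in>{t\<in>R. a \<in> set t}. set t)" by (auto simp: list_graph_def)
    moreover have "card (set t) \<le> n" if "t \<in> R" for t using R that card_length by blast
    ultimately show ?thesis
      using card_UN_le_mult[of "{t\<in>R. a \<in> set t}" set n] K True
      by (auto intro: order_trans mult_right_mono)
  next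
    case False
    then have "list_graph R `` {a} = {}" using R by (auto simp: list_graph_def)
    then show ?thesis by simp
  qed
  then show "bounded_degree (list_graph R)" by (auto simp: bounded_degree_def)
next
  assume "bounded_degree (list_graph R)"
  then obtain D where D: "\<forall>a. finite (list_graph R `` {a}) \<and> card (list_graph R `` {a}) \<le> D"
    by (auto simp: bounded_degree_def)
  have "finite {t\<in>R. m \<in> set t} \<and> card {t\<in>R. m \<in> set t} \<le> D ^ n" for m
  proof -
    let ?X = "{t. set t \<subseteq> list_graph R `` {m} \<and> length t = n}"
    have sub: "{t\<in>R. m \<in> set t} \<subseteq> ?X" using R by (auto simp: list_graph_def)
    have "finite ?X" using D finite_lists_length_eq by blast
    moreover have "card ?X = card (list_graph R `` {m}) ^ n"
      using D card_lists_length_eq by blast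
    ultimately show ?thesis using sub D
      by (metis (no_types, lifting) card_mono finite_subset le_trans power_mono zero_le)
  qed
  then show "mutually_algebraic_rel A R"
    by (auto simp: mutually_algebraic_rel_def uniformly_finite_def)
qed

text \<open>The Gaifman graph of the relation that \<open>\<theta>\<close> defines on the variables
  \<open>W\<close>. The set \<open>W\<close> is explicit because a predicate, unlike a formula, does
  not carry its variables with it.\<close>

definition clique_graph :: "'a struct \<Rightarrow> nat set \<Rightarrow> ((nat \<Rightarrow> 'a) \<Rightarrow> bool) \<Rightarrow> ('a \<times> 'a) set" where
  "clique_graph M W \<theta> = {(e x, e y) | e x y. e \<in> assignments M \<and> \<theta> e \<and> x \<in> W \<and> y \<in> W}"

definition depends_on :: "'a struct \<Rightarrow> nat set \<Rightarrow> ((nat \<Rightarrow> 'a) \<Rightarrow> 'b) \<Rightarrow> bool" where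
  "depends_on M V P \<longleftrightarrow>
     (\<forall>e\<in>assignments M. \<forall>e'\<in>assignments M. (\<forall>x\<in>V. e x = e' x) \<longrightarrow> P e = P e')"

lemma depends_onD:
  "depends_on M V P \<Longrightarrow> e \<in> assignments M \<Longrightarrow> e' \<in> assignments M \<Longrightarrow>
   (\<And>x. x \<in> V \<Longrightarrow> e x = e' x) \<Longrightarrow> P e = P e'"
  unfolding depends_on_def by blast

lemma depends_on_sat: "depends_on M (fv \<phi>) (\<lambda>e. sat M e \<phi>)"
  unfolding depends_on_def using sat_cong by blast

lemma list_graph_defined_rel: "list_graph (defined_rel M \<phi>) = clique_graph M (fv \<phi>) (\<lambda>e. sat M e \<phi>)"
  by (fastforce simp: list_graph_def clique_graph_def defined_rel_def)

lemma mutually_algebraic_fm_iff: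
  "mutually_algebraic_fm M \<phi> \<longleftrightarrow> bounded_degree (clique_graph M (fv \<phi>) (\<lambda>e. sat M e \<phi>))"
proof -
  have "defined_rel M \<phi> \<subseteq> {t. length t = card (fv \<phi>) \<and> set t \<subseteq> univ M}"
    by (auto simp: defined_rel_def)
  then show ?thesis
    using mutually_algebraic_rel_iff
    unfolding mutually_algebraic_fm_def list_graph_defined_rel[symmetric] by blast
qed

text \<open>Finite families of mutually algebraic predicates. Each predicate comes with a variable
  set, since mutual algebraicity depends on which variables count as entries of the tuple.\<close>

definition MA_preds :: "'a struct \<Rightarrow> nat set \<Rightarrow> (nat set \<times> ((nat \<Rightarrow> 'a) \<Rightarrow> bool)) set \<Rightarrow> bool" where
  "MA_preds M V \<Theta> \<longleftrightarrow> finite \<Theta> \<and>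
     (\<forall>q\<in>\<Theta>. fst q \<subseteq> V \<and> depends_on M (fst q) (snd q) \<and>
            bounded_degree (clique_graph M (fst q) (snd q)))"

lemma determined_by_cong:
  assumes "\<And>e. e \<in> assignments M \<Longrightarrow> P e = P' e" "determined_by M Q P'"
  shows "determined_by M Q P"
  unfolding determined_by_def using assms(1) determined_byD[OF assms(2)] by metis

lemma boolean_combinations_determined:
  "\<psi> \<in> boolean_combinations S \<Longrightarrow>
   \<exists>\<Theta>\<subseteq>S. finite \<Theta> \<and> determined_by M ((\<lambda>\<theta> e. sat M e \<theta>) ` \<Theta>) (\<lambda>e. sat M e \<psi>)"
proof (induction rule: boolean_combinations.induct)
  case (1 \<phi>)
  then show ?case by (intro exI[of _ "{\<phi>}"]) (auto simp: determined_by_def)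
next
  case (2 \<phi>)
  then show ?case by (auto simp: determined_by_def)
next
  case (3 \<phi> \<psi>)
  then obtain A B where "A \<subseteq> S" "B \<subseteq> S" "finite A" "finite B"
    "determined_by M ((\<lambda>\<theta> e. sat M e \<theta>) ` A) (\<lambda>e. sat M e \<phi>)"
    "determined_by M ((\<lambda>\<theta> e. sat M e \<theta>) ` B) (\<lambda>e. sat M e \<psi>)" by blast
  note AB = this
  have "determined_by M ((\<lambda>\<theta> e. sat M e \<theta>) ` (A \<union> B)) (\<lambda>e. sat M e (And \<phi> \<psi>))"
    unfolding determined_by_def
  proof (intro ballI impI)
    fix e e' assume e: "e \<in> assignments M" "e' \<in> assignments M"
      and eq: "\<forall>q\<in>(\<lambda>\<theta> e. sat M e \<theta>) ` (A \<union> B). q e \<longleftrightarrow> q e'"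
    then have eq: "sat M e \<theta> \<longleftrightarrow> sat M e' \<theta>" if "\<theta> \<in> A \<union> B" for \<theta>
      using bspec[OF _ imageI[OF that], of "\<lambda>\<theta> e. sat M e \<theta>" "\<lambda>q. q e = q e'"] by simp
    have "sat M e \<phi> \<longleftrightarrow> sat M e' \<phi>" by (rule determined_byD[OF AB(5) e]) (auto simp: eq)
    moreover have "sat M e \<psi> \<longleftrightarrow> sat M e' \<psi>" by (rule determined_byD[OF AB(6) e]) (auto simp: eq)
    ultimately show "sat M e (And \<phi> \<psi>) \<longleftrightarrow> sat M e' (And \<phi> \<psi>)" by simp
  qed
  then show ?case using AB by (intro exI[of _ "A \<union> B"]) simp
qed

lemma mutually_algebraic_determined:
  assumes "mutually_algebraic L M" "\<phi> \<in> formulas L (univ M)"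
  obtains V \<Theta> where "finite V" "MA_preds M V \<Theta>" "determined_by M (snd ` \<Theta>) (\<lambda>e. sat M e \<phi>)"
proof -
  let ?S = "{\<theta> \<in> formulas L (univ M). mutually_algebraic_fm M \<theta>}"
  obtain \<psi> where \<psi>: "\<psi> \<in> boolean_combinations ?S" "equivalent M \<phi> \<psi>"
    using assms unfolding mutually_algebraic_def by blast
  obtain T where T: "T \<subseteq> ?S" "finite T"
    "determined_by M ((\<lambda>\<theta> e. sat M e \<theta>) ` T) (\<lambda>e. sat M e \<psi>)"
    using boolean_combinations_determined[OF \<psi>(1)] by blast
  let ?\<Theta> = "(\<lambda>\<theta>. (fv \<theta>, \<lambda>e. sat M e \<theta>)) ` T"
  have "MA_preds M (\<Union>\<theta>\<in>T. fv \<theta>) ?\<Theta>"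
    using T by (auto simp: MA_preds_def depends_on_sat mutually_algebraic_fm_iff)
  moreover have "determined_by M (snd ` ?\<Theta>) (\<lambda>e. sat M e \<phi>)"
    unfolding image_image snd_conv
    by (rule determined_by_cong[OF _ T(3)]) (use \<psi>(2) in \<open>simp add: equivalent_def\<close>)
  ultimately show thesis using that[of "\<Union>\<theta>\<in>T. fv \<theta>" ?\<Theta>] T by auto
qed

section \<open>Quantifier-free mutually algebraic pieces\<close>

definition qf_formulas :: "language \<Rightarrow> 'a set \<Rightarrow> 'a fm set" where
  "qf_formulas L A = {\<phi> \<in> formulas L A. qfree \<phi>}"

abbreviation qf_definable :: "language \<Rightarrow> 'a struct \<Rightarrow> ((nat \<Rightarrow> 'a) \<Rightarrow> bool) \<Rightarrow> bool" where
  "qf_definable L M \<equiv> definable_by (qf_formulas L (univ M)) M"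

lemma bool_closed_qf_formulas [simp]: "bool_closed (qf_formulas L A)"
proof -
  have "Eq (Var 0) (Var 0) \<in> qf_formulas L A" by (simp add: qf_formulas_def)
  then have "qf_formulas L A \<noteq> {}" by (metis empty_iff)
  then show ?thesis unfolding bool_closed_def by (simp add: qf_formulas_def)
qed

section \<open>Substitution into quantifier-free formulas\<close>

fun tsubst :: "(nat \<Rightarrow> 'a trm) \<Rightarrow> 'a trm \<Rightarrow> 'a trm" where
  "tsubst \<sigma> (Var x) = \<sigma> x"
| "tsubst \<sigma> t = t"

fun qsubst :: "(nat \<Rightarrow> 'a trm) \<Rightarrow> 'a fm \<Rightarrow> 'a fm" where
  "qsubst \<sigma> (Eq s t) = Eq (tsubst \<sigma> s) (tsubst \<sigma> t)"
| "qsubst \<sigma> (Rel r ts) = Rel r (map (tsubst \<sigma>) ts)"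
| "qsubst \<sigma> (Neg \<phi>) = Neg (qsubst \<sigma> \<phi>)"
| "qsubst \<sigma> (And \<phi> \<psi>) = And (qsubst \<sigma> \<phi>) (qsubst \<sigma> \<psi>)"
| "qsubst \<sigma> (Exists x \<phi>) = Exists x \<phi>"

lemma tval_tsubst: "tval M e (tsubst \<sigma> t) = tval M (\<lambda>x. tval M e (\<sigma> x)) t"
  by (cases t) auto

lemma sat_qsubst: "qfree \<phi> \<Longrightarrow> sat M e (qsubst \<sigma> \<phi>) \<longleftrightarrow> sat M (\<lambda>x. tval M e (\<sigma> x)) \<phi>"
proof (induction \<phi>)
  case (Rel r ts)
  have "map (tval M e \<circ> tsubst \<sigma>) ts = map (tval M (\<lambda>x. tval M e (\<sigma> x))) ts"
    by (simp add: tval_tsubst)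
  then show ?case by (simp del: map_eq_conv)
qed (auto simp: tval_tsubst)

lemma qfree_qsubst: "qfree \<phi> \<Longrightarrow> qfree (qsubst \<sigma> \<phi>)"
  by (induction \<phi>) auto

lemma tsubst_formulas:
  assumes "\<forall>x. tsymbols (\<sigma> x) = {} \<and> tparams (\<sigma> x) \<subseteq> A"
  shows "tsymbols (tsubst \<sigma> t) \<subseteq> tsymbols t" "tparams (tsubst \<sigma> t) \<subseteq> tparams t \<union> A"
  using assms by (cases t; auto)+

lemma qsubst_formulas:
  assumes "\<forall>x. tsymbols (\<sigma> x) = {} \<and> tparams (\<sigma> x) \<subseteq> A" "\<phi> \<in> formulas L A"
  shows "qsubst \<sigma> \<phi> \<in> formulas L A"
proof -
  note * = tsubst_formulas[OF assms(1)]
  have "symbols (qsubst \<sigma> \<phi>) \<subseteq> symbols \<phi> \<and> params (qsubst \<sigma> \<phi>) \<subseteq> params \<phi> \<union> A"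
  proof (induction \<phi>)
    case (Eq s t)
    then show ?case using *[of s] *[of t] by auto
  next
    case (Rel r ts)
    then show ?case using * by fastforce
  qed auto
  then show ?thesis using assms(2) by (auto simp: formulas_def)
qed

lemma qf_definable_subst:
  assumes "qf_definable L M P"
    and \<sigma>: "\<forall>x. tsymbols (\<sigma> x) = {} \<and> tparams (\<sigma> x) \<subseteq> univ M"
  shows "qf_definable L M (\<lambda>e. P (\<lambda>x. tval M e (\<sigma> x)))"
proof -
  obtain \<phi> where \<phi>: "\<phi> \<in> formulas L (univ M)" "qfree \<phi>"
    "\<forall>e\<in>assignments M. P e \<longleftrightarrow> sat M e \<phi>"
    using assms(1) by (auto simp: definable_by_def qf_formulas_def)
  have "tval M e (\<sigma> x) \<in> univ M" if "e \<in> assignments M" for e x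
    using \<sigma>[rule_format, of x] that by (cases "\<sigma> x") auto
  then have "(\<lambda>x. tval M e (\<sigma> x)) \<in> assignments M" if "e \<in> assignments M" for e
    using that by (auto simp: assignments_def)
  then show ?thesis unfolding definable_by_def
    using \<phi> qsubst_formulas[OF \<sigma> \<phi>(1)]
    by (intro bexI[of _ "qsubst \<sigma> \<phi>"]) (auto simp: qf_formulas_def qfree_qsubst sat_qsubst)
qed

text \<open>The values outside \<open>C\<close> enter as parameters, so the result stays
  quantifier-free.\<close>

lemma qf_definable_fix:
  assumes "qf_definable L M P" "e' \<in> assignments M"
  shows "qf_definable L M (\<lambda>e. P (\<lambda>x. if x \<in> C then e x else e' x))"
proof -
  have *: "tval M e (if x \<in> C then Var x else Param (e' x)) = (if x \<in> C then e x else e' x)" for e x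
    by simp
  have "qf_definable L M (\<lambda>e. P (\<lambda>x. tval M e (if x \<in> C then Var x else Param (e' x))))"
    by (rule qf_definable_subst[OF assms(1)]) (use assms(2) in \<open>auto simp: assignments_def\<close>)
  then show ?thesis unfolding * .
qed

lemma qf_definable_rename:
  assumes "qf_definable L M P"
  shows "qf_definable L M (\<lambda>e. P (\<lambda>x. e (\<rho> x)))"
  using qf_definable_subst[OF assms, of "\<lambda>x. Var (\<rho> x)"] by simp

lemma qf_definable_eq: "a \<in> univ M \<Longrightarrow> qf_definable L M (\<lambda>e. e x = a)"
  unfolding definable_by_def by (rule bexI[of _ "Eq (Var x) (Param a)"]) (auto simp: qf_formulas_def)

lemma qf_definable_disjoint:
  assumes "finite C" "finite F" "F \<subseteq> univ M"
  shows "qf_definable L M (\<lambda>e. e ` C \<inter> F = {})"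
proof -
  have "qf_definable L M (\<lambda>e. \<forall>x\<in>C. \<forall>a\<in>F. \<not> e x = a)"
    using assms
    by (intro definable_by_ball definable_by_not qf_definable_eq) auto
  moreover have "(e ` C \<inter> F = {}) = (\<forall>x\<in>C. \<forall>a\<in>F. \<not> e x = a)" for e :: "nat \<Rightarrow> 'a" by auto
  ultimately show ?thesis by simp
qed

text \<open>The type, relative to \<open>\<Theta>\<close>, of the part of the tuple indexed by
  \<open>C\<close>. Only predicates with all their variables in \<open>C\<close> are recorded; hence
  the types of two complementary parts together miss exactly the true predicates that straddle the
  cut.\<close>

definition ty :: "(nat set \<times> ((nat \<Rightarrow> 'a) \<Rightarrow> bool)) set \<Rightarrow> nat set \<Rightarrow> (nat \<Rightarrow> 'a) \<Rightarrow>
    (nat set \<times> ((nat \<Rightarrow> 'a) \<Rightarrow> bool)) set" where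
  "ty \<Theta> C e = {q\<in>\<Theta>. fst q \<subseteq> C \<and> snd q e}"

lemma ty_subset: "ty \<Theta> C e \<subseteq> \<Theta>"
  by (auto simp: ty_def)

lemma ty_cong:
  assumes "MA_preds M V \<Theta>" "e \<in> assignments M" "e' \<in> assignments M" "\<forall>x\<in>C. e x = e' x"
  shows "ty \<Theta> C e = ty \<Theta> C e'"
proof -
  have "snd q e \<longleftrightarrow> snd q e'" if "q \<in> \<Theta>" "fst q \<subseteq> C" for q
    using assms that unfolding MA_preds_def by (intro depends_onD[of M "fst q" "snd q"]) auto
  then show ?thesis by (auto simp: ty_def)
qed

definition edges :: "'a struct \<Rightarrow> (nat set \<times> ((nat \<Rightarrow> 'a) \<Rightarrow> bool)) set \<Rightarrow> ('a \<times> 'a) set" where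
  "edges M \<Theta> = (\<Union>q\<in>\<Theta>. clique_graph M (fst q) (snd q))"

lemma bounded_degree_edges: "MA_preds M V \<Theta> \<Longrightarrow> bounded_degree (edges M \<Theta>)"
  unfolding edges_def MA_preds_def by (intro bounded_degree_UN) auto

lemma edgesI:
  "q \<in> \<Theta> \<Longrightarrow> e \<in> assignments M \<Longrightarrow> snd q e \<Longrightarrow> x \<in> fst q \<Longrightarrow> y \<in> fst q \<Longrightarrow> (e x, e y) \<in> edges M \<Theta>"
  by (fastforce simp: edges_def clique_graph_def)

text \<open>Greedy choice: each new realization avoids \<open>F0\<close> and all entries used so
  far.\<close>

lemma disjoint_realizations:
  assumes "\<And>F. finite F \<Longrightarrow> \<exists>e\<in>assignments M. R e \<and> e ` C \<inter> F = {}" "finite C" "finite F0"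
  shows "\<exists>es. \<forall>j<k::nat. es j \<in> assignments M \<and> R (es j) \<and> es j ` C \<inter> F0 = {} \<and>
            (\<forall>i<j. es i ` C \<inter> es j ` C = {})"
proof (induction k)
  case (Suc k)
  then obtain es where es: "\<forall>j<k. es j \<in> assignments M \<and> R (es j) \<and> es j ` C \<inter> F0 = {} \<and>
            (\<forall>i<j. es i ` C \<inter> es j ` C = {})" by blast
  obtain e where e: "e \<in> assignments M" "R e" "e ` C \<inter> (F0 \<union> (\<Union>i<k. es i ` C)) = {}"
    using assms(1)[of "F0 \<union> (\<Union>i<k. es i ` C)"] assms(2,3) by auto
  have "(es(k := e)) j \<in> assignments M \<and> R ((es(k := e)) j) \<and> (es(k := e)) j ` C \<inter> F0 = {} \<and>
            (\<forall>i<j. (es(k := e)) i ` C \<inter> (es(k := e)) j ` C = {})" if "j < Suc k" for j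
  proof (cases "j = k")
    case True
    then show ?thesis using e by auto
  next
    case False
    then show ?thesis using es that by auto
  qed
  then show ?case by blast
qed simp

text \<open>Pairwise disjoint tuples that meet \<open>N\<close> contain distinct points of
  \<open>N\<close>.\<close>

lemma disjoint_realizations_near:
  fixes es :: "nat \<Rightarrow> nat \<Rightarrow> 'a"
  assumes "finite N" "\<forall>j<k. \<forall>i<j. es i ` C \<inter> es j ` C = {}"
  shows "card {j. j < k \<and> es j ` C \<inter> N \<noteq> {}} \<le> card N"
proof -
  let ?J = "{j. j < k \<and> es j ` C \<inter> N \<noteq> {}}"
  define h where "h j = (SOME a. a \<in> es j ` C \<inter> N)" for j
  have h: "h j \<in> es j ` C \<inter> N" if "j \<in> ?J" for j
    unfolding h_def by (rule someI_ex) (use that in blast)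
  have "inj_on h ?J"
  proof (rule inj_onI)
    fix i j assume ij: "i \<in> ?J" "j \<in> ?J" "h i = h j"
    then have "h i \<in> es i ` C \<inter> es j ` C" using h[OF ij(1)] h[OF ij(2)] ij(3) by auto
    then show "i = j" using assms(2) ij by (metis (no_types, lifting) Int_commute empty_iff
          linorder_neqE_nat mem_Collect_eq)
  qed
  moreover have "h ` ?J \<subseteq> N" using h by blast
  ultimately show ?thesis using assms(1) card_inj_on_le by blast
qed

text \<open>
  Fixing the variables outside \<^term>\<open>C\<close> generically with type \<^term>\<open>t\<close> gives a predicate on the
  variables in \<^term>\<open>C\<close>: among many disjoint realizations of \<^term>\<open>t\<close> at least one is not
  adjacent to two given tuples, so finitely many instances determine the generic value.
\<close>

lemma qf_definable_generic:
  assumes V: "finite V" "C \<subseteq> V" and \<Theta>: "MA_preds M V \<Theta>"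
    and F: "finite F" "F \<subseteq> univ M"
    and G: "qf_definable L M (\<lambda>e. e ` V \<inter> F = {} \<and> g (ty \<Theta> V e))"
    and t: "\<And>F. finite F \<Longrightarrow> \<exists>e\<in>assignments M. ty \<Theta> (V - C) e = t \<and> e ` (V - C) \<inter> F = {}"
  shows "qf_definable L M (\<lambda>e. e ` C \<inter> F = {} \<and> g (ty \<Theta> C e \<union> t))"
proof -
  define G' where "G' = (\<lambda>e. e ` V \<inter> F = {} \<and> g (ty \<Theta> V e))"
  obtain D where D: "\<forall>a. finite (edges M \<Theta> `` {a}) \<and> card (edges M \<Theta> `` {a}) \<le> D"
    using bounded_degree_edges[OF \<Theta>] by (auto simp: bounded_degree_def)
  \<comment> \<open>A tuple on \<open>C\<close> has at most \<open>card C * D\<close> neighbours and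
    so spoils at most that many of the disjoint realizations. With one more than twice this number,
    some index is good for both of two tuples.\<close>
  define k where "k = 2 * (card C * D) + 1"
  have fC: "finite C" "finite (V - C)" using V finite_subset by auto
  obtain es where es: "\<forall>j<k. es j \<in> assignments M \<and> ty \<Theta> (V - C) (es j) = t \<and>
      es j ` (V - C) \<inter> F = {} \<and> (\<forall>i<j. es i ` (V - C) \<inter> es j ` (V - C) = {})"
    using disjoint_realizations[OF t fC(2) F(1), of k] by auto
  define mrg where "mrg e j = (\<lambda>x. if x \<in> C then e x else es j x)" for e j
  define bad where "bad e = {j. j < k \<and> es j ` (V - C) \<inter> edges M \<Theta> `` (e ` C) \<noteq> {}}" for e
  have near: "finite (edges M \<Theta> `` (e ` C)) \<and> card (edges M \<Theta> `` (e ` C)) \<le> card C * D" for e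
    using bounded_degree_image[OF D, of "e ` C"] fC card_image_le[OF fC(1), of e]
    by (auto intro: order_trans mult_right_mono)
  have bad: "card (bad e) \<le> card C * D" for e
    unfolding bad_def
    using disjoint_realizations_near[of "edges M \<Theta> `` (e ` C)" k es "V - C"] near[of e] es
    by (auto intro: order_trans)
  have good: "G' (mrg e j) \<longleftrightarrow> g (ty \<Theta> C e \<union> t)"
    if e: "e \<in> assignments M" "e ` C \<inter> F = {}" and j: "j < k" "j \<notin> bad e" for e j
  proof -
    have m: "mrg e j \<in> assignments M" using e es j by (auto simp: mrg_def)
    have "es j ` (V - C) \<inter> F = {}" using es j by simp
    then have "mrg e j x \<notin> F" if "x \<in> V" for x
      using e(2) that by (cases "x \<in> C") (auto simp: mrg_def)
    then have "mrg e j ` V \<inter> F = {}" by auto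
    moreover have "ty \<Theta> V (mrg e j) = ty \<Theta> C e \<union> t"
    proof -
      have 1: "ty \<Theta> C e = ty \<Theta> C (mrg e j)"
        by (rule ty_cong[OF \<Theta> e(1) m]) (simp add: mrg_def)
      have "ty \<Theta> (V - C) (es j) = ty \<Theta> (V - C) (mrg e j)"
        by (rule ty_cong[OF \<Theta> _ m]) (use es j in \<open>auto simp: mrg_def\<close>)
      then have 2: "t = ty \<Theta> (V - C) (mrg e j)" using es j by simp
      \<comment> \<open>A true predicate straddling the cut would be an edge from an entry of
        \<open>e\<close> to one of \<open>es j\<close>, against the choice of j. So the type of the
        merged tuple is the union of the two types.\<close>
      have "fst q \<subseteq> C \<or> fst q \<subseteq> V - C" if q: "q \<in> \<Theta>" "snd q (mrg e j)" for q
      proof (rule ccontr)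
        assume "\<not> ?thesis"
        moreover have "fst q \<subseteq> V" using \<Theta> q by (auto simp: MA_preds_def)
        ultimately obtain x y where xy: "x \<in> fst q" "x \<in> C" "y \<in> fst q" "y \<in> V - C" by blast
        have "(mrg e j x, mrg e j y) \<in> edges M \<Theta>" using edgesI[OF q(1) m q(2)] xy by blast
        then have "(e x, es j y) \<in> edges M \<Theta>" using xy by (simp add: mrg_def)
        then show False using j xy by (auto simp: bad_def)
      qed
      then show ?thesis unfolding 1 2 using V(2) by (auto simp: ty_def)
    qed
    ultimately show ?thesis by (simp add: G'_def)
  qed
  \<comment> \<open>Each instance is quantifier-free in \<open>e\<close>, as the entries of
    \<open>es j\<close> enter as parameters. No single index works for every \<open>e\<close>, but
    any two assignments share a good one, which is all that \<open>determined_by\<close>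
    asks.\<close>
  let ?Q = "insert (\<lambda>e. e ` C \<inter> F = {}) ((\<lambda>j e. G' (mrg e j)) ` {..<k})"
  show ?thesis
  proof (rule definable_by_determined[of _ ?Q])
    fix q assume "q \<in> ?Q"
    then consider "q = (\<lambda>e. e ` C \<inter> F = {})" | j where "j < k" "q = (\<lambda>e. G' (mrg e j))" by auto
    then show "qf_definable L M q"
    proof cases
      case 1
      then show ?thesis using qf_definable_disjoint[OF fC(1) F] by simp
    next
      case 2
      then show ?thesis using qf_definable_fix[OF G, of "es j" C] es by (simp add: G'_def mrg_def)
    qed
  next
    show "determined_by M ?Q (\<lambda>e. e ` C \<inter> F = {} \<and> g (ty \<Theta> C e \<union> t))"
      unfolding determined_by_def
    proof (intro ballI impI)
      fix e e' assume e: "e \<in> assignments M" "e' \<in> assignments M" and eq: "\<forall>q\<in>?Q. q e \<longleftrightarrow> q e'"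
      have av: "e ` C \<inter> F = {} \<longleftrightarrow> e' ` C \<inter> F = {}"
        using bspec[OF eq, of "\<lambda>e. e ` C \<inter> F = {}"] by simp
      have "card (bad e \<union> bad e') < k"
        using card_Un_le[of "bad e" "bad e'"] bad[of e] bad[of e'] by (simp add: k_def)
      then have "\<not> {..<k} \<subseteq> bad e \<union> bad e'"
        using card_mono[of "bad e \<union> bad e'" "{..<k}"] by (auto simp: bad_def)
      then obtain j where j: "j < k" "j \<notin> bad e" "j \<notin> bad e'" by auto
      have "G' (mrg e j) \<longleftrightarrow> G' (mrg e' j)"
        using bspec[OF eq, of "\<lambda>e. G' (mrg e j)"] j by simp
      then show "(e ` C \<inter> F = {} \<and> g (ty \<Theta> C e \<union> t)) = (e' ` C \<inter> F = {} \<and> g (ty \<Theta> C e' \<union> t))"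
        using good[OF e(1) _ j(1,2)] good[OF e(2) _ j(1,3)] av by blast
    qed
  qed simp_all
qed

text \<open>If every cut of \<open>V\<close> is crossed by a true predicate, the ball of radius k
  around a variable gains a new variable at each step until it is all of \<open>V\<close>. So any
  two entries are joined by at most \<open>card V\<close> edges, and a power of a relation of
  bounded degree has bounded degree.\<close>

lemma bounded_degree_connected:
  assumes V: "finite V" and \<Theta>: "MA_preds M V \<Theta>"
    and E: "\<And>e C. e \<in> assignments M \<Longrightarrow> E e \<Longrightarrow> C \<subset> V \<Longrightarrow> C \<noteq> {} \<Longrightarrow>
      \<exists>q\<in>ty \<Theta> V e. \<not> fst q \<subseteq> C \<and> \<not> fst q \<subseteq> V - C"
  shows "bounded_degree (clique_graph M V E)"
proof -
  \<comment> \<open>The identity is included to make the powers of \<open>B\<close>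
    increasing.\<close>
  define B where "B = edges M \<Theta> \<union> Id"
  have "(e x, e y) \<in> B ^^ card V" if e: "e \<in> assignments M" "E e" and xy: "x \<in> V" "y \<in> V" for e x y
  proof -
    define S where "S k = {y\<in>V. (e x, e y) \<in> B ^^ k}" for k
    have fin: "finite (S k)" for k using V by (simp add: S_def)
    have mono: "S k \<subseteq> S (Suc k)" for k by (auto simp: S_def B_def)
    have xS: "x \<in> S k" for k by (induction k) (use xy mono in \<open>auto simp: S_def\<close>)
    have "S k = V \<or> k < card (S k)" for k
    proof (induction k)
      case 0
      have "0 < card (S 0)" unfolding card_gt_0_iff using xS[of 0] fin[of 0] by auto
      then show ?case by simp
    next
      case (Suc k)
      show ?case
      proof (cases "S k = V")
        case True
        then show ?thesis using mono[of k] by (auto simp: S_def)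
      next
        case False
        then have "S k \<subset> V" "S k \<noteq> {}" using xS by (auto simp: S_def)
        from E[OF e this] obtain q where q: "q \<in> \<Theta>" "fst q \<subseteq> V" "snd q e" "\<not> fst q \<subseteq> S k"
          "\<not> fst q \<subseteq> V - S k" using ty_subset[of \<Theta> V e] unfolding ty_def by blast
        then obtain y z where yz: "y \<in> fst q" "y \<in> S k" "z \<in> fst q" "z \<notin> S k" by blast
        have "(e y, e z) \<in> B" using edgesI[OF q(1) e(1) q(3) yz(1,3)] by (simp add: B_def)
        then have "z \<in> S (Suc k)" using yz q by (auto simp: S_def)
        then have "card (S k) < card (S (Suc k))"
          using yz mono[of k] by (intro psubset_card_mono fin) auto
        then show ?thesis using Suc False by auto
      qed
    qed
    from this[of "card V"] have "S (card V) = V"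
      using card_mono[OF V, of "S (card V)"] by (auto simp: S_def)
    then show ?thesis using xy by (auto simp: S_def)
  qed
  then have "clique_graph M V E \<subseteq> B ^^ card V" by (auto simp: clique_graph_def)
  moreover have "bounded_degree (B ^^ card V)"
    unfolding B_def
    by (intro bounded_degree_relpow bounded_degree_Un bounded_degree_edges[OF \<Theta>] bounded_degree_Id)
  ultimately show ?thesis using bounded_degree_subset by blast
qed

lemma depends_on_fix:
  "depends_on M W \<theta> \<Longrightarrow> e' \<in> assignments M \<Longrightarrow>
   depends_on M (W \<inter> C) (\<lambda>e. \<theta> (\<lambda>x. if x \<in> C then e x else e' x))"
  unfolding depends_on_def by (intro ballI impI) (auto intro!: assignmentsI)

text \<open>Fixing variables restricts both the assignments and the variables considered, so the
  clique graph can only lose edges.\<close>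

lemma MA_preds_fix:
  assumes \<Theta>: "MA_preds M V \<Theta>" and e': "e' \<in> assignments M"
  shows "MA_preds M (V \<inter> C) ((\<lambda>q. (fst q \<inter> C, \<lambda>e. snd q (\<lambda>x. if x \<in> C then e x else e' x))) ` \<Theta>)"
  unfolding MA_preds_def
proof (intro conjI ballI)
  fix q' assume "q' \<in> (\<lambda>q. (fst q \<inter> C, \<lambda>e. snd q (\<lambda>x. if x \<in> C then e x else e' x))) ` \<Theta>"
  then obtain q where q: "q \<in> \<Theta>" "q' = (fst q \<inter> C, \<lambda>e. snd q (\<lambda>x. if x \<in> C then e x else e' x))"
    by blast
  have *: "fst q \<subseteq> V" "depends_on M (fst q) (snd q)"
    "bounded_degree (clique_graph M (fst q) (snd q))" using \<Theta> q(1) by (auto simp: MA_preds_def)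
  show "fst q' \<subseteq> V \<inter> C" using * q by auto
  show "depends_on M (fst q') (snd q')" using depends_on_fix[OF *(2) e'] q by simp
  have "clique_graph M (fst q') (snd q') \<subseteq> clique_graph M (fst q) (snd q)"
  proof
    fix p assume "p \<in> clique_graph M (fst q') (snd q')"
    then obtain e x y where p: "p = (e x, e y)" "e \<in> assignments M"
      "snd q (\<lambda>x. if x \<in> C then e x else e' x)" "x \<in> fst q \<inter> C" "y \<in> fst q \<inter> C"
      unfolding clique_graph_def q(2) by auto
    then show "p \<in> clique_graph M (fst q) (snd q)"
      unfolding clique_graph_def mem_Collect_eq using e'
      by (intro exI[of _ "\<lambda>x. if x \<in> C then e x else e' x"] exI[of _ x] exI[of _ y]) auto
  qed
  then show "bounded_degree (clique_graph M (fst q') (snd q'))" using *(3) bounded_degree_subset by blast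
qed (use \<Theta> in \<open>auto simp: MA_preds_def\<close>)

lemma determined_by_fix:
  assumes "determined_by M Q P" "e' \<in> assignments M"
  shows "determined_by M ((\<lambda>q e. q (\<lambda>x. if x \<in> C then e x else e' x)) ` Q)
    (\<lambda>e. P (\<lambda>x. if x \<in> C then e x else e' x))"
  unfolding determined_by_def
proof (intro ballI impI)
  fix e1 e2
  assume e: "e1 \<in> assignments M" "e2 \<in> assignments M"
    and eq: "\<forall>q\<in>(\<lambda>q e. q (\<lambda>x. if x \<in> C then e x else e' x)) ` Q. q e1 \<longleftrightarrow> q e2"
  show "P (\<lambda>x. if x \<in> C then e1 x else e' x) = P (\<lambda>x. if x \<in> C then e2 x else e' x)"
  proof (rule determined_byD[OF assms(1)])
    fix q assume "q \<in> Q"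
    from bspec[OF eq imageI[OF this]]
    show "q (\<lambda>x. if x \<in> C then e1 x else e' x) \<longleftrightarrow> q (\<lambda>x. if x \<in> C then e2 x else e' x)" by simp
  qed (use e assms(2) in auto)
qed

section \<open>Families of mutually algebraic predicates that are quantifier-free definable\<close>

definition qf_MA_preds :: "language \<Rightarrow> 'a struct \<Rightarrow> nat set \<Rightarrow>
    (nat set \<times> ((nat \<Rightarrow> 'a) \<Rightarrow> bool)) set \<Rightarrow> bool" where
  "qf_MA_preds L M V Q \<longleftrightarrow> MA_preds M V Q \<and> (\<forall>q\<in>Q. qf_definable L M (snd q))"

lemma qf_MA_preds_mono: "qf_MA_preds L M V Q \<Longrightarrow> V \<subseteq> W \<Longrightarrow> qf_MA_preds L M W Q"
  by (fastforce simp: qf_MA_preds_def MA_preds_def)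

lemma qf_MA_preds_Un: "qf_MA_preds L M V Q \<Longrightarrow> qf_MA_preds L M V R \<Longrightarrow> qf_MA_preds L M V (Q \<union> R)"
  by (auto simp: qf_MA_preds_def MA_preds_def)

lemma qf_MA_preds_empty: "qf_MA_preds L M V {}"
  by (auto simp: qf_MA_preds_def MA_preds_def)

lemma qf_MA_preds_UN:
  "finite I \<Longrightarrow> (\<And>i. i \<in> I \<Longrightarrow> qf_MA_preds L M V (Q i)) \<Longrightarrow> qf_MA_preds L M V (\<Union>i\<in>I. Q i)"
  by (auto simp: qf_MA_preds_def MA_preds_def)

definition eq_preds :: "nat set \<Rightarrow> 'a set \<Rightarrow> (nat set \<times> ((nat \<Rightarrow> 'a) \<Rightarrow> bool)) set" where
  "eq_preds V F = (\<lambda>(x, a). ({x}, \<lambda>e. e x = a)) ` (V \<times> F)"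

text \<open>An equation with a fixed element involves a single variable, so its clique graph
  consists of loops.\<close>

lemma qf_MA_preds_eq:
  assumes "finite V" "finite F" "F \<subseteq> univ M"
  shows "qf_MA_preds L M V (eq_preds V F)"
proof -
  have "bounded_degree (clique_graph M {x} (\<lambda>e. e x = a))" for x and a :: 'a
    by (rule bounded_degree_subset[OF bounded_degree_Id]) (auto simp: clique_graph_def)
  then show ?thesis using assms
    by (auto simp: qf_MA_preds_def MA_preds_def eq_preds_def depends_on_def
        intro!: qf_definable_eq)
qed

lemma eq_predsD:
  assumes "\<forall>q\<in>eq_preds V F. snd q e \<longleftrightarrow> snd q e'" "x \<in> V" "a \<in> F"
  shows "e x = a \<longleftrightarrow> e' x = a"
  using assms by (auto simp: eq_preds_def)

lemma eq_preds_disjoint: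
  assumes "\<forall>q\<in>eq_preds C F. snd q e \<longleftrightarrow> snd q e'"
  shows "e ` C \<inter> F = {} \<longleftrightarrow> e' ` C \<inter> F = {}"
proof -
  have "e x \<in> F \<longleftrightarrow> e' x \<in> F" if "x \<in> C" for x
    using eq_predsD[OF assms that] by metis
  then show ?thesis by auto
qed

lemma ty_split:
  assumes "C \<subseteq> V"
  shows "{q\<in>ty \<Theta> V e. fst q \<subseteq> C \<or> fst q \<subseteq> V - C} = ty \<Theta> C e \<union> ty \<Theta> (V - C) e"
  using assms by (auto simp: ty_def)

lemma determined_by_ty:
  assumes "MA_preds M V \<Theta>" "determined_by M (snd ` \<Theta>) P"
    "e \<in> assignments M" "e' \<in> assignments M" "ty \<Theta> V e = ty \<Theta> V e'"
  shows "P e = P e'"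
proof (rule determined_byD[OF assms(2-4)])
  fix q assume "q \<in> snd ` \<Theta>"
  then obtain p where p: "p \<in> \<Theta>" "q = snd p" by blast
  moreover have "fst p \<subseteq> V" using assms(1) p by (auto simp: MA_preds_def)
  ultimately have "q e \<longleftrightarrow> p \<in> ty \<Theta> V e" "q e' \<longleftrightarrow> p \<in> ty \<Theta> V e'" by (auto simp: ty_def)
  then show "q e \<longleftrightarrow> q e'" using assms(5) by simp
qed

text \<open>
  The pieces in \<^term>\<open>\<Theta>\<close> need not be quantifier-free definable. Let $F$ hit all realizations of the
  types that are realized by only finitely many disjoint tuples. On tuples avoiding $F$, subtract
  from \<^term>\<open>P\<close>, for every cut $V = C \cup (V - C)$ in turn, the value that \<^term>\<open>P\<close> would take
  if the two parts were not adjacent. These values depend on predicates in fewer variables, and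
  what remains lives on connected tuples, so it is mutually algebraic.
\<close>

lemma qf_MA_decomposition:
  fixes M :: "'a struct"
  assumes "univ M \<noteq> {}"
  shows "finite V \<Longrightarrow> depends_on M V P \<Longrightarrow> qf_definable L M P \<Longrightarrow> MA_preds M V \<Theta> \<Longrightarrow>
    determined_by M (snd ` \<Theta>) P \<Longrightarrow> \<exists>Q. qf_MA_preds L M V Q \<and> determined_by M (snd ` Q) P"
proof (induction "card V" arbitrary: V P \<Theta> rule: less_induct)
  case less
  note V = less.prems(1) and dep = less.prems(2) and qd = less.prems(3) and \<Theta> = less.prems(4)
    and det = less.prems(5)
  obtain a0 where a0: "a0 \<in> univ M" using assms by blast
  have fin\<Theta>: "finite \<Theta>" using \<Theta> by (simp add: MA_preds_def)
  define hits where "hits F C t \<longleftrightarrow> finite F \<and> F \<subseteq> univ M \<and>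
    (\<forall>e\<in>assignments M. ty \<Theta> C e = t \<longrightarrow> e ` C \<inter> F \<noteq> {})" for F C t
  define small where "small C t \<longleftrightarrow> (\<exists>F. hits F C t)" for C t
  define hit where "hit C t = (SOME F. hits F C t)" for C t
  have hit: "hits (hit C t) C t" if "small C t" for C t
    using that someI_ex[of "\<lambda>F. hits F C t"] unfolding small_def hit_def by blast
  \<comment> \<open>One hitting set for every small type of every subset of \<open>V\<close>; these
    are finitely many. A tuple that avoids \<open>F\<close> therefore has, on each subset of
    \<open>V\<close>, a type realized outside every finite set.\<close>
  define F where "F = (\<Union>p\<in>{p\<in>Pow V \<times> Pow \<Theta>. small (fst p) (snd p)}. hit (fst p) (snd p))"
  have F: "finite F" "F \<subseteq> univ M"
  proof -
    show "finite F" unfolding F_def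
      by (intro finite_UN_I) (use V fin\<Theta> hit in \<open>auto simp: hits_def\<close>)
    show "F \<subseteq> univ M" unfolding F_def using hit unfolding hits_def by blast
  qed
  have big: "\<not> small C (ty \<Theta> C e)" if "e \<in> assignments M" "e ` V \<inter> F = {}" "C \<subseteq> V" for C e
  proof
    assume s: "small C (ty \<Theta> C e)"
    have "(C, ty \<Theta> C e) \<in> {p\<in>Pow V \<times> Pow \<Theta>. small (fst p) (snd p)}"
      using s that(3) ty_subset[of \<Theta> C e] by auto
    from UN_upper[OF this, of "\<lambda>p. hit (fst p) (snd p)"] have "hit C (ty \<Theta> C e) \<subseteq> F"
      unfolding F_def by simp
    moreover have "e ` C \<inter> hit C (ty \<Theta> C e) \<noteq> {}" using hit[OF s] that(1) by (simp add: hits_def)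
    ultimately show False using that by blast
  qed
  have bigD: "\<exists>e\<in>assignments M. ty \<Theta> C e = t \<and> e ` C \<inter> X = {}" if "\<not> small C t" "finite X" for C t X
  proof -
    have "\<not> hits (X \<inter> univ M) C t" using that by (auto simp: small_def)
    then obtain e where "e \<in> assignments M" "ty \<Theta> C e = t" "e ` C \<inter> (X \<inter> univ M) = {}"
      using finite_Int[OF disjI1[OF \<open>finite X\<close>], of "univ M"] unfolding hits_def by blast
    then show ?thesis by (intro bexI[of _ e]) (auto simp: assignments_def)
  qed
  define av where "av = (\<lambda>e::nat \<Rightarrow> 'a. e ` V \<inter> F = {})"
  have qd_av: "qf_definable L M av" unfolding av_def using qf_definable_disjoint[OF V F] .

  \<comment> \<open>For a fixed large type on the other side, the generic value is a predicate in
    fewer variables, so the induction hypothesis applies. The equations with points of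
    \<open>F\<close> join \<open>\<Theta>\<close> because the predicate also asks that
    \<open>F\<close> be avoided.\<close>
  have side: "\<exists>Q. qf_MA_preds L M V Q \<and>
      determined_by M (snd ` Q) (\<lambda>e. e ` C \<inter> F = {} \<and> g (ty \<Theta> C e \<union> t))"
    if C: "C \<subset> V" and g: "qf_definable L M (\<lambda>e. av e \<and> g (ty \<Theta> V e))" and t: "\<not> small (V - C) t"
    for C g t
  proof -
    let ?P = "\<lambda>e. e ` C \<inter> F = {} \<and> g (ty \<Theta> C e \<union> t)"
    let ?\<Theta> = "{q\<in>\<Theta>. fst q \<subseteq> C} \<union> eq_preds C F"
    have CV: "C \<subseteq> V" and finC: "finite C" using C V finite_subset by auto
    have 1: "depends_on M C ?P"
      unfolding depends_on_def
    proof (intro ballI impI)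
      fix e e' assume e: "e \<in> assignments M" "e' \<in> assignments M" "\<forall>x\<in>C. e x = e' x"
      have "ty \<Theta> C e = ty \<Theta> C e'" by (rule ty_cong[OF \<Theta> e])
      moreover have "e ` C = e' ` C" using e(3) by auto
      ultimately show "?P e = ?P e'" by simp
    qed
    have 2: "qf_definable L M ?P"
      by (rule qf_definable_generic[OF V CV \<Theta> F g[unfolded av_def]]) (use bigD[OF t] in blast)
    have 3: "MA_preds M C ?\<Theta>"
      using \<Theta> qf_MA_preds_eq[OF finC F] by (auto simp: MA_preds_def qf_MA_preds_def)
    have 4: "determined_by M (snd ` ?\<Theta>) ?P"
      unfolding determined_by_def
    proof (intro ballI impI)
      fix e e' assume e: "e \<in> assignments M" "e' \<in> assignments M"
        and eq: "\<forall>q\<in>snd ` ?\<Theta>. q e \<longleftrightarrow> q e'"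
      have eq: "snd q e \<longleftrightarrow> snd q e'" if "q \<in> ?\<Theta>" for q using bspec[OF eq imageI[OF that]] .
      have "ty \<Theta> C e = ty \<Theta> C e'" unfolding ty_def using eq by blast
      moreover have "e ` C \<inter> F = {} \<longleftrightarrow> e' ` C \<inter> F = {}"
        by (rule eq_preds_disjoint) (use eq in blast)
      ultimately show "?P e = ?P e'" by simp
    qed
    obtain Q where "qf_MA_preds L M C Q" "determined_by M (snd ` Q) ?P"
      using less.hyps[OF psubset_card_mono[OF V C] finC 1 2 3 4] by blast
    then show ?thesis using qf_MA_preds_mono[OF _ CV] by blast
  qed

  have cut: "\<exists>Q. qf_MA_preds L M V Q \<and> (\<forall>e\<in>assignments M. \<forall>e'\<in>assignments M. av e \<longrightarrow> av e' \<longrightarrow>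
        (\<forall>q\<in>Q. snd q e \<longleftrightarrow> snd q e') \<longrightarrow>
        g (ty \<Theta> C e \<union> ty \<Theta> (V - C) e) = g (ty \<Theta> C e' \<union> ty \<Theta> (V - C) e'))"
    if C: "C \<subset> V" "C \<noteq> {}" and g: "qf_definable L M (\<lambda>e. av e \<and> g (ty \<Theta> V e))" for C g
  proof -
    let ?I = "{t\<in>Pow \<Theta>. \<not> small (V - C) t}" and ?J = "{t\<in>Pow \<Theta>. \<not> small C t}"
    have VC: "V - C \<subset> V" "V - (V - C) = C" using C by auto
    have "\<forall>t\<in>?I. \<exists>Q. qf_MA_preds L M V Q \<and>
      determined_by M (snd ` Q) (\<lambda>e. e ` C \<inter> F = {} \<and> g (ty \<Theta> C e \<union> t))"
      using side[OF C(1) g] by blast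
    then obtain Q1 where Q1: "\<forall>t\<in>?I. qf_MA_preds L M V (Q1 t) \<and>
      determined_by M (snd ` Q1 t) (\<lambda>e. e ` C \<inter> F = {} \<and> g (ty \<Theta> C e \<union> t))"
      unfolding bchoice_iff by blast
    have "\<forall>t\<in>?J. \<exists>Q. qf_MA_preds L M V Q \<and>
      determined_by M (snd ` Q) (\<lambda>e. e ` (V - C) \<inter> F = {} \<and> g (ty \<Theta> (V - C) e \<union> t))"
      using side[OF VC(1) g, unfolded VC(2)] by blast
    then obtain Q2 where Q2: "\<forall>t\<in>?J. qf_MA_preds L M V (Q2 t) \<and>
      determined_by M (snd ` Q2 t) (\<lambda>e. e ` (V - C) \<inter> F = {} \<and> g (ty \<Theta> (V - C) e \<union> t))"
      unfolding bchoice_iff by blast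
    let ?Q = "(\<Union>t\<in>?I. Q1 t) \<union> (\<Union>t\<in>?J. Q2 t)"
    have "qf_MA_preds L M V ?Q"
      using Q1 Q2 fin\<Theta> by (intro qf_MA_preds_Un qf_MA_preds_UN) auto
    moreover have "g (ty \<Theta> C e \<union> ty \<Theta> (V - C) e) = g (ty \<Theta> C e' \<union> ty \<Theta> (V - C) e')"
      if e: "e \<in> assignments M" "e' \<in> assignments M" "av e" "av e'"
        and eq: "\<forall>q\<in>?Q. snd q e \<longleftrightarrow> snd q e'" for e e'
    proof -
      have avs: "e ` C \<inter> F = {}" "e' ` C \<inter> F = {}" "e ` (V - C) \<inter> F = {}" "e' ` (V - C) \<inter> F = {}"
        using e(3,4) C unfolding av_def by auto
      have tI: "ty \<Theta> (V - C) e \<in> ?I" using big[OF e(1), of "V - C"] e(3) ty_subset[of \<Theta> "V - C" e]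
        by (simp add: av_def)
      have tJ: "ty \<Theta> C e' \<in> ?J" using big[OF e(2), of C] e(4) C(1) ty_subset[of \<Theta> C e']
        by (simp add: av_def)
      \<comment> \<open>Pass from \<open>e\<close> to \<open>e'\<close> in two moves: change the
        type on \<open>C\<close> while keeping that of \<open>e\<close> on \<open>V - C\<close>,
        then change the type on \<open>V - C\<close> while keeping that of \<open>e'\<close> on
        \<open>C\<close>. Each move has one side fixed, as \<open>side\<close> requires.\<close>
      have "(e ` C \<inter> F = {} \<and> g (ty \<Theta> C e \<union> ty \<Theta> (V - C) e)) =
            (e' ` C \<inter> F = {} \<and> g (ty \<Theta> C e' \<union> ty \<Theta> (V - C) e))"
        by (rule determined_byD[OF conjunct2[OF bspec[OF Q1 tI]] e(1,2)])
           (use eq tI in blast)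
      moreover have "(e ` (V - C) \<inter> F = {} \<and> g (ty \<Theta> (V - C) e \<union> ty \<Theta> C e')) =
            (e' ` (V - C) \<inter> F = {} \<and> g (ty \<Theta> (V - C) e' \<union> ty \<Theta> C e'))"
        by (rule determined_byD[OF conjunct2[OF bspec[OF Q2 tJ]] e(1,2)])
           (use eq tJ in blast)
      ultimately show ?thesis using avs by (simp add: Un_commute)
    qed
    ultimately show ?thesis by (intro exI[of _ ?Q]) blast
  qed

  \<comment> \<open>\<open>g\<close> is what remains of \<open>P\<close>, as a function of the type,
    once the pieces in \<open>Q\<close> are known. For each cut already treated, it vanishes on all
    types without a predicate that straddles this cut.\<close>
  have iter: "\<exists>g Q. qf_definable L M (\<lambda>e. av e \<and> g (ty \<Theta> V e)) \<and> qf_MA_preds L M V Q \<and>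
      (\<forall>C\<in>set Cs. \<forall>t\<subseteq>\<Theta>. (\<forall>q\<in>t. fst q \<subseteq> C \<or> fst q \<subseteq> V - C) \<longrightarrow> \<not> g t) \<and>
      (\<forall>e\<in>assignments M. \<forall>e'\<in>assignments M. av e \<longrightarrow> av e' \<longrightarrow> (\<forall>q\<in>Q. snd q e \<longleftrightarrow> snd q e') \<longrightarrow>
         g (ty \<Theta> V e) = g (ty \<Theta> V e') \<longrightarrow> P e = P e')"
    if "set Cs \<subseteq> {C. C \<subset> V \<and> C \<noteq> {}}" for Cs
    using that
  proof (induction Cs)
    case Nil
    define g where "g t \<longleftrightarrow> (\<exists>e\<in>assignments M. ty \<Theta> V e = t \<and> P e)" for t
    have g: "g (ty \<Theta> V e) \<longleftrightarrow> P e" if "e \<in> assignments M" for e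
      unfolding g_def using determined_by_ty[OF \<Theta> det] that by blast
    have "qf_definable L M (\<lambda>e. av e \<and> P e)"
      by (intro definable_by_conj qd qd_av bool_closed_qf_formulas)
    then have "qf_definable L M (\<lambda>e. av e \<and> g (ty \<Theta> V e))" by (simp add: g cong: definable_by_cong)
    then show ?case by (intro exI[of _ g] exI[of _ "{}"]) (simp add: g qf_MA_preds_empty)
  next
    case (Cons C Cs)
    then obtain g Q where gQ: "qf_definable L M (\<lambda>e. av e \<and> g (ty \<Theta> V e))" "qf_MA_preds L M V Q"
      "\<forall>C\<in>set Cs. \<forall>t\<subseteq>\<Theta>. (\<forall>q\<in>t. fst q \<subseteq> C \<or> fst q \<subseteq> V - C) \<longrightarrow> \<not> g t"
      "\<forall>e\<in>assignments M. \<forall>e'\<in>assignments M. av e \<longrightarrow> av e' \<longrightarrow> (\<forall>q\<in>Q. snd q e \<longleftrightarrow> snd q e') \<longrightarrow>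
         g (ty \<Theta> V e) = g (ty \<Theta> V e') \<longrightarrow> P e = P e'" by auto
    have C: "C \<subset> V" "C \<noteq> {}" using Cons.prems by auto
    obtain R where R: "qf_MA_preds L M V R"
      "\<forall>e\<in>assignments M. \<forall>e'\<in>assignments M. av e \<longrightarrow> av e' \<longrightarrow> (\<forall>q\<in>R. snd q e \<longleftrightarrow> snd q e') \<longrightarrow>
        g (ty \<Theta> C e \<union> ty \<Theta> (V - C) e) = g (ty \<Theta> C e' \<union> ty \<Theta> (V - C) e')"
      using cut[OF C gQ(1)] by blast
    define T where "T t = {q\<in>t. fst q \<subseteq> C \<or> fst q \<subseteq> V - C}" for t :: "(nat set \<times> ((nat \<Rightarrow> 'a) \<Rightarrow> bool)) set"
    \<comment> \<open>Inequality of truth values is subtraction modulo 2. On a type without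
      predicates straddling \<open>C\<close>, which \<open>T\<close> leaves unchanged, the
      difference vanishes; on a type without predicates straddling an earlier cut both terms vanish,
      because \<open>T\<close> only shrinks types.\<close>
    define g' where "g' t \<longleftrightarrow> g t \<noteq> g (T t)" for t
    have Tty: "T (ty \<Theta> V e) = ty \<Theta> C e \<union> ty \<Theta> (V - C) e" for e
      unfolding T_def using ty_split C(1) by blast
    have gT: "g (T (ty \<Theta> V e)) = g (T (ty \<Theta> V e'))"
      if "e \<in> assignments M" "e' \<in> assignments M" "av e" "av e'" "\<forall>q\<in>R. snd q e \<longleftrightarrow> snd q e'" for e e'
      using R(2) that unfolding Tty by blast
    have "qf_definable L M (\<lambda>e. av e \<and> g' (ty \<Theta> V e))"
    proof (rule definable_by_determined[of _ "insert av (insert (\<lambda>e. av e \<and> g (ty \<Theta> V e)) (snd ` R))"])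
      show "finite (insert av (insert (\<lambda>e. av e \<and> g (ty \<Theta> V e)) (snd ` R)))"
        using R(1) by (simp add: qf_MA_preds_def MA_preds_def)
      show "qf_definable L M q"
        if "q \<in> insert av (insert (\<lambda>e. av e \<and> g (ty \<Theta> V e)) (snd ` R))" for q
        using that qd_av gQ(1) R(1) by (auto simp: qf_MA_preds_def)
      show "determined_by M (insert av (insert (\<lambda>e. av e \<and> g (ty \<Theta> V e)) (snd ` R)))
          (\<lambda>e. av e \<and> g' (ty \<Theta> V e))"
        unfolding determined_by_def
      proof (intro ballI impI)
        fix e e' assume e: "e \<in> assignments M" "e' \<in> assignments M"
          and eq: "\<forall>q\<in>insert av (insert (\<lambda>e. av e \<and> g (ty \<Theta> V e)) (snd ` R)). q e \<longleftrightarrow> q e'"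
        have 1: "av e = av e'" "(av e \<and> g (ty \<Theta> V e)) = (av e' \<and> g (ty \<Theta> V e'))"
          and 2: "\<forall>q\<in>R. snd q e \<longleftrightarrow> snd q e'"
          using eq by auto
        show "(av e \<and> g' (ty \<Theta> V e)) = (av e' \<and> g' (ty \<Theta> V e'))"
          using 1 gT[OF e _ _ 2] unfolding g'_def by blast
      qed
    qed simp
    moreover have "qf_MA_preds L M V (Q \<union> R)" using gQ(2) R(1) by (rule qf_MA_preds_Un)
    moreover have "\<forall>C'\<in>set (C # Cs). \<forall>t\<subseteq>\<Theta>. (\<forall>q\<in>t. fst q \<subseteq> C' \<or> fst q \<subseteq> V - C') \<longrightarrow> \<not> g' t"
    proof (intro ballI allI impI)
      fix C' t assume C': "C' \<in> set (C # Cs)" and t: "t \<subseteq> \<Theta>" "\<forall>q\<in>t. fst q \<subseteq> C' \<or> fst q \<subseteq> V - C'"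
      show "\<not> g' t"
      proof (cases "C' \<in> set Cs")
        case True
        have "\<not> g t" using gQ(3) True t by blast
        moreover have "T t \<subseteq> \<Theta>" "\<forall>q\<in>T t. fst q \<subseteq> C' \<or> fst q \<subseteq> V - C'" using t by (auto simp: T_def)
        then have "\<not> g (T t)" using gQ(3) True by blast
        ultimately show ?thesis by (simp add: g'_def)
      next
        case False
        then have "T t = t" using C' t(2) by (auto simp: T_def)
        then show ?thesis by (simp add: g'_def)
      qed
    qed
    moreover have "P e = P e'" if e: "e \<in> assignments M" "e' \<in> assignments M" "av e" "av e'"
      and eq: "\<forall>q\<in>Q \<union> R. snd q e \<longleftrightarrow> snd q e'" and eq': "g' (ty \<Theta> V e) = g' (ty \<Theta> V e')" for e e'
    proof -
      have "g (T (ty \<Theta> V e)) = g (T (ty \<Theta> V e'))" using gT[OF e] eq by blast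
      then have "g (ty \<Theta> V e) = g (ty \<Theta> V e')" using eq' unfolding g'_def by blast
      then show ?thesis using gQ(4) e eq by blast
    qed
    ultimately show ?case by (intro exI[of _ g'] exI[of _ "Q \<union> R"]) blast
  qed

  have "finite {C. C \<subset> V \<and> C \<noteq> {}}" by (rule finite_subset[of _ "Pow V"]) (use V in auto)
  from finite_list[OF this] obtain Cs where Cs: "set Cs = {C. C \<subset> V \<and> C \<noteq> {}}" ..
  then have "set Cs \<subseteq> {C. C \<subset> V \<and> C \<noteq> {}}" by simp
  from iter[OF this] obtain g Q where g: "qf_definable L M (\<lambda>e. av e \<and> g (ty \<Theta> V e))"
    and Q: "qf_MA_preds L M V Q"
    and van: "\<forall>C\<in>set Cs. \<forall>t\<subseteq>\<Theta>. (\<forall>q\<in>t. fst q \<subseteq> C \<or> fst q \<subseteq> V - C) \<longrightarrow> \<not> g t"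
    and detg: "\<forall>e\<in>assignments M. \<forall>e'\<in>assignments M. av e \<longrightarrow> av e' \<longrightarrow>
      (\<forall>q\<in>Q. snd q e \<longleftrightarrow> snd q e') \<longrightarrow> g (ty \<Theta> V e) = g (ty \<Theta> V e') \<longrightarrow> P e = P e'"
    by (elim exE conjE) (rule that)
  \<comment> \<open>With all proper cuts treated, a type on which \<open>g\<close> holds has a
    predicate across every cut, which is the hypothesis of
    \<open>bounded_degree_connected\<close>.\<close>
  define E where "E = (\<lambda>e. av e \<and> g (ty \<Theta> V e))"
  have "bounded_degree (clique_graph M V E)"
  proof (rule bounded_degree_connected[OF V \<Theta>])
    fix e C assume "e \<in> assignments M" "E e" "C \<subset> V" "C \<noteq> {}"
    then have "C \<in> set Cs" "g (ty \<Theta> V e)" by (simp_all add: Cs E_def)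
    from bspec[OF van this(1), THEN spec, of "ty \<Theta> V e", THEN mp, OF ty_subset] this(2)
    show "\<exists>q\<in>ty \<Theta> V e. \<not> fst q \<subseteq> C \<and> \<not> fst q \<subseteq> V - C" by meson
  qed
  moreover have "depends_on M V E" unfolding depends_on_def
  proof (intro ballI impI)
    fix e e' assume e: "e \<in> assignments M" "e' \<in> assignments M" "\<forall>x\<in>V. e x = e' x"
    have "ty \<Theta> V e = ty \<Theta> V e'" by (rule ty_cong[OF \<Theta> e])
    moreover have "e ` V = e' ` V" using e(3) by auto
    ultimately show "E e = E e'" by (simp add: E_def av_def)
  qed
  ultimately have QE: "qf_MA_preds L M V {(V, E)}"
    using g by (simp add: qf_MA_preds_def MA_preds_def E_def)

  \<comment> \<open>It remains to treat tuples that meet \<open>F\<close>. There some coordinate x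
    equals some a in \<open>F\<close>; fixing it leaves a predicate in one variable fewer, to which
    the induction hypothesis applies.\<close>
  define plug where "plug x a e = (\<lambda>y. if y \<in> - {x} then e y else (\<lambda>_. a) y)" for x a and e :: "nat \<Rightarrow> 'a"
  have "\<exists>R. qf_MA_preds L M V R \<and> determined_by M (snd ` R) (\<lambda>e. P (plug x a e))"
    if x: "x \<in> V" and a: "a \<in> F" for x a
  proof -
    have a': "(\<lambda>_. a) \<in> assignments M" using a F by auto
    have 0: "card (V \<inter> - {x}) < card V" by (rule psubset_card_mono[OF V]) (use x in auto)
    have 1: "depends_on M (V \<inter> - {x}) (\<lambda>e. P (plug x a e))"
      unfolding plug_def by (rule depends_on_fix[OF dep a'])
    have 2: "qf_definable L M (\<lambda>e. P (plug x a e))"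
      unfolding plug_def by (rule qf_definable_fix[OF qd a'])
    obtain \<Theta>' where \<Theta>': "\<Theta>' = (\<lambda>q. (fst q \<inter> - {x}, \<lambda>e. snd q (plug x a e))) ` \<Theta>" by simp
    have 3: "MA_preds M (V \<inter> - {x}) \<Theta>'"
      unfolding \<Theta>' plug_def by (rule MA_preds_fix[OF \<Theta> a'])
    have im: "snd ` \<Theta>' = (\<lambda>q e. q (plug x a e)) ` (snd ` \<Theta>)" unfolding \<Theta>' by (simp add: image_image)
    have 4: "determined_by M (snd ` \<Theta>') (\<lambda>e. P (plug x a e))"
      unfolding im plug_def by (rule determined_by_fix[OF det a'])
    obtain R where "qf_MA_preds L M (V \<inter> - {x}) R" "determined_by M (snd ` R) (\<lambda>e. P (plug x a e))"
      using less.hyps[OF 0 _ 1 2 3 4] V by blast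
    then show ?thesis using qf_MA_preds_mono by blast
  qed
  then have "\<forall>p\<in>V \<times> F. \<exists>R. qf_MA_preds L M V R \<and>
      determined_by M (snd ` R) (\<lambda>e. P (plug (fst p) (snd p) e))" by auto
  then obtain R where R: "\<forall>p\<in>V \<times> F. qf_MA_preds L M V (R p) \<and>
      determined_by M (snd ` R p) (\<lambda>e. P (plug (fst p) (snd p) e))" unfolding bchoice_iff by blast
  let ?Q = "Q \<union> {(V, E)} \<union> eq_preds V F \<union> (\<Union>p\<in>V \<times> F. R p)"
  have "qf_MA_preds L M V ?Q"
    using R V F by (intro qf_MA_preds_Un qf_MA_preds_UN Q QE qf_MA_preds_eq) auto
  moreover have "determined_by M (snd ` ?Q) P"
    unfolding determined_by_def
  proof (intro ballI impI)
    fix e e' assume e: "e \<in> assignments M" "e' \<in> assignments M"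
      and eq0: "\<forall>q\<in>snd ` ?Q. q e \<longleftrightarrow> q e'"
    have eq: "snd q e \<longleftrightarrow> snd q e'" if "q \<in> ?Q" for q using bspec[OF eq0 imageI[OF that]] .
    have eqs: "e x = a \<longleftrightarrow> e' x = a" if "x \<in> V" "a \<in> F" for x a
      by (rule eq_predsD[OF _ that]) (use eq in blast)
    have av: "av e = av e'" unfolding av_def by (rule eq_preds_disjoint) (use eq in blast)
    show "P e = P e'"
    proof (cases "av e")
      case True
      moreover have "E e = E e'" using eq[of "(V, E)"] by simp
      ultimately have "av e'" "g (ty \<Theta> V e) = g (ty \<Theta> V e')" using av by (auto simp: E_def)
      moreover have "\<forall>q\<in>Q. snd q e \<longleftrightarrow> snd q e'" using eq by simp
      ultimately show ?thesis using detg e True by blast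
    next
      case False
      then obtain x where x: "x \<in> V" "e x \<in> F" by (auto simp: av_def)
      then have "e' x = e x" using eqs by blast
      then have "plug x (e x) e = e" "plug x (e x) e' = e'" by (auto simp: plug_def)
      moreover have p: "(x, e x) \<in> V \<times> F" using x by simp
      have "P (plug (fst (x, e x)) (snd (x, e x)) e) = P (plug (fst (x, e x)) (snd (x, e x)) e')"
        by (rule determined_byD[OF conjunct2[OF bspec[OF R p]] e]) (use eq p in blast)
      ultimately show ?thesis by simp
    qed
  qed
  ultimately show ?case by (intro exI[of _ ?Q]) simp
qed

section \<open>Finitely MA-presented structures\<close>

lemma atomic_relational:
  assumes "relational L" "\<phi> \<in> formulas L {}" "atomic \<phi>"
  obtains (Eq) x y where "\<phi> = Eq (Var x) (Var y)"
  | (Rel) r xs where "\<phi> = Rel r (map Var xs)" "RelSym r (length xs) \<in> L"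
proof -
  have var: "\<exists>x. t = Var x" if "tsymbols t \<subseteq> L" "tparams t \<subseteq> {}" for t :: "'a trm"
    using that assms(1) by (cases t) (auto simp: relational_def)
  show thesis
  proof (cases \<phi>)
    case (Eq s t)
    then show thesis using var[of s] var[of t] assms(2) that(1) by (auto simp: formulas_def)
  next
    case (Rel r ts)
    have "\<exists>x. t = Var x" if "t \<in> set ts" for t
      by (rule var) (use Rel assms(2) that in \<open>auto simp: formulas_def\<close>)
    then obtain h where h: "\<forall>t\<in>set ts. t = Var (h t)" by metis
    have "ts = map Var (map h ts)" using h by (auto intro!: map_idI[symmetric])
    then show thesis using that(2)[of r "map h ts"] Rel assms(2) by (auto simp: formulas_def)
  qed (use assms in auto)
qed

lemma clique_graph_Eq: "clique_graph M (fv (Eq (Var x) (Var y))) (\<lambda>e. sat M e (Eq (Var x) (Var y))) \<subseteq> Id"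
  by (auto simp: clique_graph_def)

lemma clique_graph_Rel:
  "clique_graph M (fv (Rel r (map Var xs))) (\<lambda>e. sat M e (Rel r (map Var xs)))
    \<subseteq> list_graph (rel_of M r (length xs))"
proof
  fix p assume "p \<in> clique_graph M (fv (Rel r (map Var xs))) (\<lambda>e. sat M e (Rel r (map Var xs)))"
  then obtain e x y where *: "p = (e x, e y)" "map e xs \<in> rel_of M r (length xs)"
    "x \<in> set xs" "y \<in> set xs" by (auto simp: clique_graph_def comp_def)
  then show "p \<in> list_graph (rel_of M r (length xs))"
    unfolding list_graph_def by (auto intro!: bexI[of _ "map e xs"])
qed

lemma list_graph_rel_of:
  assumes "is_structure L M" "RelSym r n \<in> L"
  shows "clique_graph M (fv (Rel r (map Var [0..<n]))) (\<lambda>e. sat M e (Rel r (map Var [0..<n])))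
    = list_graph (rel_of M r n)"
proof
  show "list_graph (rel_of M r n) \<subseteq>
    clique_graph M (fv (Rel r (map Var [0..<n]))) (\<lambda>e. sat M e (Rel r (map Var [0..<n])))"
  proof
    fix p assume "p \<in> list_graph (rel_of M r n)"
    then obtain t i j where t: "t \<in> rel_of M r n" "p = (t ! i, t ! j)" "i < length t" "j < length t"
      by (auto simp: list_graph_def in_set_conv_nth)
    then have n: "length t = n" "set t \<subseteq> univ M" using assms by (auto simp: is_structure_def)
    let ?e = "\<lambda>x. if x < n then t ! x else t ! i"
    have "?e \<in> assignments M" using n t by (auto intro!: assignmentsI)
    moreover have "map ?e [0..<n] = t" using n by (auto intro: nth_equalityI)
    then have "sat M ?e (Rel r (map Var [0..<n]))" using t by (simp add: comp_def)
    ultimately show "p \<in> clique_graph M (fv (Rel r (map Var [0..<n])))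
        (\<lambda>e. sat M e (Rel r (map Var [0..<n])))"
      unfolding clique_graph_def using t n
      by (intro CollectI exI[of _ ?e] exI[of _ i] exI[of _ j]) auto
  qed
qed (use clique_graph_Rel[of M r "[0..<n]"] in simp)

lemma mates_eq:
  "mates L M = (\<Union>\<phi>\<in>{\<phi>\<in>formulas L {}. atomic \<phi>}. clique_graph M (fv \<phi>) (\<lambda>e. sat M e \<phi>))"
  unfolding list_graph_defined_rel[symmetric] by (fastforce simp: mates_def list_graph_def)

lemma mates_subset:
  assumes "relational L"
  shows "mates L M \<subseteq> Id \<union> (\<Union>s\<in>L. list_graph (rel_of M (name s) (arity s)))"
  unfolding mates_eq
proof (rule UN_least)
  fix \<phi> :: "'a fm" assume "\<phi> \<in> {\<phi>\<in>formulas L {}. atomic \<phi>}"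
  then have "\<phi> \<in> formulas L {}" "atomic \<phi>" by auto
  with assms show "clique_graph M (fv \<phi>) (\<lambda>e. sat M e \<phi>) \<subseteq>
      Id \<union> (\<Union>s\<in>L. list_graph (rel_of M (name s) (arity s)))"
  proof (cases rule: atomic_relational)
    case (Eq x y)
    then show ?thesis using clique_graph_Eq[of M x y] by auto
  next
    case (Rel r xs)
    then show ?thesis using clique_graph_Rel[of M r xs] by force
  qed
qed

lemma bounded_degree_rel_of:
  assumes "MA_presented L M" "RelSym r n \<in> L"
  shows "bounded_degree (list_graph (rel_of M r n))"
proof -
  have "Rel r (map Var [0..<n]) \<in> formulas L {}" using assms(2) by (auto simp: formulas_def)
  then have "mutually_algebraic_fm M (Rel r (map Var [0..<n]))"
    using assms(1) by (auto simp: MA_presented_def)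
  moreover have "is_structure L M" using assms(1) by (simp add: MA_presented_def)
  ultimately show ?thesis
    unfolding mutually_algebraic_fm_iff by (simp only: list_graph_rel_of[OF _ assms(2)])
qed

text \<open>Equations contribute only loops, and finiteness of the language turns the bounds for the
  single relations into one bound for their union.\<close>

lemma bounded_degree_mates:
  assumes "finitely_MA_presented L M"
  shows "bounded_degree (mates L M)"
proof (rule bounded_degree_subset[OF _ mates_subset])
  have "bounded_degree (list_graph (rel_of M (name s) (arity s)))" if "s \<in> L" for s
    using bounded_degree_rel_of[of L M "name s" "arity s"] that assms
    by (cases s) (auto simp: finitely_MA_presented_def relational_def)
  then show "bounded_degree (Id \<union> (\<Union>s\<in>L. list_graph (rel_of M (name s) (arity s))))"
    using assms
    by (intro bounded_degree_Un bounded_degree_UN bounded_degree_Id)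
       (auto simp: finitely_MA_presented_def)
qed (use assms in \<open>simp add: finitely_MA_presented_def\<close>)

section \<open>Reducts and the construction of an associated structure\<close>

lemma sat_reduct:
  assumes "univ N = univ M"
    "\<forall>r n. RelSym r n \<in> L \<longrightarrow> rel_of N r n = rel_of M r n"
    "\<forall>c. ConstSym c \<in> L \<longrightarrow> const_of N c = const_of M c"
  shows "symbols \<phi> \<subseteq> L \<Longrightarrow> sat N e \<phi> \<longleftrightarrow> sat M e \<phi>"
proof (induction \<phi> arbitrary: e)
  case (Eq s t)
  have "tval N e t = tval M e t" if "tsymbols t \<subseteq> L" for t using assms(3) that by (cases t) auto
  then show ?case using Eq by simp
next
  case (Rel r ts)
  have "tval N e t = tval M e t" if "tsymbols t \<subseteq> L" for t using assms(3) that by (cases t) auto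
  then have "map (tval N e) ts = map (tval M e) ts" using Rel by auto
  then show ?case using Rel assms(2) by (simp del: map_eq_conv)
qed (use assms(1) in auto)

lemma definable_by_sat_iff:
  "definable_by (qf_formulas L A) M (\<lambda>e. sat M e \<phi>) \<longleftrightarrow>
   (\<exists>\<psi>\<in>formulas L A. qfree \<psi> \<and> equivalent M \<phi> \<psi>)"
  by (auto simp: definable_by_def qf_formulas_def equivalent_def)

lemma qf_definable_reduct:
  assumes "qf_definable L M P" "univ N = univ M"
    "\<forall>r n. RelSym r n \<in> L \<longrightarrow> rel_of N r n = rel_of M r n"
    "\<forall>c. ConstSym c \<in> L \<longrightarrow> const_of N c = const_of M c"
  shows "qf_definable L N P"
proof -
  obtain \<phi> where "\<phi> \<in> qf_formulas L (univ M)" "\<forall>e\<in>assignments M. P e \<longleftrightarrow> sat M e \<phi>"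
    using assms(1) by (auto simp: definable_by_def)
  then show ?thesis
    unfolding definable_by_def using sat_reduct[OF assms(2-4), of \<phi>] assms(2)
    by (intro bexI[of _ \<phi>]) (auto simp: assignments_def qf_formulas_def formulas_def)
qed

lemma mutually_algebraic_qf_pieces:
  assumes "finite L" "relational L" "is_structure L M" "mutually_algebraic L M"
  obtains V Q where "finite V" "qf_MA_preds L M V Q"
    "\<forall>r n. RelSym r n \<in> L \<longrightarrow> determined_by M (snd ` Q) (\<lambda>e. sat M e (Rel r (map Var [0..<n])))"
proof -
  have "\<exists>V Q. finite V \<and> qf_MA_preds L M V Q \<and>
      determined_by M (snd ` Q) (\<lambda>e. sat M e (Rel (name s) (map Var [0..<arity s])))"
    if s: "s \<in> L" for s
  proof -
    let ?\<phi> = "Rel (name s) (map Var [0..<arity s]) :: 'a fm"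
    have "s = RelSym (name s) (arity s)" using s assms(2) by (cases s) (auto simp: relational_def)
    then have \<phi>: "?\<phi> \<in> formulas L (univ M)" using s by (auto simp: formulas_def)
    obtain V \<Theta> where V: "finite V" "MA_preds M V \<Theta>" "determined_by M (snd ` \<Theta>) (\<lambda>e. sat M e ?\<phi>)"
      using mutually_algebraic_determined[OF assms(4) \<phi>] .
    \<comment> \<open>\<open>V\<close> only bounds the variables of the pieces; adding those of the
      atom makes the set a support of the predicate to be decomposed.\<close>
    have 1: "finite (V \<union> fv ?\<phi>)" using V by simp
    have 2: "depends_on M (V \<union> fv ?\<phi>) (\<lambda>e. sat M e ?\<phi>)"
      using depends_on_sat[of M ?\<phi>] unfolding depends_on_def by blast
    have 3: "qf_definable L M (\<lambda>e. sat M e ?\<phi>)"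
      by (rule definable_by_sat) (use \<phi> in \<open>simp add: qf_formulas_def\<close>)
    have 4: "MA_preds M (V \<union> fv ?\<phi>) \<Theta>" using V(2) by (auto simp: MA_preds_def)
    have "univ M \<noteq> {}" using assms(3) by (simp add: is_structure_def)
    from qf_MA_decomposition[OF this 1 2 3 4 V(3)] 1 show ?thesis by blast
  qed
  then obtain V Q where VQ: "\<forall>s\<in>L. finite (V s) \<and> qf_MA_preds L M (V s) (Q s) \<and>
      determined_by M (snd ` Q s) (\<lambda>e. sat M e (Rel (name s) (map Var [0..<arity s])))"
    by metis
  show thesis
  proof
    show "finite (\<Union>s\<in>L. V s)" using VQ assms(1) by auto
    show "qf_MA_preds L M (\<Union>s\<in>L. V s) (\<Union>s\<in>L. Q s)"
      by (intro qf_MA_preds_UN assms(1)) (use VQ in \<open>auto intro: qf_MA_preds_mono\<close>)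
    show "\<forall>r n. RelSym r n \<in> L \<longrightarrow>
      determined_by M (snd ` (\<Union>s\<in>L. Q s)) (\<lambda>e. sat M e (Rel r (map Var [0..<n])))"
    proof (intro allI impI)
      fix r n assume r: "RelSym r n \<in> L"
      have "determined_by M (snd ` Q (RelSym r n)) (\<lambda>e. sat M e (Rel r (map Var [0..<n])))"
        using bspec[OF VQ r] by simp
      moreover have "snd ` Q (RelSym r n) \<subseteq> snd ` (\<Union>s\<in>L. Q s)" using r by blast
      ultimately show "determined_by M (snd ` (\<Union>s\<in>L. Q s)) (\<lambda>e. sat M e (Rel r (map Var [0..<n])))"
        unfolding determined_by_def by (meson subsetD)
    qed
  qed
qed

lemma definable_by_atomic:
  "Rel r (map Var xs) \<in> \<Phi> \<Longrightarrow> definable_by \<Phi> M (\<lambda>e. map e xs \<in> rel_of M r (length xs))"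
  using definable_by_sat[of "Rel r (map Var xs)" \<Phi> M] by (simp add: comp_def)

text \<open>Permuted or repeated arguments arise from the atom with distinct variables by renaming x
  to \<open>xs ! x\<close>.\<close>

lemma definable_by_qf_Rel:
  assumes "qf_definable L M (\<lambda>e. sat M e (Rel r (map Var [0..<length xs])))"
  shows "qf_definable L M (\<lambda>e. sat M e (Rel r (map Var xs)))"
proof -
  have "map (\<lambda>x. e (xs ! x)) [0..<length xs] = map e xs" for e :: "nat \<Rightarrow> 'a"
    by (auto intro: nth_equalityI)
  then have "sat M (\<lambda>x. e (xs ! x)) (Rel r (map Var [0..<length xs])) \<longleftrightarrow> sat M e (Rel r (map Var xs))" for e
    by (simp add: comp_def)
  then show ?thesis using qf_definable_rename[OF assms, of "\<lambda>x. xs ! x"] by simp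
qed

text \<open>Each quantifier-free piece becomes a new relation symbol. A single record
  \<open>N\<close> interprets both languages: it is the common expansion and, read in
  \<open>L'\<close>, also the MA-presented structure.\<close>

theorem ex_associated_finitely_MA_presented:
  fixes M :: "'a struct"
  assumes L: "finite L" "relational L" "is_structure L M" "mutually_algebraic L M"
  obtains L' and M' :: "'a struct" where "finitely_MA_presented L' M'" "associated L M L' M'"
proof -
  obtain V Q where V: "finite V" and Q: "qf_MA_preds L M V Q"
    and det: "\<forall>r n. RelSym r n \<in> L \<longrightarrow>
      determined_by M (snd ` Q) (\<lambda>e. sat M e (Rel r (map Var [0..<n])))"
    using mutually_algebraic_qf_pieces[OF L] .
  have finQ: "finite Q" using Q by (simp add: qf_MA_preds_def MA_preds_def)
  have Qd: "finite (fst q)" "depends_on M (fst q) (snd q)"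
    "bounded_degree (clique_graph M (fst q) (snd q))" "qf_definable L M (snd q)" if "q \<in> Q" for q
    using Q V that finite_subset[of "fst q" V] by (auto simp: qf_MA_preds_def MA_preds_def)
  obtain B where B: "\<forall>r\<in>name ` L. r < B"
    using finite_nat_set_iff_bounded[of "name ` L"] L(1) by auto
  obtain h :: "_ \<Rightarrow> nat" where h: "inj_on h Q"
    using finite_imp_inj_to_nat_seg[OF finQ] by blast
  \<comment> \<open>The shift by \<open>B\<close> keeps the new names apart from all names used in
    \<open>L\<close>.\<close>
  define f where "f q = B + h q" for q
  have f: "f q = f q' \<longleftrightarrow> q = q'" if "q \<in> Q" "q' \<in> Q" for q q'
    using h that by (auto simp: f_def inj_on_def)
  have fresh: "RelSym (f q) n \<notin> L" for q n
    using B by (metis f_def imageI not_add_less1 symbol.sel(1))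
  define L' where "L' = (\<lambda>q. RelSym (f q) (card (fst q))) ` Q"
  define tup where "tup q e = map e (sorted_list_of_set (fst q))" for q :: "nat set \<times> ((nat \<Rightarrow> 'a) \<Rightarrow> bool)" and e :: "nat \<Rightarrow> 'a"
  define R where "R r n = {tup q e | e q. q \<in> Q \<and> f q = r \<and> n = card (fst q) \<and> e \<in> assignments M \<and> snd q e}" for r n
  define N where "N = M\<lparr>rel_of := (\<lambda>r n. if RelSym r n \<in> L then rel_of M r n else R r n)\<rparr>"
  have N: "univ N = univ M" "assignments N = assignments M"
    "\<forall>r n. RelSym r n \<in> L \<longrightarrow> rel_of N r n = rel_of M r n"
    "\<forall>c. ConstSym c \<in> L \<longrightarrow> const_of N c = const_of M c"
    by (auto simp: N_def assignments_def)
  have relN: "rel_of N (f q) (card (fst q)) = {tup q e | e. e \<in> assignments M \<and> snd q e}"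
    if "q \<in> Q" for q
  proof -
    have "rel_of N (f q) (card (fst q)) = R (f q) (card (fst q))"
      using fresh by (simp add: N_def)
    also have "\<dots> = {tup q e | e. e \<in> assignments M \<and> snd q e}"
      unfolding R_def using f that by blast
    finally show ?thesis .
  qed
  have rel: "relational L'" "finite L'" "relational (L \<union> L')"
    using finQ L(2) by (auto simp: L'_def relational_def)
  have str: "is_structure (L \<union> L') N" "is_structure L' N"
  proof -
    have "rel_of N r n \<subseteq> {xs. length xs = n \<and> set xs \<subseteq> univ N}" if "RelSym r n \<in> L'" for r n
    proof -
      obtain q where q: "q \<in> Q" "r = f q" "n = card (fst q)" using \<open>RelSym r n \<in> L'\<close> by (auto simp: L'_def)
      then show ?thesis using relN[OF q(1)] Qd(1)[OF q(1)] N(1) by (auto simp: tup_def)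
    qed
    then show "is_structure L' N" "is_structure (L \<union> L') N"
      using L(3) rel(1) N unfolding is_structure_def relational_def by auto
  qed
  \<comment> \<open>The relation named by q lists the values of its variables in increasing order.
    The inverse of this listing tells which argument feeds which variable, so an atom with arbitrary
    arguments is a renaming of the predicate.\<close>
  have tup: "map e xs \<in> rel_of N (f q) (length xs) \<longleftrightarrow>
      snd q (\<lambda>v. if v \<in> fst q then e (xs ! (the_inv_into {..<length xs} ((!) (sorted_list_of_set (fst q))) v)) else e v)"
    if q: "q \<in> Q" "length xs = card (fst q)" and e: "e \<in> assignments M" for e xs q
  proof -
    let ?s = "sorted_list_of_set (fst q)"
    let ?i = "the_inv_into {..<length xs} ((!) ?s)"
    let ?e = "\<lambda>v. if v \<in> fst q then e (xs ! ?i v) else e v"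
    have s: "length ?s = length xs" "set ?s = fst q" "distinct ?s" using Qd(1)[OF q(1)] q(2) by auto
    have i: "?i (?s ! j) = j" if "j < length xs" for j
      using s that by (intro the_inv_into_f_f) (auto simp: inj_on_nth)
    have e': "?e \<in> assignments M" using e by (auto intro!: assignmentsI)
    have "tup q ?e = map e xs"
      unfolding tup_def using s i by (intro nth_equalityI) (auto simp: nth_mem[of _ ?s])
    then have *: "map e xs \<in> rel_of N (f q) (length xs) \<longleftrightarrow>
        (\<exists>e'. tup q ?e = tup q e' \<and> e' \<in> assignments M \<and> snd q e')"
      unfolding q(2) relN[OF q(1)] by auto
    have "snd q e' \<longleftrightarrow> snd q ?e" if "tup q ?e = tup q e'" "e' \<in> assignments M" for e'
    proof (rule depends_onD[OF Qd(2)[OF q(1)] that(2) e'])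
      fix x assume "x \<in> fst q"
      then show "e' x = ?e x" using that(1) s(2) unfolding tup_def map_eq_conv by metis
    qed
    then show ?thesis unfolding * using e' by blast
  qed
  have symL: "RelSym r n \<in> L' \<longleftrightarrow> (\<exists>q\<in>Q. r = f q \<and> n = card (fst q))" for r n
    by (auto simp: L'_def)
  have "\<exists>\<psi>\<in>formulas L (univ M). qfree \<psi> \<and> equivalent N \<phi> \<psi>"
    if \<phi>: "\<phi> \<in> formulas (L \<union> L') {}" "atomic \<phi>" for \<phi>
    using rel(3) \<phi>
  proof (cases rule: atomic_relational)
    case (Eq x y)
    then show ?thesis by (intro bexI[of _ \<phi>]) (auto simp: equivalent_def)
  next
    case (Rel r xs)
    show ?thesis
    proof (cases "RelSym r (length xs) \<in> L")
      case True
      then show ?thesis using Rel by (intro bexI[of _ \<phi>]) (auto simp: equivalent_def formulas_def)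
    next
      case False
      then obtain q where q: "q \<in> Q" "r = f q" "length xs = card (fst q)"
        using Rel symL by auto
      let ?\<rho> = "\<lambda>v. if v \<in> fst q then xs ! (the_inv_into {..<length xs} ((!) (sorted_list_of_set (fst q))) v) else v"
      have "qf_definable L N (\<lambda>e. snd q (\<lambda>v. e (?\<rho> v)))"
        by (rule qf_definable_rename[OF qf_definable_reduct[OF Qd(4)[OF q(1)] N(1,3,4)]])
      moreover have "sat N e \<phi> \<longleftrightarrow> snd q (\<lambda>v. e (?\<rho> v))" if "e \<in> assignments N" for e
        using tup[OF q(1,3), of e] that N(2) q(2) Rel(1) by (simp add: comp_def if_distrib cong: if_cong)
      ultimately have "qf_definable L N (\<lambda>e. sat N e \<phi>)" by (simp cong: definable_by_cong)
      then show ?thesis unfolding definable_by_sat_iff N(1) .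
    qed
  qed
  then have ex1: "qf_expansion L M (L \<union> L') N"
    using L(3) str(1) N by (simp add: qf_expansion_def)
  have "\<exists>\<psi>\<in>formulas L' (univ N). qfree \<psi> \<and> equivalent N \<phi> \<psi>"
    if \<phi>: "\<phi> \<in> formulas (L \<union> L') {}" "atomic \<phi>" for \<phi>
    using rel(3) \<phi>
  proof (cases rule: atomic_relational)
    case (Eq x y)
    then show ?thesis by (intro bexI[of _ \<phi>]) (auto simp: equivalent_def)
  next
    case (Rel r xs)
    show ?thesis
    proof (cases "RelSym r (length xs) \<in> L'")
      case True
      then show ?thesis using Rel by (intro bexI[of _ \<phi>]) (auto simp: equivalent_def formulas_def)
    next
      case False
      then have r: "RelSym r (length xs) \<in> L" using Rel by auto
      have "qf_definable L' N (\<lambda>e. sat N e (Rel r (map Var [0..<length xs])))"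
      proof (rule definable_by_determined[of _ "snd ` Q"])
        fix p assume "p \<in> snd ` Q"
        then obtain q where q: "q \<in> Q" "p = snd q" by blast
        let ?ys = "sorted_list_of_set (fst q)"
        have len: "length ?ys = card (fst q)" using Qd(1)[OF q(1)] by simp
        have "qf_definable L' N (\<lambda>e. map e ?ys \<in> rel_of N (f q) (length ?ys))"
          by (rule definable_by_atomic)
             (use q(1) len symL in \<open>auto simp: qf_formulas_def formulas_def\<close>)
        moreover have "map e ?ys \<in> rel_of N (f q) (length ?ys) \<longleftrightarrow> p e" if e: "e \<in> assignments N" for e
        proof -
          have "map e ?ys \<in> rel_of N (f q) (length ?ys) \<longleftrightarrow>
              (\<exists>e'. tup q e = tup q e' \<and> e' \<in> assignments M \<and> snd q e')"
            unfolding len relN[OF q(1)] by (auto simp: tup_def)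
          moreover have "snd q e' \<longleftrightarrow> snd q e" if "tup q e = tup q e'" "e' \<in> assignments M" for e'
          proof (rule depends_onD[OF Qd(2)[OF q(1)] that(2)])
            fix x assume "x \<in> fst q"
            then show "e' x = e x" using that(1) Qd(1)[OF q(1)] unfolding tup_def map_eq_conv by auto
          qed (use e N(2) in simp)
          ultimately show ?thesis using e q(2) N(2) by blast
        qed
        ultimately show "qf_definable L' N p" by (simp cong: definable_by_cong)
      next
        have "determined_by M (snd ` Q) (\<lambda>e. sat M e (Rel r (map Var [0..<length xs])))"
          using det r by blast
        moreover have "sat N e (Rel r (map Var [0..<length xs])) \<longleftrightarrow> sat M e (Rel r (map Var [0..<length xs]))" for e
          by (rule sat_reduct[OF N(1,3,4)]) (use r in auto)
        ultimately show "determined_by N (snd ` Q) (\<lambda>e. sat N e (Rel r (map Var [0..<length xs])))"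
          by (simp only: determined_by_def N(2))
      qed (use finQ in simp_all)
      then show ?thesis
        unfolding Rel(1) definable_by_sat_iff[symmetric] by (rule definable_by_qf_Rel)
    qed
  qed
  then have ex2: "qf_expansion L' N (L \<union> L') N"
    using str by (simp add: qf_expansion_def)
  have "mutually_algebraic_fm N \<phi>" if \<phi>: "\<phi> \<in> formulas L' {}" "atomic \<phi>" for \<phi>
    using rel(1) \<phi>
  proof (cases rule: atomic_relational)
    case (Eq x y)
    then show ?thesis unfolding mutually_algebraic_fm_iff
      using bounded_degree_subset[OF bounded_degree_Id clique_graph_Eq] by simp
  next
    case (Rel r xs)
    then obtain q where q: "q \<in> Q" "r = f q" "length xs = card (fst q)" using symL by auto
    have "list_graph (rel_of N r (length xs)) \<subseteq> clique_graph M (fst q) (snd q)"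
      unfolding q(2,3) relN[OF q(1)] using Qd(1)[OF q(1)]
      by (fastforce simp: list_graph_def clique_graph_def tup_def)
    then have "bounded_degree (list_graph (rel_of N r (length xs)))"
      using Qd(3)[OF q(1)] bounded_degree_subset by blast
    then show ?thesis unfolding mutually_algebraic_fm_iff Rel(1)
      using bounded_degree_subset[OF _ clique_graph_Rel] by blast
  qed
  then have "finitely_MA_presented L' N"
    using str(2) rel by (simp add: finitely_MA_presented_def MA_presented_def)
  moreover have "associated L M L' N" unfolding associated_def using ex1 ex2 by blast
  ultimately show thesis by (rule that)
qed

section \<open>Bounded classes give a cellular structure\<close>

lemma finite_tparams [simp]: "finite (tparams t)"
  by (cases t) auto

lemma finite_params [simp]: "finite (params \<phi>)"
  by (induction \<phi>) auto

section \<open>Classes of the mate relation and transfer of automorphisms\<close>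

lemma mates_univ: "mates L M \<subseteq> univ M \<times> univ M"
  by (auto simp: mates_eq clique_graph_def)

lemma mates_refl: "a \<in> univ M \<Longrightarrow> (a, a) \<in> mates L M"
  unfolding mates_eq clique_graph_def
  by (intro UN_I[of "Eq (Var 0) (Var 0)"]) (auto intro!: exI[of _ "\<lambda>_. a"])

lemma mates_sym: "sym (mates L M)"
  by (auto simp: mates_eq clique_graph_def sym_def)

lemma rel_of_mates:
  assumes "is_structure L M" "RelSym r n \<in> L" "t \<in> rel_of M r n" "a \<in> set t" "b \<in> set t"
  shows "(a, b) \<in> mates L M"
proof -
  let ?\<phi> = "Rel r (map Var [0..<n]) :: 'a fm"
  have "(a, b) \<in> list_graph (rel_of M r n)" using assms by (auto simp: list_graph_def)
  then have *: "(a, b) \<in> clique_graph M (fv ?\<phi>) (\<lambda>e. sat M e ?\<phi>)"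
    by (simp only: list_graph_rel_of[OF assms(1,2)])
  have "?\<phi> \<in> {\<phi>\<in>formulas L {}. atomic \<phi>}" using assms(2) by (auto simp: formulas_def)
  then show ?thesis unfolding mates_eq by (rule UN_I) (rule *)
qed

lemma ma_class_self: "a \<in> univ M \<Longrightarrow> a \<in> ma_class L M a"
  by (auto simp: ma_class_def intro!: r_into_trancl mates_refl)

lemma ma_class_univ: "ma_class L M a \<subseteq> univ M"
  using trancl_subset_Sigma[OF mates_univ] by (auto simp: ma_class_def)

lemma ma_class_eq:
  assumes "b \<in> ma_class L M a"
  shows "ma_class L M b = ma_class L M a"
proof -
  have ab: "(a, b) \<in> (mates L M)\<^sup>+" using assms by (simp add: ma_class_def)
  have ba: "(b, a) \<in> (mates L M)\<^sup>+" by (rule symD[OF sym_trancl[OF mates_sym] ab])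
  show ?thesis using ab ba by (auto simp: ma_class_def)
qed

text \<open>Over \<open>N\<close> the relation s of \<open>M\<close> is defined by the
  \<open>L'\<close>-formula \<open>\<Psi> s\<close>, and an automorphism of \<open>M'\<close> that
  fixes the parameters of this formula preserves its truth.\<close>

lemma is_iso_transfer:
  assumes M: "relational L" "is_structure L M"
    and ex: "qf_expansion L M LN N" "qf_expansion L' M' LN N"
    and \<Psi>: "\<forall>s\<in>L. \<Psi> s \<in> formulas L' (univ M') \<and>
      equivalent N (Rel (name s) (map Var [0..<arity s])) (\<Psi> s)"
    and f: "is_iso L' f M' M'" "\<forall>s\<in>L. \<forall>a\<in>params (\<Psi> s). f a = a"
  shows "is_iso L f M M"
  unfolding is_iso_def
proof (intro conjI allI impI)
  have U: "univ N = univ M" "univ N = univ M'" using ex by (auto simp: qf_expansion_def)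
  then show bij: "bij_betw f (univ M) (univ M)" using f by (simp add: is_iso_def)
  have M': "is_structure L' M'" using ex by (simp add: qf_expansion_def)
  fix r n xs assume xs: "RelSym r n \<in> L \<and> length xs = n \<and> set xs \<subseteq> univ M"
  let ?\<psi> = "\<Psi> (RelSym r n)"
  have \<psi>: "?\<psi> \<in> formulas L' (univ M')" "equivalent N (Rel r (map Var [0..<n])) ?\<psi>"
    using bspec[OF \<Psi>, of "RelSym r n"] xs by auto
  obtain a where a: "a \<in> univ M" using M(2) by (auto simp: is_structure_def)
  define e where "e x = (if x < n then xs ! x else a)" for x
  have e: "e \<in> assignments M'" using xs a U nth_mem by (intro assignmentsI) (fastforce simp: e_def)
  have fe: "(\<lambda>x. f (e x)) \<in> assignments M'"
    using e f(1) by (auto simp: assignments_def is_iso_def bij_betw_def)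
  have *: "map e' [0..<n] \<in> rel_of M r n \<longleftrightarrow> sat M' e' ?\<psi>" if "e' \<in> assignments M'" for e'
  proof -
    have "map e' [0..<n] \<in> rel_of M r n \<longleftrightarrow> sat N e' (Rel r (map Var [0..<n]))"
      using ex(1) xs by (simp add: qf_expansion_def comp_def)
    also have "\<dots> \<longleftrightarrow> sat N e' ?\<psi>"
      using \<psi>(2) that U by (simp add: equivalent_def assignments_def)
    also have "\<dots> \<longleftrightarrow> sat M' e' ?\<psi>"
      by (rule sat_reduct[where L = L']) (use ex(2) \<psi>(1) in \<open>auto simp: qf_expansion_def formulas_def\<close>)
    finally show ?thesis .
  qed
  have "map e [0..<n] = xs" "map (\<lambda>x. f (e x)) [0..<n] = map f xs"
    using xs by (auto simp: e_def intro: nth_equalityI)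
  moreover have "sat M' (\<lambda>x. f (e x)) ?\<psi> \<longleftrightarrow> sat M' e ?\<psi>"
    by (rule sat_iso_fixed[OF f(1) M' e, of _ "params ?\<psi>"])
       (use \<psi> f(2) xs in \<open>auto simp: formulas_def\<close>)
  ultimately show "xs \<in> rel_of M r n \<longleftrightarrow> map f xs \<in> rel_of M r n"
    using *[OF e] *[OF fe] by simp
qed (use M in \<open>auto simp: relational_def\<close>)

lemma isomorphic_over_automorphism:
  assumes f: "is_iso L f M M" "relational L" "\<forall>a\<in>K. f a = a" "map f xs = ys"
    and sub: "K \<union> set xs \<subseteq> univ M"
  shows "isomorphic_over L M K xs ys"
  unfolding isomorphic_over_def
proof (intro exI[of _ f] conjI)
  have bij: "bij_betw f (univ M) (univ M)" using f by (simp add: is_iso_def)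
  have "f ` (K \<union> set xs) = K \<union> set ys" using f(3,4) by force
  then have im: "bij_betw f (K \<union> set xs) (K \<union> set ys)"
    using bij_betw_subset[OF bij sub] by blast
  show "is_iso L f (induced M (K \<union> set xs)) (induced M (K \<union> set ys))"
    unfolding is_iso_def
  proof (intro conjI allI impI)
    show "bij_betw f (univ (induced M (K \<union> set xs))) (univ (induced M (K \<union> set ys)))"
      using im by (simp add: induced_def)
    fix r n zs assume zs: "RelSym r n \<in> L \<and> length zs = n \<and> set zs \<subseteq> univ (induced M (K \<union> set xs))"
    then have "set zs \<subseteq> K \<union> set xs" by (simp add: induced_def)
    moreover from this have "set (map f zs) \<subseteq> K \<union> set ys" using im by (auto simp: bij_betw_def)
    moreover have "zs \<in> rel_of M r n \<longleftrightarrow> map f zs \<in> rel_of M r n"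
      using f(1) zs sub \<open>set zs \<subseteq> K \<union> set xs\<close> unfolding is_iso_def by blast
    ultimately show "zs \<in> rel_of (induced M (K \<union> set xs)) r n \<longleftrightarrow>
        map f zs \<in> rel_of (induced M (K \<union> set ys)) r n"
      by (simp add: induced_def)
  qed (use f(2) in \<open>simp add: relational_def\<close>)
qed (use f in auto)

text \<open>No tuple of a relation of \<open>M'\<close> meets two classes, so permuting classes with
  equal labelled diagrams, entry by entry, is an automorphism of \<open>M'\<close>. Countability
  allows the classes of one diagram to be indexed by the natural numbers.\<close>

theorem cellular_of_bounded_classes:
  fixes M M' :: "'a struct"
  assumes L: "finite L" "relational L" and M: "is_structure L M" "countable (univ M)"
    and M': "finitely_MA_presented L' M'" "associated L M L' M'"
    and bd: "uniformly_finite (univ M') (ma_class L' M')"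
  shows "cellular L M"
proof -
  obtain N where ex: "qf_expansion L M (L \<union> L') N" "qf_expansion L' M' (L \<union> L') N"
    using M'(2) by (auto simp: associated_def)
  have U: "univ M' = univ M" using ex by (auto simp: qf_expansion_def)
  have L': "finite L'" "relational L'" "is_structure L' M'"
    using M'(1) by (auto simp: finitely_MA_presented_def MA_presented_def)
  obtain k0 where k0: "\<forall>a\<in>univ M. finite (ma_class L' M' a) \<and> card (ma_class L' M' a) \<le> k0"
    using bd U by (auto simp: uniformly_finite_def)
  have "\<exists>\<psi>. \<psi> \<in> formulas L' (univ M') \<and> equivalent N (Rel (name s) (map Var [0..<arity s])) \<psi>"
    if "s \<in> L" for s
  proof -
    have "s = RelSym (name s) (arity s)" using that L(2) by (cases s) (auto simp: relational_def)
    then have "Rel (name s) (map Var [0..<arity s]) \<in> formulas (L \<union> L') ({}::'a set)"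
      using that by (auto simp: formulas_def)
    then show ?thesis using ex(2) unfolding qf_expansion_def by (metis atomic.simps(2))
  qed
  then obtain \<Psi> where \<Psi>: "\<forall>s\<in>L. \<Psi> s \<in> formulas L' (univ M') \<and>
      equivalent N (Rel (name s) (map Var [0..<arity s])) (\<Psi> s)" by metis
  define P where "P = (\<Union>s\<in>L. params (\<Psi> s))"
  have P: "finite P" "P \<subseteq> univ M"
    using L(1) \<Psi> U by (auto simp: P_def formulas_def)
  define cl where "cl = ma_class L' M'"
  define Cs where "Cs = cl ` univ M"
  have self: "a \<in> cl a" if "a \<in> univ M" for a using that U by (simp add: cl_def ma_class_self)
  have cleq: "cl b = cl a" if "b \<in> cl a" for a b using ma_class_eq that unfolding cl_def by metis
  have Cs: "finite C" "card C \<le> k0" "C \<noteq> {}" "C \<subseteq> univ M" "\<And>a. a \<in> C \<Longrightarrow> cl a = C" if "C \<in> Cs" for C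
    using that k0 self cleq ma_class_univ[of L' M'] U unfolding Cs_def cl_def by blast+
  have disj: "C = D" if "C \<in> Cs" "D \<in> Cs" "C \<inter> D \<noteq> {}" for C D
    using Cs(5)[OF that(1)] Cs(5)[OF that(2)] that(3) by blast
  have relcl: "set t \<subseteq> cl a" if "RelSym r m \<in> L'" "t \<in> rel_of M' r m" "a \<in> set t" for r m t a
    using rel_of_mates[OF L'(3) that] by (auto simp: cl_def ma_class_def)
  define enum where "enum C = (SOME l. set l = C \<and> distinct l)" for C :: "'a set"
  have enum: "set (enum C) = C" "distinct (enum C)" if "C \<in> Cs" for C
    using someI_ex[OF finite_distinct_list[OF Cs(1)[OF that]]] unfolding enum_def by auto
  \<comment> \<open>The diagram of an enumerated class: its length and, for every symbol, the index
    words at which the relation holds. Class sizes and arities are bounded, so only finitely many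
    diagrams occur.\<close>
  define tp where "tp l = (length l, {(s, is). s \<in> L' \<and> set is \<subseteq> {..<length l} \<and>
      length is = arity s \<and> map ((!) l) is \<in> rel_of M' (name s) (arity s)})" for l
  have fintp: "finite ((tp \<circ> enum) ` Cs)"
  proof -
    obtain m where m: "\<forall>s\<in>L'. arity s \<le> m"
      using finite_nat_set_iff_bounded_le[of "arity ` L'"] L'(1) by auto
    let ?X = "{is. set is \<subseteq> {..<k0} \<and> length is \<le> m}"
    have "(tp \<circ> enum) ` Cs \<subseteq> {..k0} \<times> Pow (L' \<times> ?X)"
    proof
      fix p assume "p \<in> (tp \<circ> enum) ` Cs"
      then obtain C where C: "C \<in> Cs" "p = tp (enum C)" by auto
      have "length (enum C) \<le> k0" using enum[OF C(1)] Cs(2)[OF C(1)] distinct_card by metis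
      then show "p \<in> {..k0} \<times> Pow (L' \<times> ?X)" using m unfolding C(2) tp_def by fastforce
    qed
    moreover have "finite ({..k0} \<times> Pow (L' \<times> ?X))"
      using L'(1) finite_lists_length_le[of "{..<k0}" m] by simp
    ultimately show ?thesis by (rule finite_subset)
  qed
  define I where "I = {\<tau>\<in>(tp \<circ> enum) ` Cs. infinite {C\<in>Cs. tp (enum C) = \<tau>}}"
  obtain ts where ts: "set ts = I" "distinct ts"
    using finite_distinct_list[of I] fintp unfolding I_def by auto
  define n where "n = length ts"
  \<comment> \<open>Classes that meet \<open>P\<close> are kept out of the cells, so that the
    parameters of the definitions \<open>\<Psi>\<close> never move. Only finitely many classes are
    lost, so each \<open>D i\<close> is still infinite.\<close>
  define D where "D i = {C\<in>Cs. tp (enum C) = ts ! i \<and> C \<inter> P = {}}" for i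
  have meetP: "finite {C\<in>Cs. C \<inter> P \<noteq> {}}"
    by (rule finite_subset[of _ "cl ` P"]) (use Cs(5) P(1) in blast)+
  have infD: "infinite (D i)" if "i < n" for i
  proof -
    have "ts ! i \<in> I" using that ts by (auto simp: n_def)
    then have "infinite {C\<in>Cs. tp (enum C) = ts ! i}" by (simp add: I_def)
    moreover have "{C\<in>Cs. tp (enum C) = ts ! i} \<subseteq> D i \<union> {C\<in>Cs. C \<inter> P \<noteq> {}}" by (auto simp: D_def)
    ultimately show ?thesis using meetP by (auto dest: finite_subset)
  qed
  have "countable (D i)" for i
    by (rule countable_subset[of _ Cs]) (use M(2) in \<open>auto simp: D_def Cs_def\<close>)
  then have bijD: "bij_betw (from_nat_into (D i)) UNIV (D i)" if "i < n" for i
    using infD[OF that] bij_betw_from_nat_into by blast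
  define c where "c i j = enum (from_nat_into (D i) j)" for i j
  define k where "k i = fst (ts ! i)" for i
  have DC: "from_nat_into (D i) j \<in> D i" if "i < n" for i j
    using bijD[OF that] by (auto simp: bij_betw_def)
  then have g: "from_nat_into (D i) j \<in> Cs" "tp (c i j) = ts ! i" "set (c i j) \<inter> P = {}"
      "set (c i j) = from_nat_into (D i) j" "distinct (c i j)" if "i < n" for i j
    using that enum unfolding D_def c_def by auto
  have len: "length (c i j) = k i" if "i < n" for i j
    unfolding k_def g(2)[OF that, of j, symmetric] by (simp add: tp_def)
  have cdisj: "set (c i j) \<inter> set (c i' j') = {}" if "i < n" "i' < n" "(i, j) \<noteq> (i', j')" for i j i' j'
  proof (rule ccontr)
    assume ne: "\<not> ?thesis"
    have eq: "from_nat_into (D i) j = from_nat_into (D i') j'"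
      using disj[OF g(1)[OF that(1)] g(1)[OF that(2)]] ne g(4)[OF that(1)] g(4)[OF that(2)] by metis
    then have "ts ! i = ts ! i'" using g(2)[OF that(1), of j] g(2)[OF that(2), of j'] by (simp add: c_def)
    then have "i = i'" using ts(2) that by (simp add: n_def nth_eq_iff_index_eq)
    moreover from this have "j = j'" using eq bijD[OF that(1)] by (auto simp: bij_betw_def inj_def)
    ultimately show False using that(3) by simp
  qed
  \<comment> \<open>The remainder consists of classes whose diagram occurs only finitely often and
    of classes that meet \<open>P\<close>; both kinds are finite in number and in size.\<close>
  define K where "K = univ M - (\<Union>i<n. \<Union>j. set (c i j))"
  have csub: "set (c i j) \<subseteq> univ M" if "i < n" for i j using Cs(4)[OF g(1)[OF that]] g(4)[OF that] by simp
  have finK: "finite K"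
  proof (rule finite_subset)
    let ?X = "{C\<in>Cs. tp (enum C) \<notin> I} \<union> {C\<in>Cs. C \<inter> P \<noteq> {}}"
    have "{C\<in>Cs. tp (enum C) \<notin> I} = (\<Union>\<tau>\<in>(tp \<circ> enum) ` Cs - I. {C\<in>Cs. tp (enum C) = \<tau>})" by auto
    moreover have "finite (\<Union>\<tau>\<in>(tp \<circ> enum) ` Cs - I. {C\<in>Cs. tp (enum C) = \<tau>})"
      by (intro finite_UN_I) (use fintp in \<open>auto simp: I_def\<close>)
    ultimately have "finite ?X" using meetP by simp
    then show "finite (\<Union>?X)" using Cs(1) by auto
    show "K \<subseteq> \<Union>?X"
    proof
      fix a assume a: "a \<in> K"
      then have aU: "a \<in> univ M" by (simp add: K_def)
      have C: "cl a \<in> Cs" using aU by (simp add: Cs_def)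
      show "a \<in> \<Union>?X"
      proof (rule ccontr)
        assume "\<not> ?thesis"
        then have "tp (enum (cl a)) \<in> I" "cl a \<inter> P = {}" using self[OF aU] C by auto
        then obtain i where i: "i < n" "tp (enum (cl a)) = ts ! i"
          using ts by (auto simp: n_def in_set_conv_nth)
        then have "cl a \<in> D i" using C \<open>cl a \<inter> P = {}\<close> by (simp add: D_def)
        then obtain j where "cl a = from_nat_into (D i) j" using bijD[OF i(1)] unfolding bij_betw_def by blast
        then have "a \<in> set (c i j)" using g(4)[OF i(1)] self[OF aU] by simp
        then show False using a i(1) by (auto simp: K_def)
      qed
    qed
  qed
  have kpos: "0 < k i" if "i < n" for i
    using len[OF that, of 0] g(4)[OF that, of 0] Cs(3)[OF g(1)[OF that, of 0]] by auto
  have part: "cellular_partition M K n k c"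
    unfolding cellular_partition_def
  proof (intro conjI)
    have "(\<Union>i<n. \<Union>j. set (c i j)) \<subseteq> univ M" using csub by blast
    then show "K \<union> (\<Union>i<n. \<Union>j. set (c i j)) = univ M" unfolding K_def by blast
    show "\<forall>i<n. \<forall>j. K \<inter> set (c i j) = {}" unfolding K_def by blast
    show "\<forall>i<n. \<forall>i'<n. \<forall>j j'. (i, j) \<noteq> (i', j') \<longrightarrow> set (c i j) \<inter> set (c i' j') = {}"
      using cdisj by blast
  qed (use finK kpos len g(5) in simp_all)
  have PK: "P \<subseteq> K" using P(2) g(3) by (auto simp: K_def)

  have aut: "\<exists>f. is_iso L f M M \<and> (\<forall>j. map f (c i j) = c i (\<sigma> j)) \<and>
      (\<forall>a\<in>univ M - (\<Union>j. set (c i j)). f a = a)"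
    if i: "i < n" and \<sigma>: "bij \<sigma>" for i and \<sigma> :: "nat \<Rightarrow> nat"
  proof -
    \<comment> \<open>\<open>p\<close> recovers the coordinates of an element of the i-th family:
      the number of its cell and its position there.\<close>
    have "\<exists>p. fst p \<in> (UNIV :: nat set) \<and> snd p < k i \<and> c i (fst p) ! snd p = a" if "a \<in> (\<Union>j. set (c i j))" for a
      using that len[OF i] by (fastforce simp: in_set_conv_nth)
    then obtain p where p: "\<And>a. a \<in> (\<Union>j. set (c i j)) \<Longrightarrow> snd (p a) < k i \<and> c i (fst (p a)) ! snd (p a) = a"
      by metis
    define f where "f \<tau> a = (if a \<in> (\<Union>j. set (c i j)) then c i (\<tau> (fst (p a))) ! snd (p a) else a)"
      for \<tau> :: "nat \<Rightarrow> nat" and a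
    have pc: "p (c i j ! l) = (j, l)" if "l < k i" for j l
    proof -
      have m: "c i j ! l \<in> set (c i j)" using that len[OF i] by simp
      then have *: "snd (p (c i j ! l)) < k i"
        "c i (fst (p (c i j ! l))) ! snd (p (c i j ! l)) = c i j ! l" using p by blast+
      then have "c i j ! l \<in> set (c i (fst (p (c i j ! l))))" using len[OF i] by (metis nth_mem)
      then have 1: "fst (p (c i j ! l)) = j" using cdisj[OF i i] m by blast
      then have "snd (p (c i j ! l)) = l"
        using * that g(5)[OF i] len[OF i] nth_eq_iff_index_eq by metis
      then show ?thesis using 1 by (metis prod.collapse)
    qed
    have fc: "f \<tau> (c i j ! l) = c i (\<tau> j) ! l" if "l < k i" for \<tau> j l
    proof -
      have "c i j ! l \<in> set (c i j)" using that len[OF i] by simp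
      then show ?thesis using pc[OF that] unfolding f_def by auto
    qed
    have fm: "map (f \<tau>) (c i j) = c i (\<tau> j)" for \<tau> j
      by (rule nth_equalityI) (use len[OF i] fc in auto)
    have fo: "f \<tau> a = a" if "a \<notin> (\<Union>j. set (c i j))" for \<tau> a using that unfolding f_def by simp
    have inv: "f \<tau> (f \<tau>' a) = a" if "\<And>j. \<tau> (\<tau>' j) = j" for \<tau> \<tau>' a
    proof (cases "a \<in> (\<Union>j. set (c i j))")
      case True
      then obtain j l where "l < k i" "a = c i j ! l" using len[OF i] by (auto simp: in_set_conv_nth)
      then show ?thesis using fc that by simp
    qed (use fo in simp)
    have fU: "f \<tau> a \<in> univ M" if "a \<in> univ M" for \<tau> a
    proof (cases "a \<in> (\<Union>j. set (c i j))")
      case True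
      then obtain j l where "l < k i" "a = c i j ! l" using len[OF i] by (auto simp: in_set_conv_nth)
      then show ?thesis using fc csub[OF i] len[OF i] by (metis nth_mem subsetD)
    qed (use fo that in simp)
    \<comment> \<open>A tuple that meets a cell lies inside it, and equality of diagrams carries its
      index word to the target cell. The claim is made for arbitrary \<open>\<tau>\<close> in order
      to apply to the inverse permutation as well.\<close>
    have pres: "map (f \<tau>) xs \<in> rel_of M' r m" if r: "RelSym r m \<in> L'" and xs: "xs \<in> rel_of M' r m" for \<tau> r m xs
    proof (cases "\<exists>j. set xs \<inter> set (c i j) \<noteq> {}")
      case True
      then obtain j a where a: "a \<in> set xs" "a \<in> set (c i j)" by blast
      have "cl a = set (c i j)" using Cs(5)[OF g(1)[OF i]] a(2) g(4)[OF i] by metis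
      then have sub: "set xs \<subseteq> set (c i j)" using relcl[OF r xs a(1)] by simp
      then have "\<forall>x\<in>set xs. \<exists>l<k i. x = c i j ! l" using len[OF i] by (metis in_set_conv_nth subsetD)
      then obtain h where h: "\<forall>x\<in>set xs. h x < k i \<and> x = c i j ! h x" by metis
      have xs': "xs = map ((!) (c i j)) (map h xs)" using h by (simp add: map_idI)
      have lx: "length xs = m" using xs r L'(3) by (auto simp: is_structure_def)
      have "(RelSym r m, map h xs) \<in> snd (tp (c i j))"
        unfolding tp_def using r h len[OF i] lx xs xs' by auto
      then have "(RelSym r m, map h xs) \<in> snd (tp (c i (\<tau> j)))" using g(2)[OF i] by simp
      then have "map ((!) (c i (\<tau> j))) (map h xs) \<in> rel_of M' r m" unfolding tp_def by simp
      moreover have "map ((!) (c i (\<tau> j))) (map h xs) = map (f \<tau>) xs"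
        unfolding map_map comp_def by (rule map_cong[OF refl]) (metis h fc)
      ultimately show ?thesis by metis
    next
      case False
      then have "map (f \<tau>) xs = xs" using fo by (intro map_idI) blast
      then show ?thesis using xs by simp
    qed
    have \<sigma>i: "\<sigma> (inv \<sigma> j) = j" "inv \<sigma> (\<sigma> j) = j" for j
      using \<sigma> by (simp_all add: bij_is_surj surj_f_inv_f bij_is_inj)
    have bij: "bij_betw (f \<sigma>) (univ M') (univ M')"
      by (rule bij_betw_byWitness[of _ "f (inv \<sigma>)"]) (use inv \<sigma>i fU U in auto)
    have "is_iso L' (f \<sigma>) M' M'"
      unfolding is_iso_def
    proof (intro conjI allI impI)
      fix r m xs assume *: "RelSym r m \<in> L' \<and> length xs = m \<and> set xs \<subseteq> univ M'"
      have "map (f (inv \<sigma>)) (map (f \<sigma>) xs) = xs" by (simp add: comp_def inv \<sigma>i)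
      then show "xs \<in> rel_of M' r m \<longleftrightarrow> map (f \<sigma>) xs \<in> rel_of M' r m"
        using pres * by metis
    qed (use bij L'(2) in \<open>auto simp: relational_def\<close>)
    moreover have "\<forall>s\<in>L. \<forall>a\<in>params (\<Psi> s). f \<sigma> a = a"
    proof (intro ballI)
      fix s a assume "s \<in> L" "a \<in> params (\<Psi> s)"
      then have "a \<in> K" using PK by (auto simp: P_def)
      then show "f \<sigma> a = a" using i by (intro fo) (auto simp: K_def)
    qed
    ultimately have "is_iso L (f \<sigma>) M M" by (rule is_iso_transfer[OF L(2) M(1) ex \<Psi>])
    then show ?thesis using fm fo by (intro exI[of _ "f \<sigma>"]) blast
  qed
  have "isomorphic_over L M K (c i j) (c i j')" if i: "i < n" for i j j'
  proof -
    \<comment> \<open>The transposition of j and j': its automorphism maps one cell to the other and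
      fixes \<open>K\<close>.\<close>
    define s where "s x = (if x = j then j' else if x = j' then j else x)" for x
    have "s (s x) = x" for x by (simp add: s_def)
    then have "bij s" by (rule involuntory_imp_bij)
    from aut[OF i this] obtain f where f: "is_iso L f M M"
      "\<forall>l. map f (c i l) = c i (s l)" "\<forall>a\<in>univ M - (\<Union>j. set (c i j)). f a = a" by blast
    have "map f (c i j) = c i j'" using f(2) by (simp add: s_def)
    moreover have "\<forall>a\<in>K. f a = a" using f(3) i by (auto simp: K_def)
    moreover have "K \<union> set (c i j) \<subseteq> univ M" using csub[OF i] by (auto simp: K_def)
    ultimately show ?thesis using isomorphic_over_automorphism[OF f(1) L(2)] by blast
  qed
  then show ?thesis unfolding cellular_def using part aut by blast
qed

section \<open>Structures with finitely many types\<close>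

definition n_type :: "language \<Rightarrow> 'a struct \<Rightarrow> (nat \<Rightarrow> 'a) \<Rightarrow> nat \<Rightarrow> 'a fm set" where
  "n_type L M e n = {\<phi> \<in> formulas L {}. fv \<phi> \<subseteq> {..<n} \<and> sat M e \<phi>}"

text \<open>The Ryll-Nardzewski condition, which mediates between cellularity, categoricity and the
  bound on algebraic closure.\<close>

definition finite_types :: "language \<Rightarrow> 'a struct \<Rightarrow> bool" where
  "finite_types L M \<longleftrightarrow> (\<forall>n. finite ((\<lambda>e. n_type L M e n) ` assignments M))"

definition elem_equiv :: "language \<Rightarrow> 'a struct \<Rightarrow> 'a struct \<Rightarrow> bool" where
  "elem_equiv L M N \<longleftrightarrow> (\<forall>\<phi>\<in>formulas L {}. holds M \<phi> \<longleftrightarrow> holds N \<phi>)"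

lemma n_type_eq_iff:
  "n_type L M e n = n_type L N e' n \<longleftrightarrow>
   (\<forall>\<phi>\<in>formulas L {}. fv \<phi> \<subseteq> {..<n} \<longrightarrow> (sat M e \<phi> \<longleftrightarrow> sat N e' \<phi>))"
  unfolding n_type_def by blast

lemma n_type_eqI:
  assumes "\<And>\<phi>. \<phi> \<in> formulas L {} \<Longrightarrow> fv \<phi> \<subseteq> {..<n} \<Longrightarrow> sat M e \<phi> \<Longrightarrow> sat N e' \<phi>"
  shows "n_type L M e n = n_type L N e' n"
  unfolding n_type_eq_iff
proof (intro ballI impI)
  fix \<phi> :: "'a fm" assume \<phi>: "\<phi> \<in> formulas L {}" "fv \<phi> \<subseteq> {..<n}"
  show "sat M e \<phi> \<longleftrightarrow> sat N e' \<phi>" using assms[OF \<phi>] assms[of "Neg \<phi>"] \<phi> by auto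
qed

lemma n_type_cong: "(\<And>i. i < n \<Longrightarrow> e i = e' i) \<Longrightarrow> n_type L M e n = n_type L M e' n"
  by (rule n_type_eqI) (metis lessThan_iff sat_cong subsetD)

lemma n_type_mono:
  "n_type L M e n = n_type L N e' n \<Longrightarrow> m \<le> n \<Longrightarrow> n_type L M e m = n_type L N e' m"
  unfolding n_type_eq_iff by (meson lessThan_subset_iff order_trans)

lemma ex_conjunction:
  assumes "finite \<Phi>" "\<forall>\<phi>\<in>\<Phi>. \<phi> \<in> formulas L A \<and> fv \<phi> \<subseteq> V"
  shows "\<exists>\<chi>\<in>formulas L A. fv \<chi> \<subseteq> V \<and> (\<forall>M e. sat M e \<chi> \<longleftrightarrow> (\<forall>\<phi>\<in>\<Phi>. sat M e \<phi>))"
  using assms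
proof (induction \<Phi>)
  case empty
  \<comment> \<open>The empty conjunction has to be a sentence, since \<open>V\<close> may be
    empty.\<close>
  show ?case
    by (rule bexI[of _ "Neg (Exists 0 (Neg (Eq (Var 0) (Var 0))))"]) auto
next
  case (insert \<phi> \<Phi>)
  then obtain \<chi> where "\<chi> \<in> formulas L A" "fv \<chi> \<subseteq> V" "\<forall>M e. sat M e \<chi> \<longleftrightarrow> (\<forall>\<phi>\<in>\<Phi>. sat M e \<phi>)" by auto
  then show ?case using insert.prems by (intro bexI[of _ "And \<phi> \<chi>"]) auto
qed

section \<open>Universal closures, elementary equivalence and isolated types\<close>

lemma assignments_nonempty:
  assumes "univ M \<noteq> {}"
  shows "assignments M \<noteq> {}"
proof -
  obtain a where "a \<in> univ M" using assms by blast
  from assignments_const[OF this] show ?thesis by blast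
qed

lemma ex_universal_closure:
  assumes "\<phi> \<in> formulas L A" "finite V"
  shows "\<exists>\<psi>\<in>formulas L A. fv \<psi> = fv \<phi> - V \<and> (\<forall>M. univ M \<noteq> {} \<longrightarrow> (holds M \<psi> \<longleftrightarrow> holds M \<phi>))"
  using assms(2)
proof (induction V)
  case empty
  show ?case using assms(1) by (intro bexI[of _ \<phi>]) auto
next
  case (insert x V)
  then obtain \<psi> where \<psi>: "\<psi> \<in> formulas L A" "fv \<psi> = fv \<phi> - V"
    "\<forall>M. univ M \<noteq> {} \<longrightarrow> (holds M \<psi> \<longleftrightarrow> holds M \<phi>)" by auto
  have "holds M (Neg (Exists x (Neg \<psi>))) \<longleftrightarrow> holds M \<psi>" for M
    unfolding holds_def
  proof
    assume *: "\<forall>e\<in>assignments M. sat M e (Neg (Exists x (Neg \<psi>)))"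
    show "\<forall>e\<in>assignments M. sat M e \<psi>"
    proof
      fix e assume e: "e \<in> assignments M"
      then have "sat M (e(x := e x)) \<psi>" using * assignmentsD[OF e] by (auto simp del: fun_upd_triv)
      then show "sat M e \<psi>" by simp
    qed
  qed auto
  then show ?case using \<psi> by (intro bexI[of _ "Neg (Exists x (Neg \<psi>))"]) auto
qed

text \<open>\<open>Th\<close> contains sentences only, whereas \<open>elem_equiv\<close> compares
  formulas with free variables; universal closures bridge the gap. A sentence that fails in
  \<open>M\<close> has its negation in \<open>Th\<close>.\<close>

lemma elem_equiv_Th:
  assumes "univ M \<noteq> {}" "univ N \<noteq> {}" "\<forall>\<phi>\<in>Th L M. holds N \<phi>"
  shows "elem_equiv L M N"
  unfolding elem_equiv_def
proof
  fix \<phi> :: "'a fm" assume "\<phi> \<in> formulas L {}"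
  then obtain \<psi> where \<psi>: "\<psi> \<in> formulas L {}" "fv \<psi> = {}"
    "\<forall>M. univ M \<noteq> {} \<longrightarrow> (holds M \<psi> \<longleftrightarrow> holds M \<phi>)"
    using ex_universal_closure[of \<phi> L "{}" "fv \<phi>"] by auto
  have "holds M \<psi> \<longleftrightarrow> holds N \<psi>"
  proof (cases "holds M \<psi>")
    case True
    then show ?thesis using assms(3) \<psi> by (auto simp: Th_def)
  next
    case False
    have "sat M e \<psi> \<longleftrightarrow> sat M e' \<psi>" for e e' by (rule sat_cong) (simp add: \<psi>(2))
    then have "holds M (Neg \<psi>)" using False unfolding holds_def by auto
    then have "holds N (Neg \<psi>)" using assms(3) \<psi> by (auto simp: Th_def)
    then show ?thesis using False assignments_nonempty[OF assms(2)] by (auto simp: holds_def)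
  qed
  then show "holds M \<phi> \<longleftrightarrow> holds N \<phi>" using \<psi>(3) assms by simp
qed

lemma elem_equiv_sym: "elem_equiv L M N \<Longrightarrow> elem_equiv L N M"
  by (auto simp: elem_equiv_def)

lemma elem_equiv_trans: "elem_equiv L M N \<Longrightarrow> elem_equiv L N P \<Longrightarrow> elem_equiv L M P"
  by (auto simp: elem_equiv_def)

text \<open>Each of the finitely many other types omits some formula of the given one; the
  conjunction of these formulas isolates it.\<close>

lemma isolating_formula:
  assumes "finite_types L M" "e \<in> assignments M"
  shows "\<exists>\<chi>\<in>formulas L {}. fv \<chi> \<subseteq> {..<n} \<and> sat M e \<chi> \<and>
    (\<forall>e'\<in>assignments M. sat M e' \<chi> \<longrightarrow> n_type L M e' n = n_type L M e n)"
proof -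
  let ?T = "(\<lambda>e. n_type L M e n) ` assignments M - {n_type L M e n}"
  have "\<exists>\<phi>. \<phi> \<in> n_type L M e n \<and> \<phi> \<notin> t" if t: "t \<in> ?T" for t
  proof -
    obtain e' where e': "e' \<in> assignments M" "t = n_type L M e' n" "t \<noteq> n_type L M e n" using t by auto
    show ?thesis
    proof (rule ccontr)
      assume "\<not> ?thesis"
      then have "n_type L M e n = n_type L M e' n" unfolding e'(2)
        by (intro n_type_eqI) (auto simp: n_type_def)
      then show False using e' by simp
    qed
  qed
  then obtain f where f: "\<And>t. t \<in> ?T \<Longrightarrow> f t \<in> n_type L M e n \<and> f t \<notin> t" by metis
  have "finite (f ` ?T)" using assms(1) by (auto simp: finite_types_def)
  moreover have "\<forall>\<phi>\<in>f ` ?T. \<phi> \<in> formulas L {} \<and> fv \<phi> \<subseteq> {..<n}"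
    using f by (auto simp: n_type_def)
  ultimately obtain \<chi> where \<chi>: "\<chi> \<in> formulas L {}" "fv \<chi> \<subseteq> {..<n}"
    "\<And>M e. sat M e \<chi> \<longleftrightarrow> (\<forall>\<phi>\<in>f ` ?T. sat M e \<phi>)"
    using ex_conjunction[of "f ` ?T" L "{}" "{..<n}"] by blast
  have "sat M e \<chi>" unfolding \<chi>(3) using f by (auto simp: n_type_def)
  moreover have "n_type L M e' n = n_type L M e n" if e': "e' \<in> assignments M" "sat M e' \<chi>" for e'
  proof (rule ccontr)
    assume "\<not> ?thesis"
    then have t: "n_type L M e' n \<in> ?T" using e' by auto
    then have "sat M e' (f (n_type L M e' n))" using e'(2) unfolding \<chi>(3) by blast
    then show False using f[OF t] by (auto simp: n_type_def)
  qed
  ultimately show ?thesis using \<chi> by blast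
qed

text \<open>\<open>M\<close> satisfies the universal statement that one of the finitely many
  isolating formulas holds, and the statements that each of these implies every formula of its type.
  All of them pass to \<open>N\<close>.\<close>

lemma finite_types_transfer:
  assumes M: "finite_types L M" and eq: "elem_equiv L M N" and e: "e \<in> assignments N"
  shows "\<exists>e'\<in>assignments M. n_type L N e n = n_type L M e' n"
proof -
  define T where "T = (\<lambda>e. n_type L M e n) ` assignments M"
  have "\<exists>\<chi>. \<chi> \<in> formulas L {} \<and> fv \<chi> \<subseteq> {..<n} \<and> (\<exists>e\<in>assignments M. n_type L M e n = t \<and> sat M e \<chi>) \<and>
      (\<forall>e'\<in>assignments M. sat M e' \<chi> \<longrightarrow> n_type L M e' n = t)" if "t \<in> T" for t
    using that isolating_formula[OF M, of _ n] unfolding T_def by blast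
  then obtain f where f: "\<And>t. t \<in> T \<Longrightarrow> f t \<in> formulas L {} \<and> fv (f t) \<subseteq> {..<n} \<and>
      (\<exists>e\<in>assignments M. n_type L M e n = t \<and> sat M e (f t)) \<and>
      (\<forall>e'\<in>assignments M. sat M e' (f t) \<longrightarrow> n_type L M e' n = t)" by metis
  have "finite ((\<lambda>t. Neg (f t)) ` T)" using M by (auto simp: finite_types_def T_def)
  moreover have "\<forall>\<phi>\<in>(\<lambda>t. Neg (f t)) ` T. \<phi> \<in> formulas L {} \<and> fv \<phi> \<subseteq> {..<n}" using f by auto
  ultimately obtain \<chi> where \<chi>: "\<chi> \<in> formulas L {}"
    "\<And>M e. sat M e \<chi> \<longleftrightarrow> (\<forall>\<phi>\<in>(\<lambda>t. Neg (f t)) ` T. sat M e \<phi>)"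
    using ex_conjunction[of "(\<lambda>t. Neg (f t)) ` T" L "{}" "{..<n}"] by blast
  have "sat M e' (Neg \<chi>)" if e': "e' \<in> assignments M" for e'
  proof -
    have t: "n_type L M e' n \<in> T" using e' by (simp add: T_def)
    then obtain e0 where e0: "e0 \<in> assignments M" "n_type L M e0 n = n_type L M e' n"
      "sat M e0 (f (n_type L M e' n))" using f by blast
    then have "sat M e' (f (n_type L M e' n))" using f[OF t] unfolding n_type_eq_iff by blast
    then show ?thesis using t \<chi>(2) by auto
  qed
  then have "holds M (Neg \<chi>)" by (simp add: holds_def)
  then have "holds N (Neg \<chi>)" using eq \<chi>(1) by (simp add: elem_equiv_def)
  then obtain t where t: "t \<in> T" "sat N e (f t)" using e \<chi>(2) by (auto simp: holds_def)
  then obtain e0 where e0: "e0 \<in> assignments M" "n_type L M e0 n = t" using f by blast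
  have "sat N e \<phi>" if \<phi>: "\<phi> \<in> formulas L {}" "fv \<phi> \<subseteq> {..<n}" "sat M e0 \<phi>" for \<phi>
  proof -
    have "holds M (Neg (And (f t) (Neg \<phi>)))" unfolding holds_def
    proof
      fix e' assume e': "e' \<in> assignments M"
      have "sat M e' \<phi>" if "sat M e' (f t)"
        using f[OF t(1)] e' that \<phi> e0(2) unfolding n_type_eq_iff[symmetric]
        by (metis (no_types, lifting) mem_Collect_eq n_type_def)
      then show "sat M e' (Neg (And (f t) (Neg \<phi>)))" by auto
    qed
    moreover have "Neg (And (f t) (Neg \<phi>)) \<in> formulas L {}" using f[OF t(1)] \<phi> by simp
    ultimately have "holds N (Neg (And (f t) (Neg \<phi>)))" using eq by (simp add: elem_equiv_def)
    then show ?thesis using e t(2) by (auto simp: holds_def)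
  qed
  then have "n_type L M e0 n = n_type L N e n" by (intro n_type_eqI)
  then show ?thesis using e0(1) by metis
qed

lemma finite_types_elem_equiv:
  assumes "finite_types L M" "elem_equiv L M N"
  shows "finite_types L N"
  unfolding finite_types_def
proof
  fix n
  have "(\<lambda>e. n_type L N e n) ` assignments N \<subseteq> (\<lambda>e. n_type L M e n) ` assignments M"
    using finite_types_transfer[OF assms] by blast
  then show "finite ((\<lambda>e. n_type L N e n) ` assignments N)"
    using assms(1) finite_subset unfolding finite_types_def by blast
qed

text \<open>If \<open>\<chi>\<close> isolates the type of the extended tuple, then
  \<open>Exists n \<chi>\<close> belongs to the type of \<open>e\<close>, hence to that of
  \<open>e'\<close>, and any witness for it will do.\<close>

lemma forth:
  assumes M: "finite_types L M" and eq: "elem_equiv L M N"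
    and e: "e \<in> assignments M" "e' \<in> assignments N" "n_type L M e n = n_type L N e' n"
    and a: "a \<in> univ M"
  shows "\<exists>b\<in>univ N. n_type L M (e(n := a)) (Suc n) = n_type L N (e'(n := b)) (Suc n)"
proof -
  have ea: "e(n := a) \<in> assignments M" using e a by simp
  obtain \<chi> where \<chi>: "\<chi> \<in> formulas L {}" "fv \<chi> \<subseteq> {..<Suc n}" "sat M (e(n := a)) \<chi>"
    "\<forall>e'\<in>assignments M. sat M e' \<chi> \<longrightarrow> n_type L M e' (Suc n) = n_type L M (e(n := a)) (Suc n)"
    using isolating_formula[OF M ea, of "Suc n"] by blast
  have "sat M e (Exists n \<chi>)" using \<chi>(3) a by auto
  moreover have "Exists n \<chi> \<in> formulas L {}" "fv (Exists n \<chi>) \<subseteq> {..<n}" using \<chi> by auto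
  ultimately have "sat N e' (Exists n \<chi>)" using e(3) unfolding n_type_eq_iff by blast
  then obtain b where b: "b \<in> univ N" "sat N (e'(n := b)) \<chi>" by auto
  have "n_type L M (e(n := a)) (Suc n) = n_type L N (e'(n := b)) (Suc n)"
  proof (rule n_type_eqI)
    fix \<phi> :: "'a fm" assume \<phi>: "\<phi> \<in> formulas L {}" "fv \<phi> \<subseteq> {..<Suc n}" "sat M (e(n := a)) \<phi>"
    have "holds M (Neg (And \<chi> (Neg \<phi>)))" unfolding holds_def
    proof
      fix e1 assume e1: "e1 \<in> assignments M"
      have "sat M e1 \<phi>" if "sat M e1 \<chi>"
        using bspec[OF \<chi>(4) e1, THEN mp, OF that] \<phi> unfolding n_type_eq_iff by blast
      then show "sat M e1 (Neg (And \<chi> (Neg \<phi>)))" by auto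
    qed
    moreover have "Neg (And \<chi> (Neg \<phi>)) \<in> formulas L {}" using \<chi>(1) \<phi>(1) by simp
    ultimately have "holds N (Neg (And \<chi> (Neg \<phi>)))" using eq by (simp add: elem_equiv_def)
    moreover have "e'(n := b) \<in> assignments N" using e b by simp
    ultimately show "sat N (e'(n := b)) \<phi>" using b(2) unfolding holds_def by auto
  qed
  then show ?thesis using b(1) by blast
qed

text \<open>The enumerations may repeat elements; as equations belong to the types, the
  correspondence is still well defined and injective.\<close>

lemma is_iso_of_enumerations:
  assumes L: "relational L" and E: "range E = univ M" "range E' = univ N"
    and eq: "\<And>n. n_type L M E n = n_type L N E' n"
  shows "\<exists>h. is_iso L h M N \<and> (\<forall>i. h (E i) = E' i)"
proof -
  have sat: "sat M E \<phi> \<longleftrightarrow> sat N E' \<phi>" if "\<phi> \<in> formulas L {}" for \<phi>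
  proof -
    obtain n where "\<forall>x\<in>fv \<phi>. x < n" using finite_nat_set_iff_bounded[of "fv \<phi>"] by auto
    then show ?thesis using eq[of n] that unfolding n_type_eq_iff by blast
  qed
  have inj: "E i = E j \<longleftrightarrow> E' i = E' j" for i j using sat[of "Eq (Var i) (Var j)"] by simp
  define h where "h a = E' (SOME i. E i = a)" for a
  have h: "h (E i) = E' i" for i
  proof -
    have "E (SOME j. E j = E i) = E i" by (rule someI) simp
    then show ?thesis unfolding h_def inj .
  qed
  have "bij_betw h (univ M) (univ N)"
    unfolding bij_betw_def E[symmetric]
  proof
    show "inj_on h (range E)" by (rule inj_onI) (auto simp: h inj)
    show "h ` range E = range E'" by (simp add: image_image h)
  qed
  moreover have "xs \<in> rel_of M r n \<longleftrightarrow> map h xs \<in> rel_of N r n"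
    if xs: "RelSym r n \<in> L" "length xs = n" "set xs \<subseteq> univ M" for r n xs
  proof -
    have "\<forall>x\<in>set xs. \<exists>i. x = E i" using xs(3) E(1) by auto
    then obtain ix where ix: "\<forall>x\<in>set xs. x = E (ix x)" by metis
    let ?is = "map ix xs"
    have xs1: "map E ?is = xs" using ix by (simp add: map_idI)
    have xs2: "map E' ?is = map h xs" using arg_cong[OF xs1, of "map h"] by (simp only: map_map comp_def h)
    have "Rel r (map Var ?is) \<in> formulas L {}" using xs by (auto simp: formulas_def)
    from sat[OF this] have "map E ?is \<in> rel_of M r (length xs) \<longleftrightarrow> map E' ?is \<in> rel_of N r (length xs)"
      by (simp add: comp_def)
    then show ?thesis unfolding xs1 xs2 xs(2) .
  qed
  ultimately have "is_iso L h M N" using L by (auto simp: is_iso_def relational_def)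
  then show ?thesis using h by blast
qed

theorem back_and_forth:
  assumes L: "relational L" and M: "finite_types L M" and eq: "elem_equiv L M N"
    and ne: "univ M \<noteq> {}" "univ N \<noteq> {}" and ct: "countable (univ M)" "countable (univ N)"
    and e: "e \<in> assignments M" "e' \<in> assignments N" "n_type L M e n = n_type L N e' n"
  shows "\<exists>h. is_iso L h M N \<and> (\<forall>i<n. h (e i) = e' i)"
proof -
  have N: "finite_types L N" using finite_types_elem_equiv[OF M eq] .
  have eq': "elem_equiv L N M" using elem_equiv_sym[OF eq] .
  define P where "P k s \<longleftrightarrow> fst s \<in> assignments M \<and> snd s \<in> assignments N \<and>
    n_type L M (fst s) (n + k) = n_type L N (snd s) (n + k)" for k and s :: "(nat \<Rightarrow> 'a) \<times> (nat \<Rightarrow> 'a)"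
  \<comment> \<open>Stage k settles the coordinate \<open>n + k\<close>: even stages insert the next
    element of \<open>M\<close>, odd stages the next element of \<open>N\<close>.\<close>
  define Q where "Q k s s' \<longleftrightarrow> (\<forall>i<n + k. fst s' i = fst s i \<and> snd s' i = snd s i) \<and>
    (if even k then fst s' (n + k) = from_nat_into (univ M) (k div 2)
     else snd s' (n + k) = from_nat_into (univ N) (k div 2))"
    for k and s s' :: "(nat \<Rightarrow> 'a) \<times> (nat \<Rightarrow> 'a)"
  have "\<exists>s. \<forall>k. (P k (s k) \<and> (k = 0 \<longrightarrow> s k = (e, e'))) \<and> Q k (s k) (s (Suc k))"
  proof (rule dependent_nat_choice)
    show "\<exists>s. P 0 s \<and> (0 = (0::nat) \<longrightarrow> s = (e, e'))" using e by (simp add: P_def)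
    fix s k assume "P k s \<and> (k = 0 \<longrightarrow> s = (e, e'))"
    then have s: "fst s \<in> assignments M" "snd s \<in> assignments N"
      "n_type L M (fst s) (n + k) = n_type L N (snd s) (n + k)" by (simp_all add: P_def)
    show "\<exists>s'. (P (Suc k) s' \<and> (Suc k = 0 \<longrightarrow> s' = (e, e'))) \<and> Q k s s'"
    proof (cases "even k")
      case True
      let ?a = "from_nat_into (univ M) (k div 2)"
      have a: "?a \<in> univ M" by (rule from_nat_into[OF ne(1)])
      from forth[OF M eq s a] obtain b where b: "b \<in> univ N" "n_type L M ((fst s)(n + k := ?a)) (Suc (n + k)) =
          n_type L N ((snd s)(n + k := b)) (Suc (n + k))"
        by blast
      show ?thesis using s(1,2) a b True
        by (intro exI[of _ "((fst s)(n + k := ?a), (snd s)(n + k := b))"]) (simp add: P_def Q_def)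
    next
      case False
      let ?b = "from_nat_into (univ N) (k div 2)"
      have b: "?b \<in> univ N" by (rule from_nat_into[OF ne(2)])
      from forth[OF N eq' s(2,1) s(3)[symmetric] b] obtain a where a: "a \<in> univ M" "n_type L N ((snd s)(n + k := ?b)) (Suc (n + k)) =
          n_type L M ((fst s)(n + k := a)) (Suc (n + k))"
        by blast
      show ?thesis using s(1,2) a(1) a(2)[symmetric] b False
        by (intro exI[of _ "((fst s)(n + k := a), (snd s)(n + k := ?b))"]) (simp add: P_def Q_def)
    qed
  qed
  then obtain s where s: "\<And>k. P k (s k)" "s 0 = (e, e')" "\<And>k. Q k (s k) (s (Suc k))" by metis
  have stab: "fst (s k') i = fst (s k) i \<and> snd (s k') i = snd (s k) i"
    if "k \<le> k'" "i < n + k" for k k' i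
    using that(1)
  proof (induction k' rule: dec_induct)
    case (step k')
    then show ?case using s(3)[of k'] that(2) by (simp add: Q_def)
  qed simp
  \<comment> \<open>Coordinate i is settled at stage \<open>Suc i\<close> at the latest, because i
    is below \<open>n + Suc i\<close>.\<close>
  define E where "E i = fst (s (Suc i)) i" for i
  define E' where "E' i = snd (s (Suc i)) i" for i
  have EE: "fst (s k) i = E i \<and> snd (s k) i = E' i" if "i < n + k" for i k
  proof (cases "k \<le> Suc i")
    case True
    then show ?thesis using stab[OF True that] by (simp add: E_def E'_def)
  next
    case False
    then show ?thesis using stab[of "Suc i" k i] by (simp add: E_def E'_def)
  qed
  have type: "n_type L M E m = n_type L N E' m" for m
  proof -
    have "n_type L M (fst (s m)) (n + m) = n_type L N (snd (s m)) (n + m)" using s(1)[of m] by (simp add: P_def)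
    then have "n_type L M (fst (s m)) m = n_type L N (snd (s m)) m" by (rule n_type_mono) simp
    moreover have "n_type L M (fst (s m)) m = n_type L M E m" by (rule n_type_cong) (simp add: EE)
    moreover have "n_type L N (snd (s m)) m = n_type L N E' m" by (rule n_type_cong) (simp add: EE)
    ultimately show ?thesis by simp
  qed
  have "range E = univ M"
  proof
    show "range E \<subseteq> univ M" using s(1) by (auto simp: E_def P_def)
    show "univ M \<subseteq> range E"
    proof
      fix a assume "a \<in> univ M"
      then obtain j where j: "from_nat_into (univ M) j = a" using from_nat_into_surj[OF ct(1)] by blast
      have "fst (s (Suc (2 * j))) (n + 2 * j) = a" using s(3)[of "2 * j"] j by (simp add: Q_def)
      then have "E (n + 2 * j) = a" using EE[of "n + 2 * j" "Suc (2 * j)"] by simp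
      then show "a \<in> range E" by blast
    qed
  qed
  moreover have "range E' = univ N"
  proof
    show "range E' \<subseteq> univ N" using s(1) by (auto simp: E'_def P_def)
    show "univ N \<subseteq> range E'"
    proof
      fix b assume "b \<in> univ N"
      then obtain j where j: "from_nat_into (univ N) j = b" using from_nat_into_surj[OF ct(2)] by blast
      have "snd (s (Suc (2 * j + 1))) (n + (2 * j + 1)) = b" using s(3)[of "2 * j + 1"] j by (simp add: Q_def)
      then have "E' (n + (2 * j + 1)) = b" using EE[of "n + (2 * j + 1)" "Suc (2 * j + 1)"] by simp
      then show "b \<in> range E'" by blast
    qed
  qed
  ultimately obtain h where h: "is_iso L h M N" "\<forall>i. h (E i) = E' i"
    using is_iso_of_enumerations[OF L _ _ type] by blast
  have "h (e i) = e' i" if "i < n" for i using EE[of i 0] that s(2) h(2) by simp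
  then show ?thesis using h(1) by blast
qed

section \<open>Cellular structures have finitely many types\<close>

lemma finite_types_finite_representatives:
  assumes "univ M \<noteq> {}"
    and "\<And>n. \<exists>F. finite F \<and> F \<subseteq> univ M \<and> (\<forall>e\<in>assignments M. \<exists>e'\<in>assignments M.
      (\<forall>i<n. e' i \<in> F) \<and> n_type L M e n = n_type L M e' n)"
  shows "finite_types L M"
  unfolding finite_types_def
proof
  fix n
  obtain F where F: "finite F" "\<forall>e\<in>assignments M. \<exists>e'\<in>assignments M.
      (\<forall>i<n. e' i \<in> F) \<and> n_type L M e n = n_type L M e' n" using assms(2)[of n] by blast
  \<comment> \<open>A type depends only on the coordinates below n, and restricted to these there
    are finitely many functions into \<open>F\<close>.\<close>
  have "(\<lambda>e. n_type L M e n) ` assignments M \<subseteq> (\<lambda>e. n_type L M e n) ` ({..<n} \<rightarrow>\<^sub>E F)"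
  proof
    fix t assume "t \<in> (\<lambda>e. n_type L M e n) ` assignments M"
    then obtain e where e: "e \<in> assignments M" "t = n_type L M e n" by blast
    then obtain e' where e': "\<forall>i<n. e' i \<in> F" "t = n_type L M e' n" using F(2) by blast
    have "n_type L M e' n = n_type L M (restrict e' {..<n}) n" by (rule n_type_cong) simp
    then show "t \<in> (\<lambda>e. n_type L M e n) ` ({..<n} \<rightarrow>\<^sub>E F)" using e' by auto
  qed
  moreover have "finite ((\<lambda>e. n_type L M e n) ` ({..<n} \<rightarrow>\<^sub>E F))"
    using F(1) by (intro finite_imageI finite_PiE) auto
  ultimately show "finite ((\<lambda>e. n_type L M e n) ` assignments M)"
    by (rule finite_subset)
qed

text \<open>Pad \<open>J\<close> to a set with exactly n elements. Its complement and that of the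
  initial segment are both infinite, so a bijection between the two finite sets extends.\<close>

lemma ex_bij_into_initial_segment:
  fixes J :: "nat set"
  assumes "finite J" "card J \<le> n"
  shows "\<exists>\<sigma>. bij \<sigma> \<and> \<sigma> ` J \<subseteq> {..<n}"
proof -
  have cof: "infinite (- A)" if "finite A" for A :: "nat set"
    using finite_compl[OF that] infinite_UNIV_nat by simp
  obtain T where T: "finite T" "card T = n - card J" "T \<subseteq> - J"
    using infinite_arbitrarily_large[OF cof[OF assms(1)]] by blast
  let ?J = "J \<union> T"
  have fin: "finite ?J" using T assms by simp
  have "card ?J = n" using T assms by (subst card_Un_disjoint) auto
  then obtain f where f: "bij_betw f ?J {..<n}" using fin finite_same_card_bij[of ?J "{..<n}"] by auto
  have inf: "infinite (- ?J)" "infinite (- {..<n})" using cof[OF fin] cof[of "{..<n}"] by simp_all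
  define g where "g = from_nat_into (- {..<n}) \<circ> to_nat_on (- ?J)"
  have g: "bij_betw g (- ?J) (- {..<n})"
    unfolding g_def using to_nat_on_infinite[OF _ inf(1)] bij_betw_from_nat_into[OF _ inf(2)]
    by (intro bij_betw_trans) auto
  define \<sigma> where "\<sigma> x = (if x \<in> ?J then f x else g x)" for x
  have "bij_betw \<sigma> (?J \<union> - ?J) ({..<n} \<union> - {..<n})"
    unfolding \<sigma>_def by (rule bij_betw_disjoint_Un[OF f g]) auto
  then have "bij \<sigma>" by (simp only: Compl_partition)
  moreover have "\<sigma> ` J \<subseteq> {..<n}" using f by (auto simp: \<sigma>_def bij_betw_def)
  ultimately show ?thesis by blast
qed

lemma n_type_iso:
  assumes "is_iso L h M N" "is_structure L M" "e \<in> assignments M"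
  shows "n_type L M e n = n_type L N (\<lambda>x. h (e x)) n"
proof (rule n_type_eqI)
  fix \<phi> :: "'a fm" assume "\<phi> \<in> formulas L {}" "sat M e \<phi>"
  then show "sat N (\<lambda>x. h (e x)) \<phi>" using sat_iso_fixed[OF assms, of \<phi> "{}"] by simp
qed

lemma assignments_iso:
  "is_iso L h M N \<Longrightarrow> e \<in> assignments M \<Longrightarrow> (\<lambda>x. h (e x)) \<in> assignments N"
  by (auto simp: is_iso_def assignments_def bij_betw_def)

text \<open>The n entries of a tuple meet at most n cells of a family, so a permutation of its cells
  brings them among the first n. The families are treated in turn; the automorphism for one of them
  fixes the others pointwise and does not spoil earlier work.\<close>

lemma cellular_finite_types:
  assumes M: "is_structure L M" and cell: "cellular L M"
  shows "finite_types L M"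
proof (rule finite_types_finite_representatives)
  show ne: "univ M \<noteq> {}" using M by (simp add: is_structure_def)
  obtain K n0 k c where part: "cellular_partition M K n0 k c"
    and aut: "\<forall>i<n0. \<forall>\<sigma>::nat \<Rightarrow> nat. bij \<sigma> \<longrightarrow> (\<exists>f. is_iso L f M M \<and>
      (\<forall>j. map f (c i j) = c i (\<sigma> j)) \<and> (\<forall>a\<in>univ M - (\<Union>j. set (c i j)). f a = a))"
    using cell unfolding cellular_def by (elim exE conjE) (rule that)
  have K: "finite K" "K \<union> (\<Union>i<n0. \<Union>j. set (c i j)) = univ M"
    using part by (simp_all add: cellular_partition_def)
  have disj: "set (c i j) \<inter> set (c i' j') = {}" if "i < n0" "i' < n0" "(i, j) \<noteq> (i', j')" for i j i' j'
    using part that unfolding cellular_partition_def by blast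
  have csub: "set (c i j) \<subseteq> univ M" if "i < n0" for i j using K(2) that by blast
  fix n
  let ?F = "K \<union> (\<Union>i<n0. \<Union>j<n. set (c i j))"
  have step: "\<exists>f. is_iso L f M M \<and> (\<forall>x<n. \<forall>i<m. \<forall>j. f (e x) \<in> set (c i j) \<longrightarrow> j < n)"
    if e: "e \<in> assignments M" and "m \<le> n0" for e m
    using \<open>m \<le> n0\<close>
  proof (induction m)
    case 0
    show ?case using is_iso_id by (intro exI[of _ "\<lambda>a. a"]) simp
  next
    case (Suc m)
    then obtain f where f: "is_iso L f M M" "\<forall>x<n. \<forall>i<m. \<forall>j. f (e x) \<in> set (c i j) \<longrightarrow> j < n" by auto
    have m: "m < n0" using Suc.prems by simp
    define J where "J = {j. \<exists>x<n. f (e x) \<in> set (c m j)}"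
    \<comment> \<open>Cells are disjoint, so each entry determines at most one index.\<close>
    have "J \<subseteq> (\<lambda>x. THE j. f (e x) \<in> set (c m j)) ` {..<n}"
    proof
      fix j assume "j \<in> J"
      then obtain x where x: "x < n" "f (e x) \<in> set (c m j)" by (auto simp: J_def)
      have "(THE j. f (e x) \<in> set (c m j)) = j"
        by (rule the_equality[of _ j]) (use x(2) disj[OF m m] in blast)+
      then show "j \<in> (\<lambda>x. THE j. f (e x) \<in> set (c m j)) ` {..<n}" using x(1) by force
    qed
    then have "finite J" "card J \<le> n"
      using finite_subset surj_card_le[of "{..<n}" J] by auto
    then obtain \<sigma> where \<sigma>: "bij \<sigma>" "\<sigma> ` J \<subseteq> {..<n}" using ex_bij_into_initial_segment by blast
    obtain g where g: "is_iso L g M M" "\<forall>j. map g (c m j) = c m (\<sigma> j)"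
      "\<forall>a\<in>univ M - (\<Union>j. set (c m j)). g a = a" using aut[rule_format, OF m \<sigma>(1)] by (elim exE conjE) (rule that)
    have gc: "g a \<in> set (c m (\<sigma> j))" if "a \<in> set (c m j)" for a j
      using g(2) that by (metis image_eqI set_map)
    have "j < n" if x: "x < n" and i: "i < Suc m" and j: "g (f (e x)) \<in> set (c i j)" for x i j
    proof (cases "\<exists>j'. f (e x) \<in> set (c m j')")
      case True
      then obtain j' where j': "f (e x) \<in> set (c m j')" by blast
      then have "(i, j) = (m, \<sigma> j')" using disj[of i m j "\<sigma> j'"] gc[OF j'] j i m by force
      moreover have "j' \<in> J" using j' x by (auto simp: J_def)
      ultimately show ?thesis using \<sigma>(2) by auto
    next
      case False
      have "f (e x) \<in> univ M" using assignments_iso[OF f(1) e] by (auto simp: assignments_def)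
      then have "g (f (e x)) = f (e x)" using False g(3) by blast
      then show ?thesis using f(2) x i j False by (metis less_antisym)
    qed
    then show ?case using is_iso_comp[OF f(1) g(1), unfolded comp_def]
      by (intro exI[of _ "\<lambda>a. g (f a)"]) blast
  qed
  show "\<exists>F. finite F \<and> F \<subseteq> univ M \<and> (\<forall>e\<in>assignments M. \<exists>e'\<in>assignments M.
      (\<forall>i<n. e' i \<in> F) \<and> n_type L M e n = n_type L M e' n)"
  proof (intro exI[of _ ?F] conjI ballI)
    show "finite ?F" using K(1) by simp
    show "?F \<subseteq> univ M" using K(2) by blast
    fix e assume e: "e \<in> assignments M"
    obtain f where f: "is_iso L f M M" "\<forall>x<n. \<forall>i<n0. \<forall>j. f (e x) \<in> set (c i j) \<longrightarrow> j < n"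
      using step[OF e order_refl] by blast
    have fe: "(\<lambda>x. f (e x)) \<in> assignments M" by (rule assignments_iso[OF f(1) e])
    have "f (e x) \<in> ?F" if "x < n" for x
    proof -
      have "f (e x) \<in> K \<union> (\<Union>i<n0. \<Union>j. set (c i j))" using fe K(2) by (auto simp: assignments_def)
      then show ?thesis using f(2) that by blast
    qed
    then show "\<exists>e'\<in>assignments M. (\<forall>i<n. e' i \<in> ?F) \<and> n_type L M e n = n_type L M e' n"
      using n_type_iso[OF f(1) M e] fe by (intro bexI[of _ "\<lambda>x. f (e x)"]) auto
  qed
qed

lemma finite_types_omega_categorical:
  assumes L: "relational L" and M: "is_structure L M" "infinite (univ M)" "countable (univ M)"
    and fin: "finite_types L M"
  shows "omega_categorical L M"
  unfolding omega_categorical_def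
proof (intro conjI ballI)
  have "M \<in> countable_models L (Th L M)" using M by (auto simp: countable_models_def Th_def)
  then show "countable_models L (Th L M) \<noteq> {}" by blast
  have ne: "univ M \<noteq> {}" using M by auto
  have model: "univ N \<noteq> {}" "countable (univ N)" "elem_equiv L M N" "finite_types L N"
    if "N \<in> countable_models L (Th L M)" for N
  proof -
    show ne': "univ N \<noteq> {}" and "countable (univ N)" using that by (auto simp: countable_models_def)
    show "elem_equiv L M N"
      by (rule elem_equiv_Th[OF ne ne']) (use that in \<open>auto simp: countable_models_def\<close>)
    then show "finite_types L N" by (rule finite_types_elem_equiv[OF fin])
  qed
  fix N N' assume N: "N \<in> countable_models L (Th L M)" and N': "N' \<in> countable_models L (Th L M)"
  obtain e' where e': "e' \<in> assignments N'"
    using assignments_nonempty[OF model(1)[OF N']] by blast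
  have eq: "elem_equiv L N N'"
    using model(3)[OF N] model(3)[OF N'] elem_equiv_sym elem_equiv_trans by blast
  obtain e1 where e1: "e1 \<in> assignments N" "n_type L N' e' 0 = n_type L N e1 0"
    using finite_types_transfer[OF model(4)[OF N] eq e', of 0] by blast
  show "\<exists>h. is_iso L h N N'"
    using back_and_forth[OF L model(4)[OF N] eq model(1)[OF N] model(1)[OF N'] model(2)[OF N]
        model(2)[OF N'] e1(1) e' e1(2)[symmetric]] by blast
qed

section \<open>Generic models\<close>

instance trm :: (countable) countable
  by countable_datatype

instance fm :: (countable) countable
  by countable_datatype

text \<open>The type of elements may be uncountable; formulas without parameters embed into the
  countable type of formulas over \<open>nat\<close>.\<close>

lemma countable_formulas: "countable (formulas L {} :: 'a fm set)"
proof -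
  let ?h = "map_fm (\<lambda>_. 0) :: 'a fm \<Rightarrow> nat fm" and ?g = "map_fm (\<lambda>_. undefined) :: nat fm \<Rightarrow> 'a fm"
  have "?g (?h \<phi>) = \<phi>" if "\<phi> \<in> formulas L {}" for \<phi>
    using map_fm_id[of \<phi> "(\<lambda>_. undefined) \<circ> (\<lambda>_. 0)"] that
    by (auto simp: fm.map_comp formulas_def)
  then have "inj_on ?h (formulas L {})" by (rule inj_on_inverseI)
  then show ?thesis by (metis countable_image_inj_on countableI_type)
qed

text \<open>The Rasiowa-Sikorski lemma. The trivial requirement \<open>\<lambda>_. True\<close> is
  added so that the set to be enumerated is nonempty.\<close>

lemma generic_sequence:
  fixes \<D> :: "'b set set"
  assumes "D0 \<in> \<D>" "countable \<T>" "\<And>T D. T \<in> \<T> \<Longrightarrow> D \<in> \<D> \<Longrightarrow> \<exists>D'\<in>\<D>. D' \<subseteq> D \<and> T D'"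
  shows "\<exists>D. D 0 = D0 \<and> (\<forall>k::nat. D k \<in> \<D> \<and> D (Suc k) \<subseteq> D k) \<and> (\<forall>T\<in>\<T>. \<exists>k. T (D k))"
proof -
  let ?\<T> = "insert (\<lambda>_. True) \<T>"
  define T where "T = from_nat_into ?\<T>"
  have T: "range T = ?\<T>"
    unfolding T_def using assms(2) by (intro range_from_nat_into) auto
  have dense: "\<exists>D'\<in>\<D>. D' \<subseteq> D \<and> T k D'" if "D \<in> \<D>" for D k
  proof (cases "T k \<in> \<T>")
    case True
    then show ?thesis using assms(3) that by blast
  next
    case False
    then have "T k = (\<lambda>_. True)" using T by blast
    then show ?thesis using that by auto
  qed
  have "\<exists>D. \<forall>k::nat. (D k \<in> \<D> \<and> (k = 0 \<longrightarrow> D k = D0)) \<and> (D (Suc k) \<subseteq> D k \<and> T k (D (Suc k)))"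
  proof (rule dependent_nat_choice)
    show "\<exists>x. x \<in> \<D> \<and> (0 = (0::nat) \<longrightarrow> x = D0)" using assms(1) by blast
    fix x and k :: nat assume "x \<in> \<D> \<and> (k = 0 \<longrightarrow> x = D0)"
    then obtain y where "y \<in> \<D>" "y \<subseteq> x" "T k y" using dense[of x k] by blast
    then show "\<exists>y. (y \<in> \<D> \<and> (Suc k = 0 \<longrightarrow> y = D0)) \<and> (y \<subseteq> x \<and> T k y)" by auto
  qed
  then obtain D where D: "\<forall>k::nat. (D k \<in> \<D> \<and> (k = 0 \<longrightarrow> D k = D0)) \<and> (D (Suc k) \<subseteq> D k \<and> T k (D (Suc k)))"
    by blast
  have "\<exists>k. t (D k)" if "t \<in> \<T>" for t
  proof -
    have "t \<in> range T" unfolding T using that by simp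
    then obtain k where k: "t = T k" by (rule rangeE)
    show ?thesis unfolding k using D by (intro exI[of _ "Suc k"]) simp
  qed
  moreover have "D 0 = D0" "\<forall>k. D k \<in> \<D> \<and> D (Suc k) \<subseteq> D k" using D by simp_all
  ultimately show ?thesis by (intro exI[of _ D]) simp
qed

text \<open>Forcing conditions: variables are names for the elements of the model to be built, and a
  definable set of assignments is finitely supported information on their values. The ideal
  \<open>small\<close> rules out conditions that leave too few types for the first n names.\<close>

definition conditions :: "language \<Rightarrow> 'a struct \<Rightarrow> nat \<Rightarrow> ('a fm set set \<Rightarrow> bool) \<Rightarrow> (nat \<Rightarrow> 'a) set set" where
  "conditions L M n small = {D. D \<subseteq> assignments M \<and> definable L M {} (\<lambda>e. e \<in> D) \<and>
     \<not> small ((\<lambda>e. n_type L M e n) ` D)}"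

text \<open>The condition that \<open>\<phi>\<close> holds when the name \<open>\<rho> x\<close> is
  put for each variable x.\<close>

definition sat_set :: "'a struct \<Rightarrow> 'a fm \<Rightarrow> (nat \<Rightarrow> nat) \<Rightarrow> (nat \<Rightarrow> 'a) set" where
  "sat_set M \<phi> \<rho> = {e. sat M (\<lambda>x. e (\<rho> x)) \<phi>}"

lemma definable_sat_set: "\<phi> \<in> formulas L {} \<Longrightarrow> definable L M {} (\<lambda>e. e \<in> sat_set M \<phi> \<rho>)"
  using definable_rename[OF definable_by_sat[of \<phi> "formulas L {}" M], of \<rho>]
  by (simp add: sat_set_def)

lemma definable_support:
  assumes "definable L M A P"
  obtains V where "finite V" "depends_on M V P"
proof -
  obtain \<phi> where \<phi>: "\<forall>e\<in>assignments M. P e \<longleftrightarrow> sat M e \<phi>" using assms by (auto simp: definable_by_def)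
  have "depends_on M (fv \<phi>) P"
    unfolding depends_on_def
  proof (intro ballI impI)
    fix e e' assume e: "e \<in> assignments M" "e' \<in> assignments M" "\<forall>x\<in>fv \<phi>. e x = e' x"
    show "P e = P e'" unfolding bspec[OF \<phi> e(1)] bspec[OF \<phi> e(2)] by (rule sat_cong[OF e(3)])
  qed
  then show thesis by (rule that[OF finite_fv])
qed

lemma definable_inter:
  "definable L M A (\<lambda>e. e \<in> D) \<Longrightarrow> definable L M A (\<lambda>e. e \<in> X) \<Longrightarrow> definable L M A (\<lambda>e. e \<in> D \<inter> X)"
  using definable_conj by simp

lemma definable_diff:
  "definable L M A (\<lambda>e. e \<in> D) \<Longrightarrow> definable L M A (\<lambda>e. e \<in> X) \<Longrightarrow> definable L M A (\<lambda>e. e \<in> D - X)"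
  using definable_conj[OF _ definable_not] by simp

text \<open>The types of \<open>D\<close> are the union of those of its two halves, so one half is
  not small.\<close>

lemma conditions_decide:
  assumes small: "\<forall>X Y. small X \<longrightarrow> small Y \<longrightarrow> small (X \<union> Y)"
    and D: "D \<in> conditions L M n small" and X: "definable L M {} (\<lambda>e. e \<in> X)"
  shows "\<exists>D'\<in>conditions L M n small. D' \<subseteq> D \<and> (D' \<subseteq> X \<or> D' \<inter> X = {})"
proof -
  have d: "D \<subseteq> assignments M" "definable L M {} (\<lambda>e. e \<in> D)" "\<not> small ((\<lambda>e. n_type L M e n) ` D)"
    using D by (auto simp: conditions_def)
  have "(\<lambda>e. n_type L M e n) ` D = (\<lambda>e. n_type L M e n) ` (D \<inter> X) \<union> (\<lambda>e. n_type L M e n) ` (D - X)"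
    by blast
  then have "\<not> small ((\<lambda>e. n_type L M e n) ` (D \<inter> X)) \<or> \<not> small ((\<lambda>e. n_type L M e n) ` (D - X))"
    using d(3) small by metis
  then have "D \<inter> X \<in> conditions L M n small \<or> D - X \<in> conditions L M n small"
    using d(1) definable_inter[OF d(2) X] definable_diff[OF d(2) X] by (auto simp: conditions_def)
  then show ?thesis by (meson Diff_disjoint Diff_subset Int_Diff Int_lower1 Int_lower2 disjoint_iff DiffD2)
qed

lemma conditions_witness:
  assumes mono: "\<forall>X Y. small Y \<longrightarrow> X \<subseteq> Y \<longrightarrow> small X"
    and D: "D \<in> conditions L M n small" and \<phi>: "\<phi> \<in> formulas L {}"
    and sub: "D \<subseteq> sat_set M (Exists y \<phi>) \<rho>"
  shows "\<exists>D'\<in>conditions L M n small. D' \<subseteq> D \<and> (\<exists>k. D' \<subseteq> sat_set M \<phi> (\<rho>(y := k)))"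
proof -
  have d: "D \<subseteq> assignments M" "definable L M {} (\<lambda>e. e \<in> D)" "\<not> small ((\<lambda>e. n_type L M e n) ` D)"
    using D by (auto simp: conditions_def)
  obtain V where V: "finite V" "depends_on M V (\<lambda>e. e \<in> D)" using definable_support[OF d(2)] .
  obtain k where k: "k \<notin> V \<union> {..<n} \<union> \<rho> ` fv \<phi>"
    using ex_new_if_finite[of "V \<union> {..<n} \<union> \<rho> ` fv \<phi>"] V(1) by auto
  let ?D = "D \<inter> sat_set M \<phi> (\<rho>(y := k))"
  have "(\<lambda>e. n_type L M e n) ` D \<subseteq> (\<lambda>e. n_type L M e n) ` ?D"
  proof
    fix t assume "t \<in> (\<lambda>e. n_type L M e n) ` D"
    then obtain e where e: "e \<in> D" "t = n_type L M e n" by blast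
    have eM: "e \<in> assignments M" using e d(1) by blast
    obtain a where a: "a \<in> univ M" "sat M ((\<lambda>x. e (\<rho> x))(y := a)) \<phi>"
      using e(1) sub by (auto simp: sat_set_def)
    let ?e = "e(k := a)"
    have eM': "?e \<in> assignments M" using eM a(1) by simp
    have "(e \<in> D) = (?e \<in> D)" by (rule depends_onD[OF V(2) eM eM']) (use k in auto)
    then have "?e \<in> D" using e(1) by simp
    moreover have "sat M (\<lambda>x. ?e ((\<rho>(y := k)) x)) \<phi> \<longleftrightarrow> sat M ((\<lambda>x. e (\<rho> x))(y := a)) \<phi>"
      by (rule sat_cong) (use k in auto)
    then have "?e \<in> sat_set M \<phi> (\<rho>(y := k))" using a(2) by (simp add: sat_set_def)
    moreover have "n_type L M ?e n = t" unfolding e(2) by (rule n_type_cong) (use k in auto)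
    ultimately show "t \<in> (\<lambda>e. n_type L M e n) ` ?D" by blast
  qed
  then have "\<not> small ((\<lambda>e. n_type L M e n) ` ?D)" using mono d(3) by blast
  then have "?D \<in> conditions L M n small"
    using d(1) definable_inter[OF d(2) definable_sat_set[OF \<phi>]] by (auto simp: conditions_def)
  then show ?thesis by blast
qed

text \<open>Codes the renamings by lists. Only the finitely many values at free variables matter, so
  this leaves countably many requirements.\<close>

definition list_fun :: "nat list \<Rightarrow> nat \<Rightarrow> nat" where
  "list_fun l x = (if x < length l then l ! x else 0)"

lemma list_fun_agree: "\<exists>l. \<forall>x\<in>fv \<phi>. list_fun l x = \<rho> x"
proof -
  obtain n where "\<forall>x\<in>fv \<phi>. x < n" using finite_nat_set_iff_bounded[of "fv \<phi>"] by auto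
  then show ?thesis by (intro exI[of _ "map \<rho> [0..<n]"]) (simp add: list_fun_def)
qed

lemma sat_set_cong: "(\<forall>x\<in>fv \<phi>. \<rho> x = \<rho>' x) \<Longrightarrow> sat_set M \<phi> \<rho> = sat_set M \<phi> \<rho>'"
  unfolding sat_set_def by (intro Collect_cong sat_cong) auto

text \<open>The elements of \<open>N\<close> are the names modulo forced equality. The requirements
  \<open>Dec\<close> and \<open>Wit\<close> correspond to negation and existential quantifier in the
  induction showing that truth in \<open>N\<close> is the same as being forced.\<close>

theorem generic_model:
  fixes M :: "'a struct"
  assumes L: "relational L" and M: "is_structure L M" "infinite (univ M)"
    and small: "\<forall>X Y. small X \<longrightarrow> small Y \<longrightarrow> small (X \<union> Y)" "\<forall>X Y. small Y \<longrightarrow> X \<subseteq> Y \<longrightarrow> small X"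
      "small {}" "\<not> small ((\<lambda>e. n_type L M e n) ` assignments M)"
    and \<T>: "countable \<T>"
      "\<And>T D. T \<in> \<T> \<Longrightarrow> D \<in> conditions L M n small \<Longrightarrow> \<exists>D'\<in>conditions L M n small. D' \<subseteq> D \<and> T D'"
  shows "\<exists>(N :: 'a struct) g D. is_structure L N \<and> univ N = range g \<and>
    (\<forall>k. D k \<in> conditions L M n small) \<and> (\<forall>T\<in>\<T>. \<exists>k. T (D k)) \<and>
    (\<forall>\<phi>\<in>formulas L {}. \<forall>\<rho>. sat N (\<lambda>x. g (\<rho> x)) \<phi> \<longleftrightarrow> (\<exists>k::nat. D k \<subseteq> sat_set M \<phi> \<rho>))"
proof -
  define Dec where "Dec = (\<lambda>(\<phi>, l) D. D \<subseteq> sat_set M \<phi> (list_fun l) \<or> D \<inter> sat_set M \<phi> (list_fun l) = {})"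
  define Wit where "Wit = (\<lambda>(\<phi>, l, y) D. D \<inter> sat_set M (Exists y \<phi>) (list_fun l) = {} \<or>
      (\<exists>k. D \<subseteq> sat_set M \<phi> ((list_fun l)(y := k))))"
  let ?\<T> = "\<T> \<union> Dec ` (formulas L {} \<times> UNIV) \<union> Wit ` (formulas L {} \<times> UNIV \<times> UNIV)"
  have ct: "countable ?\<T>"
    using \<T>(1) countable_formulas by (intro countable_Un countable_image countable_SIGMA) auto
  have dense: "\<exists>D'\<in>conditions L M n small. D' \<subseteq> D \<and> T D'"
    if T: "T \<in> ?\<T>" and D: "D \<in> conditions L M n small" for T D
  proof -
    consider "T \<in> \<T>" | \<phi> l where "\<phi> \<in> formulas L {}" "T = Dec (\<phi>, l)"
      | \<phi> l y where "\<phi> \<in> formulas L {}" "T = Wit (\<phi>, l, y)" using T by blast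
    then show ?thesis
    proof cases
      case 1
      then show ?thesis using \<T>(2) D by blast
    next
      case 2
      then show ?thesis
        using conditions_decide[OF small(1) D definable_sat_set[OF 2(1)], of "list_fun l"]
        by (simp add: Dec_def)
    next
      case 3
      have E: "Exists y \<phi> \<in> formulas L {}" using 3(1) by simp
      obtain D1 where D1: "D1 \<in> conditions L M n small" "D1 \<subseteq> D"
        "D1 \<subseteq> sat_set M (Exists y \<phi>) (list_fun l) \<or> D1 \<inter> sat_set M (Exists y \<phi>) (list_fun l) = {}"
        using conditions_decide[OF small(1) D definable_sat_set[OF E], of "list_fun l"] by blast
      show ?thesis
      proof (cases "D1 \<inter> sat_set M (Exists y \<phi>) (list_fun l) = {}")
        case True
        then show ?thesis using D1 3(2) by (auto simp: Wit_def)
      next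
        case False
        then obtain D2 where "D2 \<in> conditions L M n small" "D2 \<subseteq> D1"
          "\<exists>k. D2 \<subseteq> sat_set M \<phi> ((list_fun l)(y := k))"
          using conditions_witness[OF small(2) D1(1) 3(1)] D1(3) by blast
        then show ?thesis using D1(2) 3(2) by (auto simp: Wit_def)
      qed
    qed
  qed
  have "assignments M \<in> conditions L M n small"
  proof -
    have "definable L M {} (\<lambda>e. e \<in> assignments M)"
      using definable_const[of L "{}" M True] by (simp cong: definable_by_cong)
    then show ?thesis using small(4) by (simp add: conditions_def)
  qed
  from generic_sequence[OF this ct dense] obtain D where
    D: "\<And>k. D k \<in> conditions L M n small" "\<And>k. D (Suc k) \<subseteq> D k" and tasks: "\<forall>T\<in>?\<T>. \<exists>k. T (D k)"
    by blast
  have Dmono: "D k' \<subseteq> D k" if "k \<le> k'" for k k' using lift_Suc_antimono_le[of D] D(2) that by blast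
  have Dne: "D k \<noteq> {}" "D k \<subseteq> assignments M" for k
    using D(1)[of k] small(3) by (auto simp: conditions_def)
  \<comment> \<open>The filter generated by the sequence. It is proper because the empty set is
    small, which keeps every \<open>D k\<close> nonempty.\<close>
  define \<Gamma> where "\<Gamma> X \<longleftrightarrow> (\<exists>k. D k \<subseteq> X)" for X
  have \<Gamma>mono: "\<Gamma> Y" if "\<Gamma> X" "X \<inter> assignments M \<subseteq> Y" for X Y
    using that Dne(2) unfolding \<Gamma>_def by blast
  have \<Gamma>int: "\<Gamma> (X \<inter> Y)" if XY: "\<Gamma> X" "\<Gamma> Y" for X Y
  proof -
    obtain k k' where "D k \<subseteq> X" "D k' \<subseteq> Y" using XY by (auto simp: \<Gamma>_def)
    then have "D (max k k') \<subseteq> X \<inter> Y" using Dmono[of k "max k k'"] Dmono[of k' "max k k'"] by auto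
    then show ?thesis by (auto simp: \<Gamma>_def)
  qed
  have \<Gamma>ne: "X \<inter> assignments M \<noteq> {}" if "\<Gamma> X" for X
    using that Dne unfolding \<Gamma>_def by blast
  have dec: "\<Gamma> (sat_set M \<phi> \<rho>) \<or> \<Gamma> (- sat_set M \<phi> \<rho>)" if \<phi>: "\<phi> \<in> formulas L {}" for \<phi> \<rho>
  proof -
    obtain l where l: "\<forall>x\<in>fv \<phi>. list_fun l x = \<rho> x" using list_fun_agree by blast
    have "Dec (\<phi>, l) \<in> ?\<T>" using \<phi> by blast
    with tasks obtain k where "Dec (\<phi>, l) (D k)" by blast
    then show ?thesis unfolding Dec_def \<Gamma>_def by (auto simp: sat_set_cong[OF l])
  qed
  have wit: "\<exists>k. \<Gamma> (sat_set M \<phi> (\<rho>(y := k)))"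
    if \<phi>: "\<phi> \<in> formulas L {}" and ex: "\<Gamma> (sat_set M (Exists y \<phi>) \<rho>)" for \<phi> y \<rho>
  proof -
    obtain l where l: "\<forall>x\<in>fv \<phi>. list_fun l x = \<rho> x" using list_fun_agree by blast
    have "Wit (\<phi>, l, y) \<in> ?\<T>" using \<phi> by blast
    with tasks obtain k where k: "Wit (\<phi>, l, y) (D k)" by blast
    have 1: "sat_set M (Exists y \<phi>) (list_fun l) = sat_set M (Exists y \<phi>) \<rho>"
      by (rule sat_set_cong) (use l in auto)
    have 2: "sat_set M \<phi> ((list_fun l)(y := j)) = sat_set M \<phi> (\<rho>(y := j))" for j
      by (rule sat_set_cong) (use l in auto)
    have "D k \<inter> sat_set M (Exists y \<phi>) \<rho> \<noteq> {}"
    proof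
      assume "D k \<inter> sat_set M (Exists y \<phi>) \<rho> = {}"
      then have "\<Gamma> (- sat_set M (Exists y \<phi>) \<rho>)" unfolding \<Gamma>_def by blast
      from \<Gamma>ne[OF \<Gamma>int[OF ex this]] show False by simp
    qed
    then show ?thesis using k unfolding Wit_def \<Gamma>_def by (auto simp: 1 2)
  qed

  define E where "E i j \<longleftrightarrow> \<Gamma> {e. e i = e j}" for i j :: nat
  have Erefl: "E i i" for i by (auto simp: E_def \<Gamma>_def)
  have Esym: "E j i" if "E i j" for i j
    using that unfolding E_def by (rule \<Gamma>mono) auto
  have Etrans: "E i k" if "E i j" "E j k" for i j k
    unfolding E_def by (rule \<Gamma>mono[OF \<Gamma>int[OF that[unfolded E_def]]]) auto
  \<comment> \<open>The universe of \<open>N\<close> has to lie in \<open>'a\<close>; the infinite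
    universe of \<open>M\<close> provides room for the names.\<close>
  obtain \<iota> :: "nat \<Rightarrow> 'a" where inj: "inj \<iota>"
    using infinite_countable_subset[OF M(2)] by blast
  define g where "g i = \<iota> (LEAST j. E i j)" for i
  have g: "g i = g j \<longleftrightarrow> E i j" for i j
  proof
    assume "g i = g j"
    then have eq: "(LEAST k. E i k) = (LEAST k. E j k)" using inj by (simp add: g_def inj_eq)
    have le: "E i (LEAST k. E i k)" for i using Erefl by (rule LeastI)
    have "E i (LEAST k. E j k)" using le[of i] by (simp only: eq)
    with le[of j] show "E i j" using Etrans Esym by blast
  next
    assume "E i j"
    then have "E i k \<longleftrightarrow> E j k" for k using Etrans Esym by blast
    then show "g i = g j" by (simp add: g_def)
  qed
  define G where "G a = (SOME i. g i = a)" for a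
  have G: "E (G (g i)) i" for i
    unfolding g[symmetric] G_def by (rule someI_ex) blast
  define N :: "'a struct" where "N = \<lparr>univ = range g,
    rel_of = (\<lambda>r n. {xs. length xs = n \<and> set xs \<subseteq> range g \<and> \<Gamma> {e. map e (map G xs) \<in> rel_of M r n}}),
    const_of = const_of M\<rparr>"
  \<comment> \<open>Relations are interpreted through chosen representatives \<open>G\<close> of the
    classes of names; names with forced equality are interchangeable, so the choice has no
    effect.\<close>
  have \<Gamma>rel: "\<Gamma> {e. map e (map G (map g is)) \<in> R} \<longleftrightarrow> \<Gamma> {e. map e is \<in> R}" for "is" R
  proof -
    have "\<Gamma> {e. \<forall>i\<in>set is. e (G (g i)) = e i}"
    proof (induction "is")
      case Nil
      then show ?case by (auto simp: \<Gamma>_def)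
    next
      case (Cons i "is")
      from \<Gamma>int[OF G[of i, unfolded E_def] Cons] show ?case
        by (rule \<Gamma>mono) auto
    qed
    then have *: "\<Gamma> ({e. \<forall>i\<in>set is. e (G (g i)) = e i} \<inter> X)" if "\<Gamma> X" for X using \<Gamma>int that by blast
    have eq: "map e (map G (map g is)) = map e is" if "\<forall>i\<in>set is. e (G (g i)) = e i" for e :: "nat \<Rightarrow> 'a"
      using that by simp
    show ?thesis
    proof
      assume "\<Gamma> {e. map e (map G (map g is)) \<in> R}"
      from *[OF this] show "\<Gamma> {e. map e is \<in> R}"
        by (rule \<Gamma>mono) (intro subsetI CollectI, elim IntE CollectE, simp only: eq)
    next
      assume "\<Gamma> {e. map e is \<in> R}"
      from *[OF this] show "\<Gamma> {e. map e (map G (map g is)) \<in> R}"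
        by (rule \<Gamma>mono) (intro subsetI CollectI, elim IntE CollectE, simp only: eq)
    qed
  qed
  have truth: "\<phi> \<in> formulas L {} \<Longrightarrow> sat N (\<lambda>x. g (\<rho> x)) \<phi> \<longleftrightarrow> \<Gamma> (sat_set M \<phi> \<rho>)" for \<phi> \<rho>
  proof (induction \<phi> arbitrary: \<rho>)
    case (Eq s t)
    then have "atomic (Eq s t)" by simp
    from L Eq this show ?case
    proof (cases rule: atomic_relational)
      case (Eq x y)
      then show ?thesis by (simp add: g E_def sat_set_def)
    qed simp
  next
    case (Rel r ts)
    then have "atomic (Rel r ts)" by simp
    from L Rel this show ?case
    proof (cases rule: atomic_relational)
      case (Rel r' xs)
      have "sat N (\<lambda>x. g (\<rho> x)) (Rel r ts) \<longleftrightarrow>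
          \<Gamma> {e. map e (map G (map g (map \<rho> xs))) \<in> rel_of M r (length xs)}"
        using Rel by (auto simp: N_def comp_def)
      also have "\<dots> \<longleftrightarrow> \<Gamma> {e. map e (map \<rho> xs) \<in> rel_of M r (length xs)}" by (rule \<Gamma>rel)
      also have "\<dots> \<longleftrightarrow> \<Gamma> (sat_set M (Rel r ts) \<rho>)" using Rel by (simp add: sat_set_def comp_def)
      finally show ?thesis .
    qed simp
  next
    case (Neg \<phi>)
    have "sat_set M (Neg \<phi>) \<rho> = - sat_set M \<phi> \<rho>" by (auto simp: sat_set_def)
    \<comment> \<open>One direction is the decision of \<open>\<phi>\<close>, the other is
      properness of the filter.\<close>
    moreover have "\<Gamma> (- sat_set M \<phi> \<rho>) \<longleftrightarrow> \<not> \<Gamma> (sat_set M \<phi> \<rho>)"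
      using dec[of \<phi> \<rho>] Neg.prems \<Gamma>int[of "sat_set M \<phi> \<rho>" "- sat_set M \<phi> \<rho>"] \<Gamma>ne[of "{}"] by auto
    ultimately show ?case using Neg by simp
  next
    case (And \<phi> \<psi>)
    have "sat_set M (And \<phi> \<psi>) \<rho> = sat_set M \<phi> \<rho> \<inter> sat_set M \<psi> \<rho>" by (auto simp: sat_set_def)
    moreover have "\<Gamma> (sat_set M \<phi> \<rho> \<inter> sat_set M \<psi> \<rho>) \<longleftrightarrow> \<Gamma> (sat_set M \<phi> \<rho>) \<and> \<Gamma> (sat_set M \<psi> \<rho>)"
      using \<Gamma>int unfolding \<Gamma>_def by blast
    ultimately show ?case using And by simp
  next
    case (Exists y \<phi>)
    have \<phi>: "\<phi> \<in> formulas L {}" using Exists.prems by simp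
    have "(\<lambda>x. g (\<rho> x))(y := g k) = (\<lambda>x. g ((\<rho>(y := k)) x))" for k by auto
    then have "sat N (\<lambda>x. g (\<rho> x)) (Exists y \<phi>) \<longleftrightarrow> (\<exists>k. sat N (\<lambda>x. g ((\<rho>(y := k)) x)) \<phi>)"
      by (simp add: N_def del: fun_upd_apply)
    also have "\<dots> \<longleftrightarrow> (\<exists>k. \<Gamma> (sat_set M \<phi> (\<rho>(y := k))))"
      unfolding Exists.IH[OF \<phi>] by (rule refl)
    also have "\<dots> \<longleftrightarrow> \<Gamma> (sat_set M (Exists y \<phi>) \<rho>)"
    proof
      assume "\<exists>k. \<Gamma> (sat_set M \<phi> (\<rho>(y := k)))"
      then obtain k where "\<Gamma> (sat_set M \<phi> (\<rho>(y := k)))" by blast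
      then show "\<Gamma> (sat_set M (Exists y \<phi>) \<rho>)"
      proof (rule \<Gamma>mono)
        have "sat M (\<lambda>x. e ((\<rho>(y := k)) x)) \<phi> \<longleftrightarrow> sat M ((\<lambda>x. e (\<rho> x))(y := e k)) \<phi>" for e
          by (rule sat_cong) auto
        then show "sat_set M \<phi> (\<rho>(y := k)) \<inter> assignments M \<subseteq> sat_set M (Exists y \<phi>) \<rho>"
          by (auto simp: sat_set_def intro!: bexI[of _ "_ k"] simp del: fun_upd_apply)
      qed
    qed (use wit[OF \<phi>] in blast)
    finally show ?case .
  qed
  have "is_structure L N" using L by (auto simp: is_structure_def N_def relational_def)
  moreover have "univ N = range g" by (simp add: N_def)
  ultimately show ?thesis using truth D(1) tasks unfolding \<Gamma>_def by blast
qed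

section \<open>Categoricity and algebraic closure\<close>

lemma generic_countable_model:
  fixes M N :: "'a struct"
  assumes M: "infinite (univ M)"
    and N: "is_structure L N" "univ N = range g"
    and D: "D (0::nat) \<subseteq> assignments M"
    and truth: "\<forall>\<phi>\<in>formulas L {}. \<forall>\<rho>. sat N (\<lambda>x. g (\<rho> x)) \<phi> \<longleftrightarrow> (\<exists>k. D k \<subseteq> sat_set M \<phi> \<rho>)"
  shows "N \<in> countable_models L (Th L M)"
proof -
  have hold: "holds N \<phi>" if \<phi>: "\<phi> \<in> formulas L {}" "holds M \<phi>" for \<phi>
    unfolding holds_def
  proof
    fix e assume "e \<in> assignments N"
    then have "\<forall>x. \<exists>k. e x = g k" using N(2) by (auto simp: assignments_def)
    then obtain \<rho> where \<rho>: "\<forall>x. e x = g (\<rho> x)" by metis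
    have "sat M (\<lambda>x. e (\<rho> x)) \<phi>" if "e \<in> assignments M" for e
      using \<phi>(2) assignments_comp[OF that] by (simp add: holds_def)
    then have "D 0 \<subseteq> sat_set M \<phi> \<rho>" using D by (auto simp: sat_set_def)
    then have "sat N (\<lambda>x. g (\<rho> x)) \<phi>" using truth \<phi>(1) by blast
    moreover have "e = (\<lambda>x. g (\<rho> x))" using \<rho> by auto
    ultimately show "sat N e \<phi>" by simp
  qed
  have "infinite (univ N)"
  proof
    assume "finite (univ N)"
    then obtain xs where xs: "set xs = univ N" using finite_list by blast
    let ?m = "length xs"
    \<comment> \<open>A bound on the size of \<open>N\<close> is refuted by the formula saying that
      some element differs from ?m given ones, which holds in the infinite \<open>M\<close> under
      every assignment.\<close>
    let ?\<Phi> = "(\<lambda>i. Neg (Eq (Var ?m) (Var i))) ` {..<?m}"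
    have "\<forall>\<phi>\<in>?\<Phi>. \<phi> \<in> formulas L ({}::'a set) \<and> fv \<phi> \<subseteq> UNIV" by auto
    then obtain \<chi> where \<chi>: "\<chi> \<in> formulas L {}" "\<forall>(M::'a struct) e. sat M e \<chi> \<longleftrightarrow> (\<forall>\<phi>\<in>?\<Phi>. sat M e \<phi>)"
      using ex_conjunction[of ?\<Phi> L "{}" UNIV] by blast
    have ex: "sat M e (Exists ?m \<chi>) \<longleftrightarrow> (\<exists>a\<in>univ M. \<forall>i<?m. a \<noteq> e i)" for M :: "'a struct" and e
      using \<chi>(2) by auto
    have "holds M (Exists ?m \<chi>)" unfolding holds_def ex
    proof
      fix e assume "e \<in> assignments M"
      have "\<not> univ M \<subseteq> e ` {..<?m}" using M finite_subset by blast
      then show "\<exists>a\<in>univ M. \<forall>i<?m. a \<noteq> e i" by blast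
    qed
    then have "holds N (Exists ?m \<chi>)" using hold[of "Exists ?m \<chi>"] \<chi>(1) by simp
    moreover have "(\<lambda>i. if i < ?m then xs ! i else g 0) \<in> assignments N"
      using xs N(2) nth_mem by (intro assignmentsI) fastforce
    ultimately have "sat N (\<lambda>i. if i < ?m then xs ! i else g 0) (Exists ?m \<chi>)"
      unfolding holds_def by (rule bspec)
    then obtain a where "a \<in> set xs" "\<forall>i<?m. a \<noteq> xs ! i" unfolding ex xs by auto
    then show False by (auto simp: in_set_conv_nth)
  qed
  then show ?thesis using N hold by (auto simp: countable_models_def Th_def)
qed

text \<open>
  A generic tuple for the conditions that meet infinitely many \<^term>\<open>n\<close>-types realizes a type
  that is not isolated by any formula, and such a type can be omitted.
\<close>

theorem omega_categorical_finite_types: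
  fixes M :: "'a struct"
  assumes L: "relational L" and M: "is_structure L M" "infinite (univ M)"
    and cat: "omega_categorical L M"
  shows "finite_types L M"
proof (rule ccontr)
  have ne: "univ M \<noteq> {}" using M by auto
  assume "\<not> finite_types L M"
  then obtain n where n: "infinite ((\<lambda>e. n_type L M e n) ` assignments M)"
    by (auto simp: finite_types_def)
  have s1: "\<forall>X Y. finite X \<longrightarrow> finite Y \<longrightarrow> finite (X \<union> Y :: 'a fm set set)"
    "\<forall>X Y. finite Y \<longrightarrow> X \<subseteq> Y \<longrightarrow> finite (X :: 'a fm set set)" "finite ({} :: 'a fm set set)"
    using finite_subset by auto
  obtain N1 g1 D1 where N1: "is_structure L N1" "univ N1 = range g1"
    "\<forall>k. D1 k \<in> conditions L M n finite"
    "\<forall>\<phi>\<in>formulas L {}. \<forall>\<rho>. sat N1 (\<lambda>x. g1 (\<rho> x)) \<phi> \<longleftrightarrow> (\<exists>k::nat. D1 k \<subseteq> sat_set M \<phi> \<rho>)"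
    using generic_model[OF L M s1 n countable_empty] by auto
  define p where "p = n_type L N1 g1 n"
  \<comment> \<open>The omission requirement: the tuple of names listed in \<open>l\<close> does not
    realize \<open>p\<close>.\<close>
  define T where "T l D \<longleftrightarrow> (\<exists>\<phi>\<in>p. D \<subseteq> sat_set M (Neg \<phi>) (list_fun l))" for l D

  \<comment> \<open>If no extension of \<open>D\<close> meets the requirement, then \<open>D\<close>
    forces the named tuple to realize \<open>p\<close>, and projecting \<open>D\<close> to this
    tuple yields a formula that isolates \<open>p\<close>. That formula lies in \<open>p\<close>, so
    some condition of the first construction forces it and meets only one type, although conditions
    there meet infinitely many.\<close>
  have dense: "\<exists>D'\<in>conditions L M n (\<lambda>X. X = {}). D' \<subseteq> D \<and> T l D'"
    if D: "D \<in> conditions L M n (\<lambda>X. X = {})" for D l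
  proof (rule ccontr)
    assume no: "\<not> ?thesis"
    have d: "D \<subseteq> assignments M" "definable L M {} (\<lambda>e. e \<in> D)" "D \<noteq> {}"
      using D by (auto simp: conditions_def)
    have sub: "D \<subseteq> sat_set M \<phi> (list_fun l)" if \<phi>: "\<phi> \<in> p" for \<phi>
    proof (rule ccontr)
      assume "\<not> ?thesis"
      then have "D - sat_set M \<phi> (list_fun l) \<noteq> {}" by blast
      moreover have "\<phi> \<in> formulas L {}" using \<phi> by (simp add: p_def n_type_def)
      ultimately have "D - sat_set M \<phi> (list_fun l) \<in> conditions L M n (\<lambda>X. X = {})"
        using d(1) definable_diff[OF d(2) definable_sat_set] by (auto simp: conditions_def)
      moreover have "T l (D - sat_set M \<phi> (list_fun l))"
        unfolding T_def using \<phi> by (intro bexI[of _ \<phi>]) (auto simp: sat_set_def)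
      ultimately show False using no by blast
    qed
    \<comment> \<open>Coordinates from n on carry an element of \<open>D\<close>, and those below n
      repeat the entries named by \<open>l\<close>. Projecting away the former leaves a formula in n
      variables.\<close>
    define R where "R e' \<longleftrightarrow> (\<lambda>x. e' (n + x)) \<in> D \<and> (\<forall>i\<in>{..<n}. e' (n + list_fun l i) = e' i)" for e'
    define P where "P e \<longleftrightarrow> (\<exists>e'\<in>assignments M. (\<forall>x\<in>{..<n}. e' x = e x) \<and> R e')" for e
    have dP: "definable L M {} P"
      unfolding P_def R_def
      by (intro definable_project definable_conj definable_ball definable_eq
          definable_rename[OF d(2), of "\<lambda>x. n + x"]) simp
    have "P e \<longleftrightarrow> P e'" if "\<forall>x\<in>{..<n}. e x = e' x" for e e'
      using that by (simp add: P_def)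
    from definable_fv[OF dP this ne] obtain \<chi> where \<chi>: "\<chi> \<in> formulas L {}" "fv \<chi> \<subseteq> {..<n}"
      "\<forall>e\<in>assignments M. P e \<longleftrightarrow> sat M e \<chi>"
      by blast
    have iso: "n_type L M e n = p" if e: "e \<in> assignments M" "sat M e \<chi>" for e
    proof -
      obtain e' where e': "e' \<in> assignments M" "\<forall>x\<in>{..<n}. e' x = e x" "R e'"
        using e \<chi>(3) unfolding P_def by blast
      have "n_type L N1 g1 n = n_type L M e n"
      proof (rule n_type_eqI)
        fix \<phi> :: "'a fm" assume \<phi>: "\<phi> \<in> formulas L {}" "fv \<phi> \<subseteq> {..<n}" "sat N1 g1 \<phi>"
        then have "\<phi> \<in> p" by (simp add: p_def n_type_def)
        then have "(\<lambda>x. e' (n + x)) \<in> sat_set M \<phi> (list_fun l)" using sub e'(3) by (auto simp: R_def)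
        then have "sat M (\<lambda>x. e' (n + list_fun l x)) \<phi>" by (simp add: sat_set_def)
        moreover have "e' (n + list_fun l x) = e x" if "x \<in> fv \<phi>" for x
          using that \<phi>(2) e'(2,3) by (auto simp: R_def)
        ultimately show "sat M e \<phi>" using sat_cong[of \<phi> "\<lambda>x. e' (n + list_fun l x)" e M] by simp
      qed
      then show ?thesis by (simp add: p_def)
    qed
    obtain e0 where e0: "e0 \<in> D" using d(3) by blast
    define e1 where "e1 x = (if x < n then e0 (list_fun l x) else e0 (x - n))" for x
    have e0M: "e0 \<in> assignments M" using e0 d(1) by blast
    then have e1: "e1 \<in> assignments M" by (auto simp: e1_def intro!: assignmentsI)
    have "(\<lambda>x. e1 (n + x)) = e0" by (simp add: e1_def fun_eq_iff)
    then have "R e1" using e0 by (simp add: R_def e1_def)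
    then have "P e1" using e1 unfolding P_def by blast
    then have e1\<chi>: "sat M e1 \<chi>" using \<chi>(3) e1 by blast
    then have "\<chi> \<in> n_type L M e1 n" using \<chi> by (simp add: n_type_def)
    then have "\<chi> \<in> p" using iso[OF e1 e1\<chi>] by simp
    then have "sat N1 (\<lambda>x. g1 (id x)) \<chi>" by (simp add: p_def n_type_def)
    then obtain k where k: "D1 k \<subseteq> sat_set M \<chi> id" using N1(4) \<chi>(1) by blast
    have "D1 k \<subseteq> assignments M" "infinite ((\<lambda>e. n_type L M e n) ` D1 k)"
      using N1(3) by (auto simp: conditions_def)
    moreover have "(\<lambda>e. n_type L M e n) ` D1 k \<subseteq> {p}"
      using k iso calculation(1) by (auto simp: sat_set_def)
    ultimately show False using finite_subset by blast
  qed
  \<comment> \<open>Now only the empty set is small, so the conditions are the nonempty definable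
    sets.\<close>
  have s2: "\<forall>X Y. X = {} \<longrightarrow> Y = {} \<longrightarrow> (X \<union> Y :: 'a fm set set) = {}"
    "\<forall>X Y. Y = {} \<longrightarrow> X \<subseteq> Y \<longrightarrow> (X :: 'a fm set set) = {}" "({} :: 'a fm set set) = {}"
    "\<not> (\<lambda>e. n_type L M e n) ` assignments M = {}"
    using assignments_nonempty[OF ne] by auto
  have ct: "countable (range T)" by simp
  have "\<exists>D'\<in>conditions L M n (\<lambda>X. X = {}). D' \<subseteq> D \<and> t D'"
    if "t \<in> range T" "D \<in> conditions L M n (\<lambda>X. X = {})" for t D
    using dense[OF that(2)] that(1) by blast
  from generic_model[OF L M s2 ct this] obtain N2 g2 D2 where
    N2: "is_structure L N2" "univ N2 = range g2" "\<forall>k. D2 k \<in> conditions L M n (\<lambda>X. X = {})"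
    "\<forall>t\<in>range T. \<exists>k. t (D2 k)"
    "\<forall>\<phi>\<in>formulas L {}. \<forall>\<rho>. sat N2 (\<lambda>x. g2 (\<rho> x)) \<phi> \<longleftrightarrow> (\<exists>k::nat. D2 k \<subseteq> sat_set M \<phi> \<rho>)"
    by auto
  have "D1 0 \<subseteq> assignments M" "D2 0 \<subseteq> assignments M"
    using N1(3) N2(3) by (auto simp: conditions_def)
  then have "N1 \<in> countable_models L (Th L M)" "N2 \<in> countable_models L (Th L M)"
    using generic_countable_model[OF M(2) N1(1,2) _ N1(4)]
      generic_countable_model[OF M(2) N2(1,2) _ N2(5)] by auto
  then obtain h where h: "is_iso L h N1 N2" using cat unfolding omega_categorical_def by blast
  have "\<forall>i. \<exists>j. h (g1 i) = g2 j"
    using h N1(2) N2(2) by (auto simp: is_iso_def bij_betw_def)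
  then obtain \<rho> where \<rho>: "\<forall>i. h (g1 i) = g2 (\<rho> i)" by metis
  let ?l = "map \<rho> [0..<n]"
  have "\<exists>k. T ?l (D2 k)" using N2(4) by blast
  then obtain k \<phi> where \<phi>: "\<phi> \<in> p" "D2 k \<subseteq> sat_set M (Neg \<phi>) (list_fun ?l)"
    unfolding T_def by blast
  have \<phi>L: "\<phi> \<in> formulas L {}" "fv \<phi> \<subseteq> {..<n}" "sat N1 g1 \<phi>" using \<phi>(1) by (auto simp: p_def n_type_def)
  have g1: "g1 \<in> assignments N1" using N1(2) by (auto simp: assignments_def)
  have "sat N2 (\<lambda>i. h (g1 i)) \<phi>" using sat_iso_fixed[OF h N1(1) g1 \<phi>L(1)] \<phi>L(3) by simp
  moreover have "sat N2 (\<lambda>i. h (g1 i)) \<phi> \<longleftrightarrow> sat N2 (\<lambda>i. g2 (list_fun ?l i)) \<phi>"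
    by (rule sat_cong) (use \<phi>L(2) \<rho> in \<open>auto simp: list_fun_def\<close>)
  moreover have "sat N2 (\<lambda>i. g2 (list_fun ?l i)) (Neg \<phi>)"
    using N2(5) \<phi>L(1) \<phi>(2) by (metis formulas_simps(1))
  ultimately show False by simp
qed

section \<open>Algebraic closure of a point\<close>

lemma symbols_map_fm [simp]: "symbols (map_fm h \<phi>) = symbols \<phi>"
proof -
  have "tsymbols (map_trm h t) = tsymbols t" for t by (cases t) auto
  then show ?thesis by (induction \<phi>) auto
qed

lemma fv_map_fm [simp]: "fv (map_fm h \<phi>) = fv \<phi>"
proof -
  have "tfv (map_trm h t) = tfv t" for t by (cases t) auto
  then show ?thesis by (induction \<phi>) auto
qed

lemma acl_iso:
  assumes h: "is_iso L h M M" and M: "is_structure L M" and A: "A \<subseteq> univ M"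
  shows "h ` acl L M A \<subseteq> acl L M (h ` A)"
proof
  fix b' assume "b' \<in> h ` acl L M A"
  then obtain b \<phi> x where b: "b' = h b" "b \<in> univ M" "\<phi> \<in> formulas L A" "fv \<phi> \<subseteq> {x}"
    "sat M (\<lambda>_. b) \<phi>" "finite {c\<in>univ M. sat M (\<lambda>_. c) \<phi>}" by (auto simp: acl_def)
  have bij: "bij_betw h (univ M) (univ M)" using h by (simp add: is_iso_def)
  have sat: "sat M (\<lambda>_. h c) (map_fm h \<phi>) \<longleftrightarrow> sat M (\<lambda>_. c) \<phi>" if "c \<in> univ M" for c
    using sat_iso[OF h M assignments_const[OF that] formulas_mono[OF b(3) A]] .
  have "{c\<in>univ M. sat M (\<lambda>_. c) (map_fm h \<phi>)} \<subseteq> h ` {c\<in>univ M. sat M (\<lambda>_. c) \<phi>}"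
  proof
    fix c' assume c': "c' \<in> {c\<in>univ M. sat M (\<lambda>_. c) (map_fm h \<phi>)}"
    then obtain c where "c \<in> univ M" "c' = h c" using bij by (auto simp: bij_betw_def)
    then show "c' \<in> h ` {c\<in>univ M. sat M (\<lambda>_. c) \<phi>}" using c' sat by auto
  qed
  then have "finite {c\<in>univ M. sat M (\<lambda>_. c) (map_fm h \<phi>)}" using b(6) finite_surj by blast
  moreover have "map_fm h \<phi> \<in> formulas L (h ` A)" using b(3) by (auto simp: formulas_def fm.set_map)
  moreover have "h b \<in> univ M" using b(2) bij by (auto simp: bij_betw_def)
  moreover have "sat M (\<lambda>_. h b) (map_fm h \<phi>)" using sat b by simp
  ultimately show "b' \<in> acl L M (h ` A)" using b(1,4) unfolding acl_def
    by (intro CollectI conjI bexI[of _ "map_fm h \<phi>"] exI[of _ x]) auto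
qed

text \<open>Makes algebraicity over \<open>a\<close> visible in 2-types: the parameter moves to
  variable 0 and the point to variable 1.\<close>

lemma acl_definable:
  assumes a: "a \<in> univ M" and \<phi>: "\<phi> \<in> formulas L {a}"
  shows "\<exists>\<psi>\<in>formulas L {}. fv \<psi> \<subseteq> {..<2} \<and> (\<forall>b\<in>univ M.
    sat M (\<lambda>i. if i = 0 then a else b) \<psi> \<longleftrightarrow> sat M (\<lambda>_. b) \<phi>)"
proof -
  have "definable L M (insert a {}) (\<lambda>e. sat M (\<lambda>_. e 1) \<phi>)"
    by (rule definable_rename[OF definable_by_sat[OF \<phi>], where \<rho> = "\<lambda>_. 1"])
  from definable_unparam[OF this a, of 0] obtain Q where
    Q: "definable L M {} Q" "\<forall>e\<in>assignments M. Q (e(0 := a)) \<longleftrightarrow> sat M (\<lambda>_. e 1) \<phi>"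
    by auto
  define P where "P e \<longleftrightarrow> (\<exists>e'\<in>assignments M. (\<forall>x\<in>{..<2::nat}. e' x = e x) \<and> Q e')" for e
  have dP: "definable L M {} P" unfolding P_def by (rule definable_project[OF Q(1)])
  have "P e \<longleftrightarrow> P e'" if "\<forall>x\<in>{..<2}. e x = e' x" for e e' using that by (simp add: P_def)
  moreover have "univ M \<noteq> {}" using a by blast
  ultimately obtain \<psi> where \<psi>: "\<psi> \<in> formulas L {}" "fv \<psi> \<subseteq> {..<2}"
    "\<forall>e\<in>assignments M. P e \<longleftrightarrow> sat M e \<psi>"
    using definable_fv[OF dP, of "{..<2}"] by blast
  have "sat M (\<lambda>i. if i = 0 then a else b) \<psi> \<longleftrightarrow> sat M (\<lambda>_. b) \<phi>" if b: "b \<in> univ M" for b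
  proof -
    let ?e = "\<lambda>i::nat. if i = 0 then a else b"
    have e: "?e \<in> assignments M" using a b by (auto intro: assignmentsI)
    have q: "Q e' \<longleftrightarrow> sat M (\<lambda>_. b) \<phi>" if "e' \<in> assignments M" "\<forall>x\<in>{..<2::nat}. e' x = ?e x" for e'
    proof -
      have "e' 0 = a" "e' 1 = b" using that(2) by auto
      then show ?thesis using bspec[OF Q(2) that(1)] by (metis fun_upd_triv)
    qed
    have "P ?e \<longleftrightarrow> sat M (\<lambda>_. b) \<phi>"
    proof
      assume "P ?e"
      then obtain e' where "e' \<in> assignments M" "\<forall>x\<in>{..<2::nat}. e' x = ?e x" "Q e'"
        unfolding P_def by blast
      then show "sat M (\<lambda>_. b) \<phi>" using q by simp
    next
      assume "sat M (\<lambda>_. b) \<phi>"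
      then have "Q ?e" using q[OF e] by simp
      then show "P ?e" unfolding P_def using e by (intro bexI[of _ ?e]) simp
    qed
    then show ?thesis using \<psi>(3) e by blast
  qed
  then show ?thesis using \<psi> by blast
qed

theorem finite_types_acl:
  assumes L: "relational L" and M: "is_structure L M" "countable (univ M)"
    and fin: "finite_types L M"
  shows "uniformly_finite (univ M) (\<lambda>a. acl L M {a})"
proof -
  define t where "t a b = n_type L M (\<lambda>i. if i = 0 then a else b) 2" for a b
  have pair: "(\<lambda>i::nat. if i = 0 then a else b) \<in> assignments M" if "a \<in> univ M" "b \<in> univ M" for a b
    using that by (auto intro: assignmentsI)
  have finacl: "finite (acl L M {a})" if a: "a \<in> univ M" for a
  proof (rule finite_subset)
    \<comment> \<open>All points with the same 2-type over \<open>a\<close> as an algebraic point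
      satisfy its algebraic formula, so they are finite in number. Finitely many 2-types then cover
      the closure by finite sets.\<close>
    let ?T = "{\<tau>\<in>(\<lambda>e. n_type L M e 2) ` assignments M. finite {c\<in>univ M. t a c = \<tau>}}"
    show "acl L M {a} \<subseteq> (\<Union>\<tau>\<in>?T. {c\<in>univ M. t a c = \<tau>})"
    proof
      fix b assume "b \<in> acl L M {a}"
      then obtain \<phi> where b: "b \<in> univ M" "\<phi> \<in> formulas L {a}" "sat M (\<lambda>_. b) \<phi>"
        "finite {c\<in>univ M. sat M (\<lambda>_. c) \<phi>}" by (auto simp: acl_def)
      obtain \<psi> where \<psi>: "\<psi> \<in> formulas L {}" "fv \<psi> \<subseteq> {..<2}" "\<forall>b\<in>univ M.
        sat M (\<lambda>i. if i = 0 then a else b) \<psi> \<longleftrightarrow> sat M (\<lambda>_. b) \<phi>"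
        using acl_definable[OF a b(2)] by blast
      have "{c\<in>univ M. t a c = t a b} \<subseteq> {c\<in>univ M. sat M (\<lambda>_. c) \<phi>}"
      proof
        fix c assume c: "c \<in> {c\<in>univ M. t a c = t a b}"
        then have "sat M (\<lambda>i. if i = 0 then a else c) \<psi> \<longleftrightarrow> sat M (\<lambda>i. if i = 0 then a else b) \<psi>"
          using \<psi>(1,2) unfolding t_def n_type_eq_iff by blast
        then show "c \<in> {c\<in>univ M. sat M (\<lambda>_. c) \<phi>}" using \<psi>(3) b c by auto
      qed
      then have "finite {c\<in>univ M. t a c = t a b}" using b(4) finite_subset by blast
      moreover have "t a b \<in> (\<lambda>e. n_type L M e 2) ` assignments M"
        unfolding t_def using pair[OF a b(1)] by blast
      ultimately show "b \<in> (\<Union>\<tau>\<in>?T. {c\<in>univ M. t a c = \<tau>})" using b(1) by blast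
    qed
    show "finite (\<Union>\<tau>\<in>?T. {c\<in>univ M. t a c = \<tau>})"
      using fin by (intro finite_UN_I) (auto simp: finite_types_def)
  qed
  define t1 where "t1 a = n_type L M (\<lambda>_. a) 1" for a
  have le: "card (acl L M {a}) \<le> card (acl L M {a'})"
    if a: "a \<in> univ M" "a' \<in> univ M" "t1 a = t1 a'" for a a'
  proof -
    have ne: "univ M \<noteq> {}" using a by blast
    have "elem_equiv L M M" by (simp add: elem_equiv_def)
    \<comment> \<open>Equal 1-types give an automorphism that moves \<open>a\<close> to
      \<open>a'\<close> and embeds one algebraic closure into the other.\<close>
    from back_and_forth[OF L fin this ne ne M(2) M(2) assignments_const[OF a(1)]
        assignments_const[OF a(2)] a(3)[unfolded t1_def]]
    obtain h where h: "is_iso L h M M" "h a = a'" by auto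
    have "h ` acl L M {a} \<subseteq> acl L M {a'}" using acl_iso[OF h(1) M(1), of "{a}"] a h(2) by simp
    moreover have "inj_on h (acl L M {a})"
      by (rule inj_on_subset[of _ "univ M"])
         (use h(1) in \<open>auto simp: is_iso_def bij_betw_def acl_def\<close>)
    ultimately show ?thesis using card_inj_on_le finacl[OF a(2)] by blast
  qed
  define F where "F \<tau> = card (acl L M {SOME a. a \<in> univ M \<and> t1 a = \<tau>})" for \<tau>
  have F: "card (acl L M {a}) = F (t1 a)" if a: "a \<in> univ M" for a
  proof -
    let ?b = "SOME b. b \<in> univ M \<and> t1 b = t1 a"
    have "?b \<in> univ M \<and> t1 ?b = t1 a" by (rule someI[of _ a]) (use a in simp)
    then show ?thesis unfolding F_def using le[OF a, of ?b] le[of ?b a] a by (simp add: antisym)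
  qed
  have "finite (t1 ` univ M)"
  proof (rule finite_subset)
    show "t1 ` univ M \<subseteq> (\<lambda>e. n_type L M e 1) ` assignments M" unfolding t1_def by auto
    show "finite ((\<lambda>e. n_type L M e 1) ` assignments M)" using fin by (simp add: finite_types_def)
  qed
  then have "finite (F ` t1 ` univ M)" by simp
  then obtain K where "\<forall>k\<in>F ` t1 ` univ M. k \<le> K" using finite_nat_set_iff_bounded_le by blast
  then have "\<forall>a\<in>univ M. finite (acl L M {a}) \<and> card (acl L M {a}) \<le> K" using finacl F by simp
  then show ?thesis unfolding uniformly_finite_def by blast
qed

section \<open>Eliminating parameters\<close>

text \<open>Lists the vertices of a finite connected piece so that each entry after the first has an
  earlier neighbour. For a fixed length this is first-order, unlike lying in one component.\<close>

definition tree :: "'a set \<Rightarrow> ('a \<times> 'a) set \<Rightarrow> 'a list \<Rightarrow> bool" where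
  "tree U G ws \<longleftrightarrow> set ws \<subseteq> U \<and> distinct ws \<and> (\<forall>i. 0 < i \<and> i < length ws \<longrightarrow> (\<exists>j<i. (ws ! j, ws ! i) \<in> G))"

lemma tree_take: "tree U G ws \<Longrightarrow> tree U G (take n ws)"
  unfolding tree_def by (auto dest: in_set_takeD) (metis less_trans nth_take)

lemma tree_mono:
  assumes "tree U G ws" "\<And>x y. x \<in> set ws \<Longrightarrow> y \<in> set ws \<Longrightarrow> (x, y) \<in> G \<Longrightarrow> (x, y) \<in> G'"
  shows "tree U G' ws"
  unfolding tree_def
proof (intro conjI allI impI)
  fix i assume i: "0 < i \<and> i < length ws"
  then obtain j where j: "j < i" "(ws ! j, ws ! i) \<in> G" using assms(1) unfolding tree_def by blast
  then show "\<exists>j<i. (ws ! j, ws ! i) \<in> G'" using i assms(2) by (intro exI[of _ j]) simp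
qed (use assms(1) in \<open>simp_all add: tree_def\<close>)

text \<open>While fewer than \<open>N\<close> points are listed, some edge leaves the list, and its
  endpoint is appended.\<close>

lemma ex_tree_reachable:
  assumes a: "a \<in> U" and G: "G \<subseteq> U \<times> U" and R: "infinite (G\<^sup>* `` {a}) \<or> N \<le> card (G\<^sup>* `` {a})"
  shows "\<exists>ws. length ws = N \<and> tree U G ws \<and> set ws \<subseteq> G\<^sup>* `` {a}"
proof -
  have "\<exists>ws. length ws = Suc n \<and> tree U G ws \<and> set ws \<subseteq> G\<^sup>* `` {a} \<and> a \<in> set ws" if "Suc n \<le> N" for n
    using that
  proof (induction n)
    case 0
    show ?case by (rule exI[of _ "[a]"]) (use a in \<open>auto simp: tree_def\<close>)
  next
    case (Suc n)
    then obtain ws where ws: "length ws = Suc n" "tree U G ws" "set ws \<subseteq> G\<^sup>* `` {a}" "a \<in> set ws" by auto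
    have "\<not> G\<^sup>* `` {a} \<subseteq> set ws"
    proof
      assume s: "G\<^sup>* `` {a} \<subseteq> set ws"
      have "card (G\<^sup>* `` {a}) \<le> card (set ws)" by (rule card_mono[OF _ s]) simp
      also have "\<dots> \<le> Suc n" using card_length[of ws] ws(1) by simp
      finally have "card (G\<^sup>* `` {a}) < N" using Suc.prems by simp
      moreover have "finite (G\<^sup>* `` {a})" using s finite_subset by blast
      ultimately show False using R by simp
    qed
    then obtain b where b: "(a, b) \<in> G\<^sup>*" "b \<notin> set ws" by blast
    have "\<exists>x\<in>set ws. \<exists>y. y \<notin> set ws \<and> (x, y) \<in> G"
    proof (rule ccontr)
      assume no: "\<not> ?thesis"
      have "b \<in> set ws" using b(1)
      proof (induction rule: rtrancl_induct)
        case (step y z)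
        then show ?case using no by blast
      qed (use ws(4) in simp)
      then show False using b(2) by simp
    qed
    then obtain x y where xy: "x \<in> set ws" "y \<notin> set ws" "(x, y) \<in> G" by blast
    have "tree U G (ws @ [y])"
      unfolding tree_def
    proof (intro conjI allI impI)
      show "set (ws @ [y]) \<subseteq> U" using ws(2) xy(3) G by (auto simp: tree_def)
      show "distinct (ws @ [y])" using ws(2) xy(2) by (simp add: tree_def)
      fix i assume i: "0 < i \<and> i < length (ws @ [y])"
      show "\<exists>j<i. ((ws @ [y]) ! j, (ws @ [y]) ! i) \<in> G"
      proof (cases "i < length ws")
        case True
        then obtain j where "j < i" "(ws ! j, ws ! i) \<in> G" using ws(2) i unfolding tree_def by blast
        then show ?thesis using True by (intro exI[of _ j]) (simp add: nth_append)
      next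
        case False
        then have "i = length ws" using i by simp
        moreover obtain j where "j < length ws" "ws ! j = x" using xy(1) by (auto simp: in_set_conv_nth)
        ultimately show ?thesis using xy(3) by (intro exI[of _ j]) (simp add: nth_append)
      qed
    qed
    moreover have "y \<in> G\<^sup>* `` {a}" using ws(3) xy by (auto intro: rtrancl_into_rtrancl)
    ultimately show ?case using ws by (intro exI[of _ "ws @ [y]"]) auto
  qed
  from this[of "N - 1"] show ?thesis
    by (cases N) (auto intro: exI[of _ "[]"] simp: tree_def)
qed

text \<open>Deleting \<open>X\<close> splits the tree into pieces, each reached from the first entry
  or from a neighbour of \<open>X\<close>; these are at most \<open>1 + D * d\<close> starting
  points. If no tree of length \<open>N\<close> avoided \<open>X\<close>, each piece would have at
  most \<open>N\<close> points, which with the at most \<open>D\<close> points of \<open>X\<close>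
  gives the bound.\<close>

lemma tree_avoiding:
  assumes G: "G \<subseteq> U \<times> U" and deg: "\<forall>a. finite (G `` {a}) \<and> card (G `` {a}) \<le> d"
    and X: "finite X" "card X \<le> D"
    and ws: "tree U G ws" "length ws > D + (1 + D * d) * N"
  shows "\<exists>ws'. length ws' = N \<and> tree U G ws' \<and> set ws' \<inter> X = {}"
proof (rule ccontr)
  assume no: "\<not> ?thesis"
  define H where "H = G \<inter> (- X) \<times> (- X)"
  have reach: "finite (H\<^sup>* `` {q}) \<and> card (H\<^sup>* `` {q}) \<le> N" if q: "q \<in> U" "q \<notin> X" for q
  proof (rule ccontr)
    assume "\<not> ?thesis"
    moreover have "H \<subseteq> U \<times> U" using G by (auto simp: H_def)
    ultimately obtain vs where vs: "length vs = N" "tree U H vs" "set vs \<subseteq> H\<^sup>* `` {q}"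
      using ex_tree_reachable[of q U H N] q(1) by auto
    have "y \<notin> X" if "(q, y) \<in> H\<^sup>*" for y using that q(2) by (cases rule: rtrancl.cases) (auto simp: H_def)
    then have "set vs \<inter> X = {}" using vs(3) by blast
    moreover have "tree U G vs" using vs(2) by (rule tree_mono) (simp add: H_def)
    ultimately show False using no vs(1) by blast
  qed
  let ?Q = "insert (ws ! 0) (G `` X) - X"
  have pos: "0 < length ws" using ws(2) by (cases ws) auto
  have QU: "q \<in> U" if "q \<in> ?Q" for q using that G ws(1) pos unfolding tree_def by force
  have GX: "finite (G `` X) \<and> card (G `` X) \<le> D * d"
    using bounded_degree_image[OF deg X(1)] X(2) by (meson le_trans mult_le_mono1)
  have "card ?Q \<le> card (insert (ws ! 0) (G `` X))" using GX by (intro card_mono) auto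
  also have "\<dots> \<le> 1 + D * d" using GX by (auto simp: card_insert_if)
  finally have "card ?Q \<le> 1 + D * d" .
  then have "card ?Q * N \<le> (1 + D * d) * N" by (rule mult_le_mono1)
  moreover have "finite (\<Union>q\<in>?Q. H\<^sup>* `` {q}) \<and> card (\<Union>q\<in>?Q. H\<^sup>* `` {q}) \<le> card ?Q * N"
    by (rule card_UN_le_mult) (use reach QU GX in auto)
  ultimately have cU: "finite (\<Union>q\<in>?Q. H\<^sup>* `` {q}) \<and> card (\<Union>q\<in>?Q. H\<^sup>* `` {q}) \<le> (1 + D * d) * N"
    by (meson le_trans)
  have "i < length ws \<Longrightarrow> ws ! i \<in> X \<union> (\<Union>q\<in>?Q. H\<^sup>* `` {q})" for i
  proof (induction i rule: less_induct)
    case (less i)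
    show ?case
    proof (cases "ws ! i \<in> X \<or> i = 0")
      case True
      then show ?thesis by blast
    next
      case False
      then obtain j where j: "j < i" "(ws ! j, ws ! i) \<in> G" using ws(1) less.prems unfolding tree_def by blast
      show ?thesis
      proof (cases "ws ! j \<in> X")
        case True
        then have "ws ! i \<in> ?Q" using j(2) False by blast
        then show ?thesis by blast
      next
        case Fj: False
        then obtain q where q: "q \<in> ?Q" "(q, ws ! j) \<in> H\<^sup>*" using less.IH[OF j(1)] j(1) less.prems by auto
        moreover have "(ws ! j, ws ! i) \<in> H" using j(2) False Fj by (simp add: H_def)
        ultimately have "(q, ws ! i) \<in> H\<^sup>*" by (blast intro: rtrancl_into_rtrancl)
        then show ?thesis using q(1) by blast
      qed
    qed
  qed
  then have sub: "set ws \<subseteq> X \<union> (\<Union>q\<in>?Q. H\<^sup>* `` {q})" unfolding set_conv_nth by blast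
  have "length ws = card (set ws)" using ws(1) by (simp add: tree_def distinct_card)
  also have "\<dots> \<le> card (X \<union> (\<Union>q\<in>?Q. H\<^sup>* `` {q}))" using sub X(1) cU by (intro card_mono) auto
  also have "\<dots> \<le> D + (1 + D * d) * N"
    using card_Un_le[of X "\<Union>q\<in>?Q. H\<^sup>* `` {q}"] X(2) cU by linarith
  finally show False using ws(2) by simp
qed

text \<open>The list is stored in the \<open>N\<close> variables from m on, which are then projected
  away; \<open>R\<close> reads assignments only below m.\<close>

lemma definable_ex_list:
  assumes P: "definable L M A (\<lambda>e. R e (map e [m..<m + N]))"
    and R: "\<And>e e' ws. \<forall>x<m. e x = e' x \<Longrightarrow> R e ws \<longleftrightarrow> R e' ws" and ne: "univ M \<noteq> {}"
  shows "definable L M A (\<lambda>e. \<exists>ws. length ws = N \<and> set ws \<subseteq> univ M \<and> R e ws)"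
proof -
  have "(\<exists>e'\<in>assignments M. (\<forall>x\<in>{..<m}. e' x = e x) \<and> R e' (map e' [m..<m + N])) \<longleftrightarrow>
      (\<exists>ws. length ws = N \<and> set ws \<subseteq> univ M \<and> R e ws)" if e: "e \<in> assignments M" for e
  proof
    assume "\<exists>e'\<in>assignments M. (\<forall>x\<in>{..<m}. e' x = e x) \<and> R e' (map e' [m..<m + N])"
    then obtain e' where e': "e' \<in> assignments M" "\<forall>x<m. e' x = e x" "R e' (map e' [m..<m + N])" by auto
    then have "R e (map e' [m..<m + N])" using R[OF e'(2)] by simp
    then show "\<exists>ws. length ws = N \<and> set ws \<subseteq> univ M \<and> R e ws"
      using e'(1) by (intro exI[of _ "map e' [m..<m + N]"]) (auto simp: assignments_def)
  next
    assume "\<exists>ws. length ws = N \<and> set ws \<subseteq> univ M \<and> R e ws"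
    then obtain ws where ws: "length ws = N" "set ws \<subseteq> univ M" "R e ws" by blast
    define e' where "e' x = (if x < m then e x else if x < m + N then ws ! (x - m) else e x)" for x
    have e': "e' \<in> assignments M"
      unfolding assignments_def using ws e nth_mem by (force simp: e'_def)
    have "map e' [m..<m + N] = ws" using ws(1) by (intro nth_equalityI) (auto simp: e'_def)
    moreover have agree: "\<forall>x<m. e' x = e x" by (simp add: e'_def)
    ultimately have "R e' (map e' [m..<m + N])" using R[OF agree] ws(3) by simp
    then show "\<exists>e'\<in>assignments M. (\<forall>x\<in>{..<m}. e' x = e x) \<and> R e' (map e' [m..<m + N])"
      using e' agree by (intro bexI[of _ e']) auto
  qed
  then show ?thesis using definable_project[OF P, of "{..<m}"] by (simp cong: definable_by_cong)
qed

section \<open>Families of graphs indexed by an element\<close>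

lemma definable_rename3:
  assumes "definable L M A (\<lambda>e. (e 0, e 1, e 2) \<in> \<Gamma>)"
  shows "definable L M A (\<lambda>e. (e i, e j, e k) \<in> \<Gamma>)"
  using definable_rename[OF assms, of "\<lambda>v. if v = 0 then i else if v = 1 then j else k"] by simp

lemma definable_rename1:
  assumes "definable L M A (\<lambda>e. e 0 \<in> Z)"
  shows "definable L M A (\<lambda>e. e i \<in> Z)"
  using definable_rename[OF assms, of "\<lambda>v. i"] by simp

text \<open>Makes \<open>G\<close> one member of a family indexed by the third coordinate, so that
  \<open>p\<close> can be compared with other elements.\<close>

lemma definable_ternary:
  assumes G: "definable L M (insert p A) (\<lambda>e. (e 0, e 1) \<in> G)" "G \<subseteq> univ M \<times> univ M" and p: "p \<in> univ M"
  obtains \<Gamma> where "definable L M A (\<lambda>e. (e 0, e 1, e 2) \<in> \<Gamma>)" "\<forall>x y. (x, y, p) \<in> \<Gamma> \<longleftrightarrow> (x, y) \<in> G"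
proof -
  from definable_unparam[OF G(1) p, of 2] obtain Q where
    Q: "definable L M A Q" "\<forall>e\<in>assignments M. Q (e(2 := p)) \<longleftrightarrow> (e 0, e 1) \<in> G" by auto
  define P where "P e \<longleftrightarrow> (\<exists>e'\<in>assignments M. (\<forall>x\<in>{..<3::nat}. e' x = e x) \<and> Q e')" for e
  have P: "definable L M A P" unfolding P_def by (rule definable_project[OF Q(1)])
  define tr where "tr x y z = (\<lambda>v::nat. if v = 0 then x else if v = 1 then y else z)" for x y z :: 'a
  define \<Gamma> where "\<Gamma> = {(x, y, z). x \<in> univ M \<and> y \<in> univ M \<and> P (tr x y z)}"
  have "(e 0, e 1, e 2) \<in> \<Gamma> \<longleftrightarrow> P e" if "e \<in> assignments M" for e
  proof -
    have "\<forall>x\<in>{..<3}. tr (e 0) (e 1) (e 2) x = e x" by (auto simp: tr_def less_Suc_eq numeral_3_eq_3 numeral_2_eq_2)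
    then have "P (tr (e 0) (e 1) (e 2)) \<longleftrightarrow> P e" by (simp add: P_def)
    then show ?thesis using that by (simp add: \<Gamma>_def)
  qed
  then have "definable L M A (\<lambda>e. (e 0, e 1, e 2) \<in> \<Gamma>)" using P by (simp cong: definable_by_cong)
  moreover have "(x, y, p) \<in> \<Gamma> \<longleftrightarrow> (x, y) \<in> G" for x y
  proof (cases "x \<in> univ M \<and> y \<in> univ M")
    case True
    have q: "Q e' \<longleftrightarrow> (x, y) \<in> G" if e': "e' \<in> assignments M" "\<forall>v\<in>{..<3}. e' v = tr x y p v" for e'
    proof -
      have "e' 0 = x" "e' 1 = y" "e' 2 = p" using e'(2) by (auto simp: tr_def)
      then show ?thesis using bspec[OF Q(2) e'(1)] by (metis fun_upd_triv)
    qed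
    have t: "tr x y p \<in> assignments M" using True p by (auto simp: tr_def intro: assignmentsI)
    have "P (tr x y p) \<longleftrightarrow> (x, y) \<in> G"
    proof
      assume "P (tr x y p)"
      then obtain e' where "e' \<in> assignments M" "\<forall>v\<in>{..<3}. e' v = tr x y p v" "Q e'"
        unfolding P_def by blast
      then show "(x, y) \<in> G" using q by simp
    next
      assume "(x, y) \<in> G"
      then have "Q (tr x y p)" using q[OF t] by simp
      then show "P (tr x y p)" unfolding P_def using t by (intro bexI[of _ "tr x y p"]) simp
    qed
    then show ?thesis using True by (simp add: \<Gamma>_def)
  qed (use G(2) in \<open>auto simp: \<Gamma>_def\<close>)
  ultimately show thesis using that[of \<Gamma>] by blast
qed

lemma sym_edges: "sym (edges M \<Theta>)"
  by (fastforce simp: edges_def clique_graph_def sym_def)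

text \<open>
  For fixed \<^term>\<open>x\<close> and \<^term>\<open>y\<close>, a relation of a mutually algebraic structure only sees a
  finite colour of \<^term>\<open>z\<close>, as long as \<^term>\<open>z\<close> is not adjacent to them.
\<close>

lemma locality:
  fixes M :: "'a struct"
  assumes MA: "mutually_algebraic L M" and ne: "univ M \<noteq> {}" and A: "A \<subseteq> univ M"
    and \<Gamma>: "definable L M A (\<lambda>e. (e 0, e 1, e 2) \<in> \<Gamma>)"
  obtains B and t :: "'a \<Rightarrow> (nat set \<times> ((nat \<Rightarrow> 'a) \<Rightarrow> bool)) set" where
    "sym B" "bounded_degree B" "finite (range t)"
    "\<forall>x\<in>univ M. \<forall>y\<in>univ M. \<forall>z\<in>univ M. \<forall>z'\<in>univ M. (x, z) \<notin> B \<longrightarrow> (y, z) \<notin> B \<longrightarrow>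
      (x, z') \<notin> B \<longrightarrow> (y, z') \<notin> B \<longrightarrow> t z = t z' \<longrightarrow> ((x, y, z) \<in> \<Gamma> \<longleftrightarrow> (x, y, z') \<in> \<Gamma>)"
proof -
  obtain \<phi> where \<phi>: "\<phi> \<in> formulas L A" "\<forall>e\<in>assignments M. (e 0, e 1, e 2) \<in> \<Gamma> \<longleftrightarrow> sat M e \<phi>"
    using \<Gamma> by (auto simp: definable_by_def)
  obtain V \<Theta> where \<Theta>: "MA_preds M V \<Theta>" "determined_by M (snd ` \<Theta>) (\<lambda>e. sat M e \<phi>)"
    using mutually_algebraic_determined[OF MA formulas_mono[OF \<phi>(1) A]] by blast
  obtain a0 where a0: "a0 \<in> univ M" using ne by blast
  \<comment> \<open>The colour of z: the predicates that do not involve the variables of x and y,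
    with the remaining variables set to the fixed \<open>a0\<close>. There are at most as many
    colours as subsets of \<open>\<Theta>\<close>.\<close>
  define t where "t z = {q\<in>\<Theta>. fst q \<inter> {0, 1} = {} \<and> snd q (\<lambda>v. if v = 2 then z else a0)}" for z
  define tr where "tr x y z = (\<lambda>v::nat. if v = 0 then x else if v = 1 then y else if v = 2 then z else a0)"
    for x y z
  have tr: "tr x y z \<in> assignments M" if "x \<in> univ M" "y \<in> univ M" "z \<in> univ M" for x y z
    using that a0 by (auto simp: tr_def intro: assignmentsI)
  have dep: "snd q e \<longleftrightarrow> snd q e'" if "q \<in> \<Theta>" "e \<in> assignments M" "e' \<in> assignments M"
    "\<And>v. v \<in> fst q \<Longrightarrow> e v = e' v" for q e e'
    using \<Theta>(1) that unfolding MA_preds_def by (intro depends_onD[of M "fst q" "snd q"]) auto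
  have far: "\<not> snd q (tr x y z)"
    if q: "q \<in> \<Theta>" "2 \<in> fst q" "fst q \<inter> {0, 1} \<noteq> {}" and U: "x \<in> univ M" "y \<in> univ M" "z \<in> univ M"
      and f: "(x, z) \<notin> edges M \<Theta>" "(y, z) \<notin> edges M \<Theta>" for q x y z
  proof
    assume s: "snd q (tr x y z)"
    obtain v where v: "v \<in> fst q" "v = 0 \<or> v = 1" using q(3) by blast
    have "(tr x y z v, tr x y z 2) \<in> edges M \<Theta>" by (rule edgesI[OF q(1) tr[OF U] s v(1) q(2)])
    then show False using f v(2) by (auto simp: tr_def)
  qed
  have "(x, y, z) \<in> \<Gamma> \<longleftrightarrow> (x, y, z') \<in> \<Gamma>"
    if U: "x \<in> univ M" "y \<in> univ M" "z \<in> univ M" "z' \<in> univ M"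
      and f: "(x, z) \<notin> edges M \<Theta>" "(y, z) \<notin> edges M \<Theta>" "(x, z') \<notin> edges M \<Theta>" "(y, z') \<notin> edges M \<Theta>"
      and eq: "t z = t z'" for x y z z'
  proof -
    have "sat M (tr x y z) \<phi> \<longleftrightarrow> sat M (tr x y z') \<phi>"
    proof (rule determined_byD[OF \<Theta>(2) tr[OF U(1,2,3)] tr[OF U(1,2,4)]])
      fix p assume "p \<in> snd ` \<Theta>"
      then obtain q where q: "q \<in> \<Theta>" "p = snd q" by blast
      \<comment> \<open>A predicate without z keeps its value; one that links z with x or y is
        false, as it would be an edge; any other is part of the colour.\<close>
      consider "2 \<notin> fst q" | "2 \<in> fst q" "fst q \<inter> {0, 1} \<noteq> {}" | "fst q \<inter> {0, 1} = {}" by blast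
      then have "snd q (tr x y z) \<longleftrightarrow> snd q (tr x y z')"
      proof cases
        case 1
        show ?thesis
          by (rule dep[OF q(1) tr[OF U(1,2,3)] tr[OF U(1,2,4)]]) (use 1 in \<open>auto simp: tr_def\<close>)
      next
        case 2
        then show ?thesis using far[OF q(1) 2 U(1,2,3) f(1,2)] far[OF q(1) 2 U(1,2,4) f(3,4)] by simp
      next
        case 3
        have c: "snd q (tr x y w) \<longleftrightarrow> q \<in> t w" if w: "w \<in> univ M" for w
        proof -
          have "snd q (tr x y w) \<longleftrightarrow> snd q (\<lambda>v. if v = 2 then w else a0)"
            by (rule dep[OF q(1) tr[OF U(1,2) w]])
               (use 3 a0 w in \<open>auto simp: tr_def intro: assignmentsI\<close>)
          then show ?thesis using 3 q(1) by (simp add: t_def)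
        qed
        show ?thesis unfolding c[OF U(3)] c[OF U(4)] eq by (rule refl)
      qed
      then show "p (tr x y z) \<longleftrightarrow> p (tr x y z')" by (simp add: q(2))
    qed
    moreover have "(x, y, w) \<in> \<Gamma> \<longleftrightarrow> sat M (tr x y w) \<phi>" if "w \<in> univ M" for w
      using bspec[OF \<phi>(2) tr[OF U(1,2) that]] by (simp add: tr_def)
    ultimately show ?thesis using U by simp
  qed
  moreover have "finite (range t)"
    by (rule finite_subset[of _ "Pow \<Theta>"]) (use \<Theta>(1) in \<open>auto simp: t_def MA_preds_def\<close>)
  ultimately show thesis using that[OF sym_edges bounded_degree_edges[OF \<Theta>(1)], of t] by blast
qed

definition large_components :: "language \<Rightarrow> 'a struct \<Rightarrow> 'a set \<Rightarrow> bool" where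
  "large_components L M A \<longleftrightarrow> (\<exists>G. definable L M A (\<lambda>e. (e 0, e 1) \<in> G) \<and> sym G \<and>
     G \<subseteq> univ M \<times> univ M \<and> bounded_degree G \<and> (\<forall>N. \<exists>ws. length ws = N \<and> tree (univ M) G ws))"

text \<open>Degree at most d as a first-order property. The list holds a vertex followed by d + 1
  neighbours, hence the length d + 2; only its tail has to be distinct, since a vertex may have a
  loop.\<close>

definition degree_le :: "'a set \<Rightarrow> ('a \<times> 'a) set \<Rightarrow> nat \<Rightarrow> bool" where
  "degree_le U G d \<longleftrightarrow> \<not> (\<exists>ws. length ws = d + 2 \<and> set ws \<subseteq> U \<and> distinct (tl ws) \<and>
     (\<forall>i<d + 2. 0 < i \<longrightarrow> (ws ! 0, ws ! i) \<in> G))"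

lemma degree_le_card:
  assumes "degree_le U G d" "Y \<subseteq> G `` {x}" "G \<subseteq> U \<times> U" "finite Y"
  shows "card Y \<le> d"
proof (rule ccontr)
  assume "\<not> ?thesis"
  then obtain Z where Z: "Z \<subseteq> Y" "card Z = d + 1"
    using obtain_subset_with_card_n[of "d + 1" Y] by auto
  then obtain zs where zs: "set zs = Z" "distinct zs"
    using finite_distinct_list[OF finite_subset[OF Z(1) assms(4)]] by blast
  have len: "length zs = d + 1" using zs Z(2) distinct_card by metis
  have G: "(x, z) \<in> G" if "z \<in> set zs" for z using that zs(1) Z(1) assms(2) by blast
  have "\<forall>i<d + 2. 0 < i \<longrightarrow> ((x # zs) ! 0, (x # zs) ! i) \<in> G"
    using G len by (auto simp: nth_Cons split: nat.splits)
  moreover have "set (x # zs) \<subseteq> U"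
  proof -
    have "zs ! 0 \<in> set zs" using len by simp
    then show ?thesis using G assms(3) by auto
  qed
  ultimately show False using assms(1) len zs(2) unfolding degree_le_def
    by (metis add_2_eq_Suc' add_Suc_right length_Cons list.sel(3) One_nat_def add_0_right)
qed

lemma degree_leI:
  assumes "\<forall>a. finite (G `` {a}) \<and> card (G `` {a}) \<le> d"
  shows "degree_le U G d"
  unfolding degree_le_def
proof
  assume "\<exists>ws. length ws = d + 2 \<and> set ws \<subseteq> U \<and> distinct (tl ws) \<and>
     (\<forall>i<d + 2. 0 < i \<longrightarrow> (ws ! 0, ws ! i) \<in> G)"
  then obtain ws where ws: "length ws = d + 2" "distinct (tl ws)"
    "\<forall>i<d + 2. 0 < i \<longrightarrow> (ws ! 0, ws ! i) \<in> G" by blast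
  have "set (tl ws) \<subseteq> G `` {ws ! 0}"
    using ws(1,3) by (auto simp: in_set_conv_nth nth_tl)
  then have "card (set (tl ws)) \<le> card (G `` {ws ! 0})" using assms card_mono by blast
  moreover have "card (set (tl ws)) = d + 1" using ws by (simp add: distinct_card)
  ultimately show False using assms[rule_format, of "ws ! 0"] by simp
qed

lemma degree_leD:
  assumes "degree_le U G d" "G \<subseteq> U \<times> U"
  shows "finite (G `` {x}) \<and> card (G `` {x}) \<le> d"
proof -
  have "finite (G `` {x})"
  proof (rule ccontr)
    assume "\<not> ?thesis"
    then obtain Y where Y: "finite Y" "card Y = d + 1" "Y \<subseteq> G `` {x}"
      using infinite_arbitrarily_large by blast
    then show False using degree_le_card[OF assms(1) Y(3) assms(2) Y(1)] by simp
  qed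
  then show ?thesis using degree_le_card[OF assms(1) subset_refl assms(2)] by simp
qed

text \<open>The points to be avoided form a list of fixed length, possibly with repetitions, which
  keeps the property first-order.\<close>

definition avoiding_trees :: "'a set \<Rightarrow> ('a \<times> 'a) set \<Rightarrow> nat \<Rightarrow> nat \<Rightarrow> bool" where
  "avoiding_trees U G D N \<longleftrightarrow> (\<forall>us. length us = D \<longrightarrow> set us \<subseteq> U \<longrightarrow>
     (\<exists>ws. length ws = N \<and> tree U G ws \<and> set ws \<inter> set us = {}))"

text \<open>A smaller set is padded with copies of \<open>a\<close> to a list of length exactly
  \<open>D\<close>.\<close>

lemma avoiding_treesD:
  assumes "avoiding_trees U G D N" "finite X" "card X \<le> D" "a \<in> U"
  shows "\<exists>ws. length ws = N \<and> tree U G ws \<and> set ws \<inter> X = {}"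
proof -
  obtain xs where xs: "set xs = X \<inter> U" "distinct xs"
    using finite_distinct_list[of "X \<inter> U"] assms(2) by auto
  have "length xs \<le> D" using distinct_card[OF xs(2)] xs(1) assms(2,3) card_mono[of X "X \<inter> U"] by auto
  then have len: "length (xs @ replicate (D - length xs) a) = D" by simp
  have "set (xs @ replicate (D - length xs) a) \<subseteq> U"
    using assms(4) by (simp add: xs(1) set_replicate_conv_if)
  from assms(1)[unfolded avoiding_trees_def, rule_format, OF len this]
  obtain ws where ws: "length ws = N" "tree U G ws"
    "set ws \<inter> set (xs @ replicate (D - length xs) a) = {}" by blast
  then have "set ws \<inter> (X \<inter> U) = {}" unfolding set_append xs(1) by blast
  moreover have "set ws \<subseteq> U" using ws(2) by (simp add: tree_def)
  ultimately show ?thesis using ws(1,2) by blast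
qed

lemma avoiding_trees_antimono:
  assumes "avoiding_trees U G D N" "N' \<le> N"
  shows "avoiding_trees U G D N'"
  unfolding avoiding_trees_def
proof (intro allI impI)
  fix us assume "length us = D" "set us \<subseteq> U"
  then obtain ws where ws: "length ws = N" "tree U G ws" "set ws \<inter> set us = {}"
    using assms(1) unfolding avoiding_trees_def by blast
  then show "\<exists>ws. length ws = N' \<and> tree U G ws \<and> set ws \<inter> set us = {}"
    using tree_take[OF ws(2), of N'] assms(2) set_take_subset[of N' ws]
    by (intro exI[of _ "take N' ws"]) auto
qed

lemma definable_degree_le:
  assumes \<Gamma>: "definable L M A (\<lambda>e. (e 0, e 1, e 2) \<in> \<Gamma>)" and ne: "univ M \<noteq> {}"
  shows "definable L M A (\<lambda>e. degree_le (univ M) {(x, y). (x, y, e 0) \<in> \<Gamma> \<and> (y, x, e 0) \<in> \<Gamma>} d)"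
proof -
  define R where "R e ws \<longleftrightarrow> (\<forall>i\<in>{1..<d + 2}. (\<forall>j\<in>{1..<i}. \<not> ws ! j = ws ! i) \<and>
    (ws ! 0, ws ! i, e 0) \<in> \<Gamma> \<and> (ws ! i, ws ! 0, e 0) \<in> \<Gamma>)" for e :: "nat \<Rightarrow> 'a" and ws
  have nth: "map e [1..<1 + (d + 2)] ! i = e (1 + i)" if "i < d + 2" for i and e :: "nat \<Rightarrow> 'a"
    using that by (simp del: upt_Suc)
  have "definable L M A (\<lambda>e. \<forall>i\<in>{1..<d + 2}. (\<forall>j\<in>{1..<i}. \<not> e (1 + j) = e (1 + i)) \<and>
    (e (1 + 0), e (1 + i), e 0) \<in> \<Gamma> \<and> (e (1 + i), e (1 + 0), e 0) \<in> \<Gamma>)"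
    by (intro definable_ball definable_conj definable_not definable_eq definable_rename3[OF \<Gamma>]) auto
  moreover have "(\<forall>i\<in>{1..<d + 2}. (\<forall>j\<in>{1..<i}. \<not> e (1 + j) = e (1 + i)) \<and>
    (e (1 + 0), e (1 + i), e 0) \<in> \<Gamma> \<and> (e (1 + i), e (1 + 0), e 0) \<in> \<Gamma>) \<longleftrightarrow>
    R e (map e [1..<1 + (d + 2)])" for e
    unfolding R_def by (intro ball_cong refl) (simp add: nth del: upt_Suc map_eq_conv)
  ultimately have "definable L M A (\<lambda>e. R e (map e [1..<1 + (d + 2)]))" by simp
  then have "definable L M A (\<lambda>e. \<exists>ws. length ws = d + 2 \<and> set ws \<subseteq> univ M \<and> R e ws)"
    by (rule definable_ex_list) (use ne in \<open>auto simp: R_def\<close>)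
  from definable_not[OF this] have
    "definable L M A (\<lambda>e. \<not> (\<exists>ws. length ws = d + 2 \<and> set ws \<subseteq> univ M \<and> R e ws))" .
  moreover have "R e ws \<longleftrightarrow> distinct (tl ws) \<and>
      (\<forall>i<d + 2. 0 < i \<longrightarrow> (ws ! 0, ws ! i) \<in> {(x, y). (x, y, e 0) \<in> \<Gamma> \<and> (y, x, e 0) \<in> \<Gamma>})"
    if len: "length ws = d + 2" for e ws
  proof -
    have "distinct (tl ws) \<longleftrightarrow> (\<forall>i\<in>{1..<d + 2}. \<forall>j\<in>{1..<i}. \<not> ws ! j = ws ! i)"
    proof
      assume "distinct (tl ws)"
      then show "\<forall>i\<in>{1..<d + 2}. \<forall>j\<in>{1..<i}. \<not> ws ! j = ws ! i"
        using len by (auto simp: distinct_conv_nth nth_tl Suc_le_eq gr0_conv_Suc)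
    next
      assume *: "\<forall>i\<in>{1..<d + 2}. \<forall>j\<in>{1..<i}. \<not> ws ! j = ws ! i"
      show "distinct (tl ws)"
        unfolding distinct_conv_nth
      proof (intro allI impI)
        fix i j assume ij: "i < length (tl ws)" "j < length (tl ws)" "i \<noteq> j"
        have "ws ! Suc i \<noteq> ws ! Suc j"
          using *[THEN bspec, of "Suc i", THEN bspec, of "Suc j"]
            *[THEN bspec, of "Suc j", THEN bspec, of "Suc i"] ij len
          by (cases "i < j") auto
        then show "tl ws ! i \<noteq> tl ws ! j" using ij by (simp add: nth_tl)
      qed
    qed
    then show ?thesis unfolding R_def by auto
  qed
  ultimately show ?thesis unfolding degree_le_def by (simp cong: conj_cong)
qed

lemma definable_avoiding_trees:
  assumes \<Gamma>: "definable L M A (\<lambda>e. (e 0, e 1, e 2) \<in> \<Gamma>)" and ne: "univ M \<noteq> {}"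
  shows "definable L M A (\<lambda>e. avoiding_trees (univ M) {(x, y). (x, y, e 0) \<in> \<Gamma> \<and> (y, x, e 0) \<in> \<Gamma>} D N)"
proof -
  \<comment> \<open>Variable 0 holds z, the next \<open>D\<close> variables hold \<open>us\<close>,
    and the \<open>N\<close> variables after these hold \<open>ws\<close>.\<close>
  define R where "R z us ws \<longleftrightarrow> (\<forall>i\<in>{..<N}. (\<forall>j\<in>{..<i}. \<not> ws ! j = ws ! i) \<and>
    (i = 0 \<or> (\<exists>j\<in>{..<i}. (ws ! j, ws ! i, z) \<in> \<Gamma> \<and> (ws ! i, ws ! j, z) \<in> \<Gamma>)) \<and>
    (\<forall>j\<in>{..<D}. \<not> ws ! i = us ! j))" for z us ws
  define S where "S e us \<longleftrightarrow> \<not> (\<exists>ws. length ws = N \<and> set ws \<subseteq> univ M \<and> R (e 0) us ws)"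
    for e :: "nat \<Rightarrow> 'a" and us
  have nth: "map e [m..<m + n] ! i = e (m + i)" if "i < n" for i m n and e :: "nat \<Rightarrow> 'a"
    using that by simp
  have "definable L M A (\<lambda>e. \<forall>i\<in>{..<N}. (\<forall>j\<in>{..<i}. \<not> e (1 + D + j) = e (1 + D + i)) \<and>
    (i = 0 \<or> (\<exists>j\<in>{..<i}. (e (1 + D + j), e (1 + D + i), e 0) \<in> \<Gamma> \<and> (e (1 + D + i), e (1 + D + j), e 0) \<in> \<Gamma>)) \<and>
    (\<forall>j\<in>{..<D}. \<not> e (1 + D + i) = e (1 + j)))"
    by (intro definable_ball definable_bex definable_conj definable_disj definable_not
        definable_eq definable_const definable_rename3[OF \<Gamma>]) auto
  moreover have "(\<forall>i\<in>{..<N}. (\<forall>j\<in>{..<i}. \<not> e (1 + D + j) = e (1 + D + i)) \<and>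
    (i = 0 \<or> (\<exists>j\<in>{..<i}. (e (1 + D + j), e (1 + D + i), e 0) \<in> \<Gamma> \<and> (e (1 + D + i), e (1 + D + j), e 0) \<in> \<Gamma>)) \<and>
    (\<forall>j\<in>{..<D}. \<not> e (1 + D + i) = e (1 + j))) \<longleftrightarrow>
    R (e 0) (map e [1..<1 + D]) (map e [1 + D..<1 + D + N])" for e
    unfolding R_def by (intro ball_cong refl) (simp add: nth del: upt_Suc)
  ultimately have "definable L M A (\<lambda>e. R (e 0) (map e [1..<1 + D]) (map e [1 + D..<1 + D + N]))"
    by simp
  then have "definable L M A (\<lambda>e. \<exists>ws. length ws = N \<and> set ws \<subseteq> univ M \<and> R (e 0) (map e [1..<1 + D]) ws)"
  proof (rule definable_ex_list)
    fix e e' :: "nat \<Rightarrow> 'a" and ws assume *: "\<forall>x<1 + D. e x = e' x"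
    have "map e [1..<1 + D] = map e' [1..<1 + D]" by (rule map_cong) (use * in auto)
    then show "R (e 0) (map e [1..<1 + D]) ws \<longleftrightarrow> R (e' 0) (map e' [1..<1 + D]) ws"
      using *[rule_format, of 0] by (simp only: zero_less_Suc plus_1_eq_Suc)
  qed (rule ne)
  from definable_not[OF this] have "definable L M A (\<lambda>e. S e (map e [1..<1 + D]))"
    unfolding S_def .
  then have "definable L M A (\<lambda>e. \<exists>us. length us = D \<and> set us \<subseteq> univ M \<and> S e us)"
    by (rule definable_ex_list) (use ne in \<open>auto simp: S_def\<close>)
  from definable_not[OF this] have
    def: "definable L M A (\<lambda>e. \<not> (\<exists>us. length us = D \<and> set us \<subseteq> univ M \<and> S e us))" .
  have iff: "length ws = N \<and> set ws \<subseteq> univ M \<and> R z us ws \<longleftrightarrow>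
      length ws = N \<and> tree (univ M) {(x, y). (x, y, z) \<in> \<Gamma> \<and> (y, x, z) \<in> \<Gamma>} ws \<and> set ws \<inter> set us = {}"
    if len: "length us = D" for z us ws
  proof (cases "length ws = N")
    case True
    have 1: "distinct ws \<longleftrightarrow> (\<forall>i\<in>{..<N}. \<forall>j\<in>{..<i}. \<not> ws ! j = ws ! i)"
      unfolding distinct_conv_nth True by (metis lessThan_iff less_trans nat_neq_iff)
    have 2: "set ws \<inter> set us = {} \<longleftrightarrow> (\<forall>i\<in>{..<N}. \<forall>j\<in>{..<D}. \<not> ws ! i = us ! j)"
      unfolding set_conv_nth True len by blast
    have 3: "(\<forall>i. 0 < i \<and> i < N \<longrightarrow> (\<exists>j<i. (ws ! j, ws ! i) \<in> {(x, y). (x, y, z) \<in> \<Gamma> \<and> (y, x, z) \<in> \<Gamma>})) \<longleftrightarrow>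
      (\<forall>i\<in>{..<N}. i = 0 \<or> (\<exists>j\<in>{..<i}. (ws ! j, ws ! i, z) \<in> \<Gamma> \<and> (ws ! i, ws ! j, z) \<in> \<Gamma>))"
      unfolding Ball_def Bex_def lessThan_iff mem_Collect_eq split_conv
      by (intro iff_allI) auto
    show ?thesis unfolding tree_def R_def True 1 2 3 by blast
  qed simp
  have "\<not> (\<exists>us. length us = D \<and> set us \<subseteq> univ M \<and> S e us) \<longleftrightarrow>
      avoiding_trees (univ M) {(x, y). (x, y, e 0) \<in> \<Gamma> \<and> (y, x, e 0) \<in> \<Gamma>} D N" for e
  proof -
    let ?T = "\<lambda>us. \<exists>ws. length ws = N \<and>
      tree (univ M) {(x, y). (x, y, e 0) \<in> \<Gamma> \<and> (y, x, e 0) \<in> \<Gamma>} ws \<and> set ws \<inter> set us = {}"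
    have "S e us \<longleftrightarrow> \<not> ?T us" if "length us = D" for us unfolding S_def iff[OF that] ..
    then have "(\<exists>us. length us = D \<and> set us \<subseteq> univ M \<and> S e us) \<longleftrightarrow>
        (\<exists>us. length us = D \<and> set us \<subseteq> univ M \<and> \<not> ?T us)" by (simp cong: conj_cong)
    then show ?thesis unfolding avoiding_trees_def by blast
  qed
  with def show ?thesis by simp
qed

lemma ex_distinct_list:
  assumes "infinite A"
  shows "\<exists>zs. length zs = k \<and> distinct zs \<and> set zs \<subseteq> A"
proof -
  obtain T where T: "finite T" "card T = k" "T \<subseteq> A" using infinite_arbitrarily_large[OF assms] by blast
  then obtain zs where "set zs = T" "distinct zs" using finite_distinct_list by blast
  then show ?thesis using T distinct_card by metis
qed

text \<open>
  If the parameter \<^term>\<open>p\<close> is algebraic over \<^term>\<open>A\<close>, take the union over its conjugates.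
  Otherwise keep those pairs that are edges for many \<^term>\<open>z\<close> behaving like \<^term>\<open>p\<close>; by locality
  this graph still has bounded degree and inherits large trees.
\<close>

lemma large_components_elim:
  fixes M :: "'a struct"
  assumes MA: "mutually_algebraic L M" and A: "A \<subseteq> univ M" and p: "p \<in> univ M"
    and large: "large_components L M (insert p A)"
  shows "large_components L M A"
proof -
  have ne: "univ M \<noteq> {}" using p by blast
  obtain G where G: "definable L M (insert p A) (\<lambda>e. (e 0, e 1) \<in> G)" "sym G"
    "G \<subseteq> univ M \<times> univ M" "bounded_degree G" "\<forall>N. \<exists>ws. length ws = N \<and> tree (univ M) G ws"
    using large unfolding large_components_def by blast
  obtain d where d: "\<forall>a. finite (G `` {a}) \<and> card (G `` {a}) \<le> d"
    using G(4) unfolding bounded_degree_def by blast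
  obtain \<Gamma>' where \<Gamma>': "definable L M A (\<lambda>e. (e 0, e 1, e 2) \<in> \<Gamma>')" "\<forall>x y. (x, y, p) \<in> \<Gamma>' \<longleftrightarrow> (x, y) \<in> G"
    using definable_ternary[OF G(1,3) p] .
  define \<Gamma> where "\<Gamma> = \<Gamma>' \<inter> univ M \<times> univ M \<times> univ M"
  have \<Gamma>: "definable L M A (\<lambda>e. (e 0, e 1, e 2) \<in> \<Gamma>)"
    using \<Gamma>'(1) by (simp add: \<Gamma>_def cong: definable_by_cong)
  have \<Gamma>p: "(x, y, p) \<in> \<Gamma> \<longleftrightarrow> (x, y) \<in> G" for x y using \<Gamma>'(2) G(3) p by (auto simp: \<Gamma>_def)
  \<comment> \<open>The symmetrized fibre over z; over \<open>p\<close> it is \<open>G\<close>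
    itself.\<close>
  define E where "E z = {(x, y). (x, y, z) \<in> \<Gamma> \<and> (y, x, z) \<in> \<Gamma>}" for z
  have Ep: "E p = G" using \<Gamma>p G(2) by (auto simp: E_def sym_def)
  have EU: "E z \<subseteq> univ M \<times> univ M" for z by (auto simp: E_def \<Gamma>_def)
  obtain B and t :: "'a \<Rightarrow> (nat set \<times> ((nat \<Rightarrow> 'a) \<Rightarrow> bool)) set" where
    B: "sym B" "bounded_degree B" "finite (range t)" and
    loc: "\<forall>x\<in>univ M. \<forall>y\<in>univ M. \<forall>z\<in>univ M. \<forall>z'\<in>univ M. (x, z) \<notin> B \<longrightarrow> (y, z) \<notin> B \<longrightarrow>
      (x, z') \<notin> B \<longrightarrow> (y, z') \<notin> B \<longrightarrow> t z = t z' \<longrightarrow> ((x, y, z) \<in> \<Gamma> \<longleftrightarrow> (x, y, z') \<in> \<Gamma>)"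
    using locality[OF MA ne A \<Gamma>] .
  obtain D where D: "\<forall>a. finite (B `` {a}) \<and> card (B `` {a}) \<le> D"
    using B(2) unfolding bounded_degree_def by blast
  have locE: "(x, y) \<in> E z \<longleftrightarrow> (x, y) \<in> E z'"
    if "x \<in> univ M" "y \<in> univ M" "z \<in> univ M" "z' \<in> univ M" "(x, z) \<notin> B" "(y, z) \<notin> B"
      "(x, z') \<notin> B" "(y, z') \<notin> B" "t z = t z'" for x y z z'
  proof -
    have "(x, y, z) \<in> \<Gamma> \<longleftrightarrow> (x, y, z') \<in> \<Gamma>" using loc that by blast
    moreover have "(y, x, z) \<in> \<Gamma> \<longleftrightarrow> (y, x, z') \<in> \<Gamma>" using loc that by blast
    ultimately show ?thesis by (simp add: E_def)
  qed
  \<comment> \<open>Elements that resemble \<open>p\<close> up to trees of size \<open>N\<close>.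
    Here \<open>D\<close> is the degree of \<open>B\<close>, so the trees can be kept away from the
    points adjacent to z, where \<open>locality\<close> applies.\<close>
  define Z where "Z N = {z\<in>univ M. degree_le (univ M) (E z) d \<and> avoiding_trees (univ M) (E z) D N}" for N
  have defZ: "definable L M A (\<lambda>e. e 0 \<in> Z N)" for N
  proof -
    have "definable L M A (\<lambda>e. degree_le (univ M) (E (e 0)) d \<and> avoiding_trees (univ M) (E (e 0)) D N)"
      unfolding E_def
      by (intro definable_conj definable_degree_le[OF \<Gamma> ne] definable_avoiding_trees[OF \<Gamma> ne])
    then show ?thesis by (simp add: Z_def cong: definable_by_cong)
  qed
  have defE: "definable L M A (\<lambda>e. (e i, e j) \<in> E (e k))" for i j k
    unfolding E_def mem_Collect_eq split_conv
    by (intro definable_conj definable_rename3[OF \<Gamma>])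
  have pZ: "p \<in> Z N" for N
  proof -
    have "avoiding_trees (univ M) G D N" unfolding avoiding_trees_def
    proof (intro allI impI)
      fix us :: "'a list" assume us: "length us = D" "set us \<subseteq> univ M"
      obtain ws where "length ws = Suc (D + (1 + D * d) * N)" "tree (univ M) G ws" using G(5) by blast
      then show "\<exists>ws. length ws = N \<and> tree (univ M) G ws \<and> set ws \<inter> set us = {}"
        using tree_avoiding[OF G(3) d, of "set us" D ws N] us(1) card_length[of us] by auto
    qed
    then show ?thesis using p degree_leI[OF d] by (simp add: Z_def Ep)
  qed
  have Zanti: "Z N \<subseteq> Z N'" if "N' \<le> N" for N N'
    using avoiding_trees_antimono[OF _ that] by (auto simp: Z_def)
  have Edeg: "finite (E z `` {x}) \<and> card (E z `` {x}) \<le> d" if "z \<in> Z N" for z x N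
  proof -
    have "degree_le (univ M) (E z) d" using that by (simp add: Z_def)
    then show ?thesis by (rule degree_leD[OF _ EU])
  qed
  have Esym: "(y, x) \<in> E z" if "(x, y) \<in> E z" for x y z using that by (simp add: E_def)
  show ?thesis
  proof (cases "\<exists>N. finite (Z N)")
    case True
    then obtain N0 where N0: "finite (Z N0)" by blast
    define G' where "G' = (\<Union>z\<in>Z N0. E z)"
    have "definable L M A (\<lambda>e. \<exists>a\<in>univ M. (e(2 := a)) 2 \<in> Z N0 \<and> ((e(2 := a)) 0, (e(2 := a)) 1) \<in> E ((e(2 := a)) 2))"
      by (rule definable_ex) (intro definable_conj defE definable_rename1[OF defZ])
    moreover have "(\<exists>a\<in>univ M. (e(2 := a)) 2 \<in> Z N0 \<and> ((e(2 := a)) 0, (e(2 := a)) 1) \<in> E ((e(2 := a)) 2))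
        \<longleftrightarrow> (e 0, e 1) \<in> G'" for e :: "nat \<Rightarrow> 'a"
      by (auto simp: G'_def Z_def)
    ultimately have "definable L M A (\<lambda>e. (e 0, e 1) \<in> G')" by simp
    moreover have "sym G'" using Esym by (auto simp: G'_def sym_def)
    moreover have "G' \<subseteq> univ M \<times> univ M" using EU by (auto simp: G'_def)
    moreover have "bounded_degree G'" unfolding G'_def
      using N0 Edeg by (intro bounded_degree_UN) (auto simp: bounded_degree_def)
    moreover have "\<exists>ws. length ws = N \<and> tree (univ M) G' ws" for N
    proof -
      obtain ws where ws: "length ws = N" "tree (univ M) G ws" using G(5) by blast
      have "tree (univ M) G' ws"
        by (rule tree_mono[OF ws(2)]) (use pZ Ep in \<open>auto simp: G'_def\<close>)
      then show ?thesis using ws(1) by blast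
    qed
    ultimately show ?thesis unfolding large_components_def by blast
  next
    case False
    then have infZ: "infinite (Z N)" for N by blast
    define S where "S = {z\<in>Z 0. finite {z'\<in>Z 0. t z' = t z}}"
    have finS: "finite S"
    proof (rule finite_subset)
      show "S \<subseteq> (\<Union>c\<in>{c\<in>range t. finite {z'\<in>Z 0. t z' = c}}. {z'\<in>Z 0. t z' = c})"
        by (auto simp: S_def)
      show "finite (\<Union>c\<in>{c\<in>range t. finite {z'\<in>Z 0. t z' = c}}. {z'\<in>Z 0. t z' = c})"
        using B(3) by (intro finite_UN_I) auto
    qed
    \<comment> \<open>Among more than \<open>2 * D + card S\<close> witnesses, one is adjacent
      neither to x nor to y and has a colour that occurs infinitely often. The witnesses come from
      \<open>Z 0\<close>, where only the degree bound has content, so that one graph serves trees of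
      every size.\<close>
    define k where "k = Suc (2 * D + card S)"
    define many where "many x y \<longleftrightarrow> (\<exists>zs. length zs = k \<and> set zs \<subseteq> univ M \<and> distinct zs \<and>
      (\<forall>z\<in>set zs. z \<in> Z 0 \<and> (x, y) \<in> E z))" for x y
    define G' where "G' = {(x, y). x \<in> univ M \<and> y \<in> univ M \<and> many x y}"
    have "definable L M A (\<lambda>e. (e 0, e 1) \<in> G')"
    proof -
      define R where "R e zs \<longleftrightarrow> (\<forall>i\<in>{..<k}. (\<forall>j\<in>{..<i}. \<not> zs ! j = zs ! i) \<and>
        zs ! i \<in> Z 0 \<and> (e 0, e 1) \<in> E (zs ! i))" for e :: "nat \<Rightarrow> 'a" and zs
      have "definable L M A (\<lambda>e. \<forall>i\<in>{..<k}. (\<forall>j\<in>{..<i}. \<not> e (2 + j) = e (2 + i)) \<and>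
        e (2 + i) \<in> Z 0 \<and> (e 0, e 1) \<in> E (e (2 + i)))"
        by (intro definable_ball definable_conj definable_not definable_eq defE definable_rename1[OF defZ]) auto
      moreover have "(\<forall>i\<in>{..<k}. (\<forall>j\<in>{..<i}. \<not> e (2 + j) = e (2 + i)) \<and>
        e (2 + i) \<in> Z 0 \<and> (e 0, e 1) \<in> E (e (2 + i))) \<longleftrightarrow> R e (map e [2..<2 + k])" for e
        unfolding R_def by (intro ball_cong refl) (simp del: upt_Suc)
      ultimately have "definable L M A (\<lambda>e. R e (map e [2..<2 + k]))" by simp
      then have "definable L M A (\<lambda>e. \<exists>zs. length zs = k \<and> set zs \<subseteq> univ M \<and> R e zs)"
        by (rule definable_ex_list) (use ne in \<open>auto simp: R_def\<close>)
      moreover have "(\<exists>zs. length zs = k \<and> set zs \<subseteq> univ M \<and> R e zs) \<longleftrightarrow> (e 0, e 1) \<in> G'"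
        if "e \<in> assignments M" for e
      proof -
        have "R e zs \<longleftrightarrow> distinct zs \<and> (\<forall>z\<in>set zs. z \<in> Z 0 \<and> (e 0, e 1) \<in> E z)"
          if len: "length zs = k" for zs
        proof -
          have 1: "distinct zs \<longleftrightarrow> (\<forall>i\<in>{..<k}. \<forall>j\<in>{..<i}. \<not> zs ! j = zs ! i)"
            unfolding distinct_conv_nth len by (metis lessThan_iff less_trans nat_neq_iff)
          have 2: "(\<forall>z\<in>set zs. z \<in> Z 0 \<and> (e 0, e 1) \<in> E z) \<longleftrightarrow>
              (\<forall>i\<in>{..<k}. zs ! i \<in> Z 0 \<and> (e 0, e 1) \<in> E (zs ! i))"
            unfolding set_conv_nth len by blast
          show ?thesis unfolding R_def 1 2 by blast
        qed
        then show ?thesis using that by (auto simp: G'_def many_def)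
      qed
      ultimately show ?thesis by (simp cong: definable_by_cong)
    qed
    moreover have "sym G'"
    proof -
      have "(x, y) \<in> E z \<longleftrightarrow> (y, x) \<in> E z" for x y z using Esym by blast
      then have "many x y \<longleftrightarrow> many y x" for x y unfolding many_def by simp
      then show ?thesis by (auto simp: G'_def sym_def)
    qed
    moreover have "G' \<subseteq> univ M \<times> univ M" by (auto simp: G'_def)
    moreover have "bounded_degree G'"
    proof -
      \<comment> \<open>Neighbours of x that have a far witness of the frequent colour c. Finitely
        many of them share one further z of this colour far from them all, and by locality they all
        are neighbours of x in \<open>E z\<close>; hence there are at most d.\<close>
      define Y where "Y x c = {y\<in>univ M. \<exists>z\<in>Z 0 - S. t z = c \<and> (x, z) \<notin> B \<and> (y, z) \<notin> B \<and> (x, y) \<in> E z}" for x c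
      have sub: "G' `` {x} \<subseteq> (\<Union>c\<in>range t. Y x c)" for x
      proof
        fix y assume "y \<in> G' `` {x}"
        then obtain zs where xy: "x \<in> univ M" "y \<in> univ M" and zs: "length zs = k" "distinct zs"
          "\<forall>z\<in>set zs. z \<in> Z 0 \<and> (x, y) \<in> E z" by (auto simp: G'_def many_def)
        let ?X = "B `` {x} \<union> B `` {y} \<union> S"
        have "card ?X \<le> card (B `` {x}) + card (B `` {y}) + card S"
          by (meson add_le_mono1 card_Un_le le_trans)
        also have "\<dots> < k" using D[rule_format, of x] D[rule_format, of y] by (simp add: k_def)
        also have "k = card (set zs)" using zs(1,2) distinct_card by metis
        finally have "\<not> set zs \<subseteq> ?X" using card_mono[of ?X "set zs"] D finS by auto
        then obtain z where "z \<in> set zs" "z \<notin> ?X" by blast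
        then have "y \<in> Y x (t z)" unfolding Y_def using xy zs(3) by auto
        then show "y \<in> (\<Union>c\<in>range t. Y x c)" by blast
      qed
      have Yd: "finite (Y x c) \<and> card (Y x c) \<le> d" for x c
      proof (rule ccontr)
        assume no: "\<not> ?thesis"
        have "\<exists>T. finite T \<and> card T = Suc d \<and> T \<subseteq> Y x c"
        proof (cases "finite (Y x c)")
          case True
          then show ?thesis using no obtain_subset_with_card_n[of "Suc d" "Y x c"] by auto
        qed (use infinite_arbitrarily_large in blast)
        then obtain T where T: "finite T" "card T = Suc d" "T \<subseteq> Y x c" by blast
        then have "T \<noteq> {}" by auto
        then obtain y0 where "y0 \<in> Y x c" using T(3) by blast
        then obtain z0 where z0: "z0 \<in> Z 0 - S" "t z0 = c" "(x, y0) \<in> E z0" by (auto simp: Y_def)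
        then have xU: "x \<in> univ M" using EU by blast
        have "infinite {z'\<in>Z 0. t z' = c}" using z0 by (auto simp: S_def)
        moreover have fin: "finite (B `` {x} \<union> (\<Union>y\<in>T. B `` {y}))" using D T(1) by auto
        ultimately have "\<not> {z'\<in>Z 0. t z' = c} \<subseteq> B `` {x} \<union> (\<Union>y\<in>T. B `` {y})"
          using finite_subset by blast
        then obtain z where z: "z \<in> Z 0" "t z = c" "(x, z) \<notin> B" "\<forall>y\<in>T. (y, z) \<notin> B" by blast
        have "T \<subseteq> E z `` {x}"
        proof
          fix y assume y: "y \<in> T"
          then obtain z1 where z1: "y \<in> univ M" "z1 \<in> Z 0" "t z1 = c" "(x, z1) \<notin> B" "(y, z1) \<notin> B"
            "(x, y) \<in> E z1" using T(3) by (auto simp: Y_def)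
          have "(x, y) \<in> E z1 \<longleftrightarrow> (x, y) \<in> E z"
            by (rule locE) (use xU y z z1 in \<open>auto simp: Z_def\<close>)
          then show "y \<in> E z `` {x}" using z1 by simp
        qed
        then have "card T \<le> card (E z `` {x})" using Edeg[OF z(1)] card_mono by blast
        then show False using Edeg[OF z(1), of x] T(2) by simp
      qed
      have "finite (\<Union>c\<in>range t. Y x c) \<and> card (\<Union>c\<in>range t. Y x c) \<le> card (range t) * d" for x
        by (rule card_UN_le_mult) (use B(3) Yd in auto)
      then have "finite (G' `` {x}) \<and> card (G' `` {x}) \<le> card (range t) * d" for x
        using sub[of x] by (meson card_mono finite_subset le_trans)
      then show ?thesis unfolding bounded_degree_def by blast
    qed
    moreover have "\<exists>ws. length ws = N \<and> tree (univ M) G' ws" for N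
    proof -
      \<comment> \<open>Take z in \<open>Z N\<close> whose colour occurs infinitely often there, and
        a tree in \<open>E z\<close> away from the neighbours of z. By locality each of its edges
        persists for infinitely many elements of that colour, so it is an edge of
        \<open>G'\<close>.\<close>
      have "finite (t ` Z N)" using B(3) finite_subset[of "t ` Z N" "range t"] by blast
      then obtain z where z: "z \<in> Z N" "infinite {z'\<in>Z N. t z' = t z}"
        using pigeonhole_infinite[OF infZ[of N]] by blast
      have "avoiding_trees (univ M) (E z) D N" using z(1) by (simp add: Z_def)
      from avoiding_treesD[OF this _ _ p, of "B `` {z}"] D
      obtain ws where ws: "length ws = N" "tree (univ M) (E z) ws" "set ws \<inter> B `` {z} = {}" by blast
      have "tree (univ M) G' ws"
      proof (rule tree_mono[OF ws(2)])
        fix x y assume xy: "x \<in> set ws" "y \<in> set ws" "(x, y) \<in> E z"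
        have U: "x \<in> univ M" "y \<in> univ M" using xy(3) EU by blast+
        have far: "(x, z) \<notin> B" "(y, z) \<notin> B" using ws(3) xy(1,2) B(1) by (auto dest: symD)
        have "finite (B `` {x} \<union> B `` {y})" using D by simp
        with z(2) have "infinite ({z'\<in>Z N. t z' = t z} - (B `` {x} \<union> B `` {y}))"
          using Diff_infinite_finite by blast
        from ex_distinct_list[OF this, of k] obtain zs where zs: "length zs = k" "distinct zs"
          "set zs \<subseteq> {z'\<in>Z N. t z' = t z} - (B `` {x} \<union> B `` {y})" by blast
        have "z' \<in> univ M \<and> z' \<in> Z 0 \<and> (x, y) \<in> E z'" if "z' \<in> set zs" for z'
        proof -
          have z': "z' \<in> Z N" "t z' = t z" "(x, z') \<notin> B" "(y, z') \<notin> B" using zs(3) that by auto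
          have "(x, y) \<in> E z \<longleftrightarrow> (x, y) \<in> E z'"
            by (rule locE) (use U far z z' in \<open>auto simp: Z_def\<close>)
          then show ?thesis using xy(3) z'(1) Zanti[of 0 N] by (auto simp: Z_def)
        qed
        then show "(x, y) \<in> G'" unfolding G'_def many_def using U zs(1,2) by blast
      qed
      then show ?thesis using ws(1) by blast
    qed
    ultimately show ?thesis unfolding large_components_def by blast
  qed
qed

text \<open>The points within r steps of \<open>a\<close> form a finite set definable over
  \<open>a\<close> alone, so every point of a tree is algebraic over its first entry.\<close>

lemma large_components_acl:
  fixes M :: "'a struct"
  assumes large: "large_components L M {}"
  shows "\<not> uniformly_finite (univ M) (\<lambda>a. acl L M {a})"
proof
  assume "uniformly_finite (univ M) (\<lambda>a. acl L M {a})"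
  then obtain K where K: "\<forall>a\<in>univ M. finite (acl L M {a}) \<and> card (acl L M {a}) \<le> K"
    unfolding uniformly_finite_def by blast
  obtain G where G: "definable L M {} (\<lambda>e. (e 0, e 1) \<in> G)"
    "G \<subseteq> univ M \<times> univ M" "bounded_degree G" "\<forall>N. \<exists>ws. length ws = N \<and> tree (univ M) G ws"
    using large unfolding large_components_def by blast
  \<comment> \<open>With the identity added, the power r describes the ball of radius r.\<close>
  define R where "R = G \<union> Id"
  have dR: "definable L M {} (\<lambda>e. (e i, e j) \<in> R)" for i j
  proof -
    have "definable L M {} (\<lambda>e. (e i, e j) \<in> G)"
      using definable_rename[OF G(1), of "\<lambda>v. if v = 0 then i else j"] by simp
    then show ?thesis unfolding R_def using definable_disj[OF _ definable_eq[where x = i and y = j]] by simp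
  qed
  have RU: "y \<in> univ M" if "(x, y) \<in> R ^^ r" "x \<in> univ M" for x y r
    using that
  proof (induction r arbitrary: y)
    case (Suc r)
    then show ?case using G(2) unfolding R_def by auto
  qed simp
  have dRr: "definable L M {} (\<lambda>e. (e i, e j) \<in> R ^^ r)" for i j r
  proof (induction r arbitrary: i j)
    case 0
    show ?case by (simp add: definable_eq)
  next
    case (Suc r)
    let ?k = "Suc (max i j)"
    have "definable L M {} (\<lambda>e. \<exists>a\<in>univ M. ((e(?k := a)) i, (e(?k := a)) ?k) \<in> R ^^ r \<and>
        ((e(?k := a)) ?k, (e(?k := a)) j) \<in> R)"
      by (rule definable_ex) (intro definable_conj Suc dR)
    moreover have "(\<exists>a\<in>univ M. ((e(?k := a)) i, (e(?k := a)) ?k) \<in> R ^^ r \<and>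
        ((e(?k := a)) ?k, (e(?k := a)) j) \<in> R) \<longleftrightarrow> (e i, e j) \<in> R ^^ Suc r"
      if "e \<in> assignments M" for e
      using RU[of "e i" _ r] that by (auto simp: relcomp_unfold)
    ultimately show ?case by (simp cong: definable_by_cong)
  qed
  obtain ws where ws: "length ws = Suc K" "tree (univ M) G ws" using G(4) by blast
  define a where "a = ws ! 0"
  have a: "a \<in> univ M" unfolding a_def using ws nth_mem[of 0 ws] by (auto simp: tree_def)
  have acl: "b \<in> acl L M {a}" if b: "(a, b) \<in> R ^^ r" for b r
  proof -
    have d: "definable L M (insert a {}) (\<lambda>e. ((e(0 := a)) 0, (e(0 := a)) 1) \<in> R ^^ r)"
      by (rule definable_upd_param[OF dRr a])
    have ne: "univ M \<noteq> {}" using a by blast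
    have "\<exists>\<phi>\<in>formulas L {a}. fv \<phi> \<subseteq> {1} \<and> (\<forall>e\<in>assignments M.
        ((e(0 := a)) 0, (e(0 := a)) 1) \<in> R ^^ r \<longleftrightarrow> sat M e \<phi>)"
      by (rule definable_fv[OF d _ ne]) simp
    then obtain \<phi> where \<phi>: "\<phi> \<in> formulas L {a}" "fv \<phi> \<subseteq> {1}"
      "\<forall>e\<in>assignments M. (a, e 1) \<in> R ^^ r \<longleftrightarrow> sat M e \<phi>" by auto
    have s: "sat M (\<lambda>_. c) \<phi> \<longleftrightarrow> (a, c) \<in> R ^^ r" if "c \<in> univ M" for c
      using bspec[OF \<phi>(3) assignments_const[OF that]] by simp
    have "bounded_degree (R ^^ r)"
      unfolding R_def by (intro bounded_degree_relpow bounded_degree_Un G(3) bounded_degree_Id)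
    then have "finite ((R ^^ r) `` {a})" unfolding bounded_degree_def by blast
    then have "finite {c\<in>univ M. sat M (\<lambda>_. c) \<phi>}"
      by (rule rev_finite_subset) (auto simp: s)
    then show ?thesis unfolding acl_def using \<phi>(1,2) s RU[OF b a] b by blast
  qed
  have "i < length ws \<Longrightarrow> \<exists>r. (a, ws ! i) \<in> R ^^ r" for i
  proof (induction i rule: less_induct)
    case (less i)
    show ?case
    proof (cases "i = 0")
      case True
      then show ?thesis by (intro exI[of _ 0]) (simp add: a_def)
    next
      case False
      then obtain j where j: "j < i" "(ws ! j, ws ! i) \<in> G"
        using ws(2) less.prems unfolding tree_def by blast
      then obtain r where "(a, ws ! j) \<in> R ^^ r" using less.IH[of j] less.prems by auto
      then have "(a, ws ! i) \<in> R ^^ Suc r" using j(2) by (auto simp: R_def)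
      then show ?thesis by blast
    qed
  qed
  then have "\<forall>i<length ws. ws ! i \<in> acl L M {a}" using acl by blast
  then have "set ws \<subseteq> acl L M {a}" unfolding set_conv_nth by blast
  then have "card (set ws) \<le> card (acl L M {a})" using K a card_mono by blast
  moreover have "card (set ws) = Suc K" using ws by (simp add: tree_def distinct_card)
  ultimately show False using K a by fastforce
qed

section \<open>The equivalences\<close>

lemma definable_rel_graph:
  fixes M M' :: "'a struct"
  assumes L': "relational L'" "is_structure L' M'" "RelSym r n \<in> L'"
    and ex: "qf_expansion L M LN N" "qf_expansion L' M' LN N"
  shows "\<exists>P. finite P \<and> P \<subseteq> univ M \<and> definable L M P (\<lambda>e. (e 0, e 1) \<in> list_graph (rel_of M' r n))"
proof -
  have U: "univ N = univ M" "univ M' = univ M" using ex by (auto simp: qf_expansion_def)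
  let ?\<phi> = "Rel r (map Var [0..<n]) :: 'a fm"
  have "?\<phi> \<in> formulas LN {}" using L'(3) ex(2) by (auto simp: formulas_def qf_expansion_def)
  moreover have "atomic ?\<phi>" by simp
  ultimately obtain \<psi> where \<psi>: "\<psi> \<in> formulas L (univ M)" "equivalent N ?\<phi> \<psi>"
    using ex(1) unfolding qf_expansion_def by blast
  have \<psi>P: "\<psi> \<in> formulas L (params \<psi>)" using \<psi>(1) by (simp add: formulas_def)
  have sat: "sat M e \<psi> \<longleftrightarrow> sat M' e ?\<phi>" if "e \<in> assignments M" for e
  proof -
    have "sat M e \<psi> \<longleftrightarrow> sat N e \<psi>"
      by (rule sat_reduct[where L = L, symmetric])
         (use ex(1) \<psi>(1) in \<open>auto simp: qf_expansion_def formulas_def\<close>)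
    also have "\<dots> \<longleftrightarrow> sat N e ?\<phi>"
      using \<psi>(2) that U by (simp add: equivalent_def assignments_def)
    also have "\<dots> \<longleftrightarrow> sat M' e ?\<phi>"
      by (rule sat_reduct[where L = L'])
         (use ex(2) L'(3) in \<open>auto simp: qf_expansion_def formulas_def\<close>)
    finally show ?thesis .
  qed
  \<comment> \<open>The ends of an edge are placed in the variables n and \<open>Suc n\<close>,
    where they can be set without affecting the atom.\<close>
  define R where "R e \<longleftrightarrow> sat M e \<psi> \<and> (\<exists>i\<in>{..<n}. \<exists>j\<in>{..<n}. e i = e n \<and> e j = e (Suc n))" for e
  have "definable L M (params \<psi>) R"
    unfolding R_def
    by (intro definable_conj definable_bex definable_eq definable_by_sat[OF \<psi>P]) auto
  from definable_rename[OF definable_project[OF this, of "{n, Suc n}"], of "\<lambda>x. if x = n then 0 else 1"]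
  have "definable L M (params \<psi>) (\<lambda>e. \<exists>e'\<in>assignments M. (e' n = e 0 \<and> e' (Suc n) = e 1) \<and> R e')"
    by simp
  moreover have "(\<exists>e'\<in>assignments M. (e' n = e 0 \<and> e' (Suc n) = e 1) \<and> R e') \<longleftrightarrow>
      (e 0, e 1) \<in> list_graph (rel_of M' r n)" if e: "e \<in> assignments M" for e
  proof -
    have "(\<exists>e'\<in>assignments M. (e' n = e 0 \<and> e' (Suc n) = e 1) \<and> R e') \<longleftrightarrow>
        (\<exists>e'\<in>assignments M. sat M' e' ?\<phi> \<and> (\<exists>i<n. \<exists>j<n. e' i = e 0 \<and> e' j = e 1))"
    proof
      assume "\<exists>e'\<in>assignments M. (e' n = e 0 \<and> e' (Suc n) = e 1) \<and> R e'"
      then show "\<exists>e'\<in>assignments M. sat M' e' ?\<phi> \<and> (\<exists>i<n. \<exists>j<n. e' i = e 0 \<and> e' j = e 1)"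
        unfolding R_def using sat by fastforce
    next
      assume "\<exists>e'\<in>assignments M. sat M' e' ?\<phi> \<and> (\<exists>i<n. \<exists>j<n. e' i = e 0 \<and> e' j = e 1)"
      then obtain e' i j where e': "e' \<in> assignments M" "sat M' e' ?\<phi>" "i < n" "j < n"
        "e' i = e 0" "e' j = e 1" by blast
      let ?e = "e'(n := e 0, Suc n := e 1)"
      have eM: "?e \<in> assignments M" using e' e by simp
      have "sat M' ?e ?\<phi> \<longleftrightarrow> sat M' e' ?\<phi>" by (rule sat_cong) auto
      then have "sat M ?e \<psi>" using sat[OF eM] e'(2) by blast
      then have "R ?e" unfolding R_def using e' by (intro conjI bexI[of _ i] bexI[of _ j]) auto
      then show "\<exists>e'\<in>assignments M. (e' n = e 0 \<and> e' (Suc n) = e 1) \<and> R e'"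
        using eM by (intro bexI[of _ ?e]) auto
    qed
    also have "\<dots> \<longleftrightarrow> (e 0, e 1) \<in> clique_graph M' (fv ?\<phi>) (\<lambda>e. sat M' e ?\<phi>)"
      unfolding clique_graph_def using U(2) by (auto simp: assignments_def) metis+
    finally show ?thesis by (simp only: list_graph_rel_of[OF L'(2,3)])
  qed
  ultimately have "definable L M (params \<psi>) (\<lambda>e. (e 0, e 1) \<in> list_graph (rel_of M' r n))"
    by (simp cong: definable_by_cong)
  moreover have "params \<psi> \<subseteq> univ M" using \<psi>(1) by (simp add: formulas_def)
  ultimately show ?thesis by (intro exI[of _ "params \<psi>"]) simp
qed

text \<open>Equations contribute the diagonal and each of the finitely many symbols a Gaifman graph;
  the parameters of their definitions over \<open>M\<close> are collected into one finite
  set.\<close>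

lemma definable_mates:
  fixes M M' :: "'a struct"
  assumes M': "finitely_MA_presented L' M'" and as: "associated L M L' M'"
  obtains P where "finite P" "P \<subseteq> univ M" "definable L M P (\<lambda>e. (e 0, e 1) \<in> mates L' M')"
proof -
  obtain N where ex: "qf_expansion L M (L \<union> L') N" "qf_expansion L' M' (L \<union> L') N"
    using as by (auto simp: associated_def)
  have U: "univ M' = univ M" using ex by (auto simp: qf_expansion_def)
  have L': "finite L'" "relational L'" "is_structure L' M'"
    using M' by (auto simp: finitely_MA_presented_def MA_presented_def)
  have sym: "s = RelSym (name s) (arity s)" if "s \<in> L'" for s
    using that L'(2) by (cases s) (auto simp: relational_def)
  have "\<exists>P. finite P \<and> P \<subseteq> univ M \<and>
      definable L M P (\<lambda>e. (e 0, e 1) \<in> list_graph (rel_of M' (name s) (arity s)))" if "s \<in> L'" for s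
    by (rule definable_rel_graph[OF L'(2,3) _ ex]) (use sym[OF that] that in simp)
  then have "\<forall>s\<in>L'. \<exists>P. finite P \<and> P \<subseteq> univ M \<and>
      definable L M P (\<lambda>e. (e 0, e 1) \<in> list_graph (rel_of M' (name s) (arity s)))" ..
  then obtain P where P: "\<forall>s\<in>L'. finite (P s) \<and> P s \<subseteq> univ M \<and>
      definable L M (P s) (\<lambda>e. (e 0, e 1) \<in> list_graph (rel_of M' (name s) (arity s)))" unfolding bchoice_iff ..
  let ?P = "\<Union>s\<in>L'. P s"
  have "definable L M ?P (\<lambda>e. e 0 = e 1 \<or> (\<exists>s\<in>L'. (e 0, e 1) \<in> list_graph (rel_of M' (name s) (arity s))))"
  proof (intro definable_disj definable_eq definable_bex L'(1))
    fix s assume s: "s \<in> L'"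
    show "definable L M ?P (\<lambda>e. (e 0, e 1) \<in> list_graph (rel_of M' (name s) (arity s)))"
      by (rule definable_mono[where A = "P s"]) (use P s in auto)
  qed
  moreover have "(e 0 = e 1 \<or> (\<exists>s\<in>L'. (e 0, e 1) \<in> list_graph (rel_of M' (name s) (arity s)))) \<longleftrightarrow>
      (e 0, e 1) \<in> mates L' M'" if e: "e \<in> assignments M" for e
  proof
    assume "e 0 = e 1 \<or> (\<exists>s\<in>L'. (e 0, e 1) \<in> list_graph (rel_of M' (name s) (arity s)))"
    then show "(e 0, e 1) \<in> mates L' M'"
    proof
      assume "e 0 = e 1"
      then show ?thesis using mates_refl[of "e 1" M' L'] e U by simp
    next
      assume "\<exists>s\<in>L'. (e 0, e 1) \<in> list_graph (rel_of M' (name s) (arity s))"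
      then obtain s t where "s \<in> L'" "t \<in> rel_of M' (name s) (arity s)" "e 0 \<in> set t" "e 1 \<in> set t"
        by (auto simp: list_graph_def)
      then show ?thesis using rel_of_mates[OF L'(3), of "name s" "arity s" t] sym by auto
    qed
  next
    assume "(e 0, e 1) \<in> mates L' M'"
    then show "e 0 = e 1 \<or> (\<exists>s\<in>L'. (e 0, e 1) \<in> list_graph (rel_of M' (name s) (arity s)))"
      using mates_subset[OF L'(2), of M'] by blast
  qed
  ultimately have "definable L M ?P (\<lambda>e. (e 0, e 1) \<in> mates L' M')" by (simp cong: definable_by_cong)
  moreover have "finite ?P" "?P \<subseteq> univ M" using P L'(1) by auto
  ultimately show thesis using that by blast
qed

theorem acl_bounded_classes:
  fixes M M' :: "'a struct"
  assumes M: "is_structure L M" "mutually_algebraic L M"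
    and acl: "uniformly_finite (univ M) (\<lambda>a. acl L M {a})"
    and M': "finitely_MA_presented L' M'" "associated L M L' M'"
  shows "uniformly_finite (univ M') (ma_class L' M')"
proof (rule ccontr)
  assume no: "\<not> ?thesis"
  have U: "univ M' = univ M" using M'(2) by (auto simp: associated_def qf_expansion_def)
  obtain P where P: "finite P" "P \<subseteq> univ M" "definable L M P (\<lambda>e. (e 0, e 1) \<in> mates L' M')"
    using definable_mates[OF M'] .
  let ?G = "mates L' M'"
  have GU: "?G \<subseteq> univ M \<times> univ M" using mates_univ[of L' M'] U by simp
  have "\<exists>ws. length ws = N \<and> tree (univ M) ?G ws" for N
  proof -
    obtain a where a: "a \<in> univ M" "infinite (ma_class L' M' a) \<or> N < card (ma_class L' M' a)"
      using no U unfolding uniformly_finite_def by (auto simp: not_le)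
    \<comment> \<open>Reflexivity of mates makes the plain and the reflexive transitive closure
      agree at a.\<close>
    have "(a, a) \<in> ?G" using mates_refl[of a M' L'] a(1) U by simp
    then have "?G\<^sup>* `` {a} = ma_class L' M' a"
      unfolding ma_class_def by (auto simp: rtrancl_eq_or_trancl)
    then show ?thesis using ex_tree_reachable[OF a(1) GU, of N] a(2) by auto
  qed
  then have "large_components L M P"
    unfolding large_components_def
    using P(3) mates_sym GU bounded_degree_mates[OF M'(1)] by blast
  with P(1,2) have "large_components L M {}"
  proof (induction P)
    case (insert p P)
    then show ?case using large_components_elim[OF M(2), of P p] by simp
  qed
  then show False using large_components_acl acl by blast
qed

theorem theorem5:
  fixes L :: language and M :: "'a struct"
  assumes "finite L" and "relational L"
    and "is_structure L M"
    and "infinite (univ M)" and "countable (univ M)"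
    and "mutually_algebraic L M"
  shows "(cellular L M \<longleftrightarrow> omega_categorical L M) \<and>
    (omega_categorical L M \<longleftrightarrow> uniformly_finite (univ M) (\<lambda>a. acl L M {a})) \<and>
    (uniformly_finite (univ M) (\<lambda>a. acl L M {a}) \<longleftrightarrow>
       (\<forall>L' (M' :: 'a struct). finitely_MA_presented L' M' \<and> associated L M L' M' \<longrightarrow>
          uniformly_finite (univ M') (ma_class L' M'))) \<and>
    ((\<forall>L' (M' :: 'a struct). finitely_MA_presented L' M' \<and> associated L M L' M' \<longrightarrow>
          uniformly_finite (univ M') (ma_class L' M')) \<longleftrightarrow>
       (\<exists>L' (M' :: 'a struct). finitely_MA_presented L' M' \<and> associated L M L' M' \<and>
          uniformly_finite (univ M') (ma_class L' M')))"
    (is "(?cell \<longleftrightarrow> ?cat) \<and> (?cat \<longleftrightarrow> ?acl) \<and> (?acl \<longleftrightarrow> ?all) \<and> (?all \<longleftrightarrow> ?ex)")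
proof -
  have 12: ?cat if ?cell
    using finite_types_omega_categorical[OF assms(2-5) cellular_finite_types[OF assms(3) that]] .
  have 23: ?acl if ?cat
    using finite_types_acl[OF assms(2,3,5) omega_categorical_finite_types[OF assms(2-4) that]] .
  have 34: ?all if ?acl
    using acl_bounded_classes[OF assms(3,6) that] by blast
  have 45: ?ex if ?all
  proof -
    obtain L' and M' :: "'a struct" where "finitely_MA_presented L' M'" "associated L M L' M'"
      using ex_associated_finitely_MA_presented[OF assms(1-3,6)] .
    then show ?ex using that by blast
  qed
  have 51: ?cell if ?ex
    using that cellular_of_bounded_classes[OF assms(1-3,5)] by blast
  show ?thesis using 12 23 34 45 51 by argo
qed

end
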